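(* Let $\Delta$ be a simplicial complex on the vertex set $V_\Delta=\{x_1,\dots,x_n\}$ and let $F$ be a splitting facet of $\Delta$. Let $\Delta'=\Delta\setminus F$ and $\Omega=\Delta\setminus\mathrm{conn}_\Delta(F)$. Then for all $i\ge 1$ and $j\ge 0$, \[\beta_{i,j}(\mathcal{I}(\Delta))=\beta_{i,j}(\mathcal{I}(\Delta'))+\sum_{l_1=0}^{i}\sum_{l_2=0}^{j-|F|}\beta_{l_1-1,\,l_2}\big(\mathcal{I}(\overline{\mathrm{conn}}_\Delta(F))\big)\,\beta_{i-l_1-1,\,j-|F|-l_2}(\mathcal{I}(\Omega)).\]
   Context: Let $R=k[x_1,\dots,x_n]$ with $k$ an arbitrary field. A simplicial complex $\Delta$ on $V_\Delta$ is a collection of subsets of $V_\Delta$ closed under taking subsets and containing all $\{x_i\}$; facets are its maximal faces, and $\mathcal{F}(\Delta)$ is the set of facets. A face $F$ is also written for the monomial $\prod_{x\in F}x$. The facet ideal is $\mathcal{I}(\Delta)=(\{F\mid F\in\mathcal{F}(\Delta)\})$; a complex with no facets has facet ideal $(0)$. All facet ideals are viewed in $R$. A subcomplex means a simplicial complex whose facet set is a subset of $\mathcal{F}(\Delta)$ (on the vertices occurring in its facets). $\Delta\setminus F$ is the complex with facet set $\mathcal{F}(\Delta)\setminus\{F\}$, and for a subcomplex $\Gamma$, $\Delta\setminus\Gamma$ is the complex with facet set $\mathcal{F}(\Delta)\setminus\mathcal{F}(\Gamma)$. Two facets $F,G$ are connected if there is a chain of facets $F=F_0,\dots,F_m=G$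 with $F_i\cap F_{i+1}\ne\emptyset$ for all $i$. $\mathrm{conn}_\Delta(F)$ is the connected component of $\Delta$ containing $F$ (the subcomplex whose facets are all facets of $\Delta$ connected to $F$). If $G_1,\dots,G_p$ are the facets of $\mathrm{conn}_\Delta(F)\setminus F$, then $\overline{\mathrm{conn}}_\Delta(F)$ is the simplicial complex whose facets are the inclusion-minimal sets among $G_1\setminus F,\dots,G_p\setminus F$ (each occurring once). Betti numbers: $\beta_{i,j}(I)=\dim_k\mathrm{Tor}_i^R(I,k)_j$ for $i\ge0$; by convention, for every ideal $I$ (including $(0)$), $\beta_{-1,0}(I)=1$ and $\beta_{-1,j}(I)=0$ for $j\ne0$. Splittings: $\mathcal{G}(I)$ is the minimal set of monomial generators of a monomial ideal $I$. An expression $I=J+K$ with $J,K$ nonzero monomial ideals is a splitting of $I$ if (1) $\mathcal{G}(I)$ is the disjoint union of $\mathcal{G}(J)$ and $\mathcal{G}(K)$, and (2) there is a function $\mathcal{G}(J\cap K)\to\mathcal{G}(J)\times\mathcal{G}(K)$, $w\mapsto(\phi(w),\psi(w))$, such that (a) $w=\mathrm{lcm}(\phi(w),\psi(w))$ for all $w$, and (b) for every nonempty $S\subseteq\mathcal{G}(J\cap K)$, both $\mathrm{lcm}(\phi(S))$ and $\mathrm{lcm}(\psi(S))$ strictly divide $\mathrm{lcm}(S)$. A facet $F$ of $\Delta$ is a splitting facet if $\mathcal{I}(\Delta)=(F)+\mathcal{I}(\Delta\setminus F)$ is a splitting. *)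

theory Defs
  imports Main "HOL-Library.Poly_Mapping" "HOL-Library.Function_Algebras"
    "HOL-Library.Indicator_Function"
begin

section \<open>The polynomial ring and its monomial ideals\<close>

text \<open>
  The variables are the elements of a finite type \<open>'x\<close>.  A monomial is its exponent vector
  \<open>'x \<Rightarrow> nat\<close>, with pointwise addition (Function_Algebras) as product of monomials.  In
  the pointwise order of function types, \<open>\<le>\<close> is divisibility, \<open><\<close> is strict divisibility,
  \<open>sup\<close> is the lcm of two monomials and \<open>Sup\<close> is the lcm of a finite set of monomials.
\<close>

type_synonym 'x monomial = "'x \<Rightarrow> nat"

type_synonym ('x, 'k) mpoly = "'x monomial \<Rightarrow>\<^sub>0 'k"

definition monom :: "'x monomial \<Rightarrow> ('x, 'k::field) mpoly" where
  "monom m = Poly_Mapping.single m 1"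

text \<open>The span in the ring, regarded as a module over itself, is the generated ideal.\<close>

abbreviation ideal_gen :: "('x, 'k::field) mpoly set \<Rightarrow> ('x, 'k) mpoly set" where
  "ideal_gen \<equiv> module.span (*)"

definition monomial_ideal :: "('x, 'k::field) mpoly set \<Rightarrow> bool" where
  "monomial_ideal I \<longleftrightarrow> (\<exists>A. I = ideal_gen (monom ` A))"

text \<open>Unique for a monomial ideal, and finite because \<open>'x\<close> is.\<close>

definition min_mon_gens :: "('x, 'k::field) mpoly set \<Rightarrow> 'x monomial set" where
  "min_mon_gens I =
    (THE A. ideal_gen (monom ` A) = I \<and> (\<forall>B. B \<subset> A \<longrightarrow> ideal_gen (monom ` B) \<noteq> I))"

definition is_splitting ::
  "('x, 'k::field) mpoly set \<Rightarrow> ('x, 'k) mpoly set \<Rightarrow> ('x, 'k) mpoly set \<Rightarrow> bool" where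
  "is_splitting I J K \<longleftrightarrow>
     monomial_ideal J \<and> monomial_ideal K \<and> J \<noteq> {0} \<and> K \<noteq> {0} \<and>
     I = {p + q |p q. p \<in> J \<and> q \<in> K} \<and>
     min_mon_gens I = min_mon_gens J \<union> min_mon_gens K \<and>
     min_mon_gens J \<inter> min_mon_gens K = {} \<and>
     (\<exists>\<phi> \<psi>.
        (\<forall>w\<in>min_mon_gens (J \<inter> K).
           \<phi> w \<in> min_mon_gens J \<and> \<psi> w \<in> min_mon_gens K \<and> w = sup (\<phi> w) (\<psi> w)) \<and>
        (\<forall>S. S \<subseteq> min_mon_gens (J \<inter> K) \<and> S \<noteq> {} \<longrightarrow>
           Sup (\<phi> ` S) < Sup S \<and> Sup (\<psi> ` S) < Sup S))"

section \<open>Graded Betti numbers\<close>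

definition mdeg :: "'x::finite monomial \<Rightarrow> nat" where
  "mdeg m = (\<Sum>x\<in>UNIV. m x)"

definition homogeneous :: "int \<Rightarrow> ('x::finite, 'k::field) mpoly \<Rightarrow> bool" where
  "homogeneous d p \<longleftrightarrow> (\<forall>m\<in>Poly_Mapping.keys p. int (mdeg m) = d)"

text \<open>
  Data of an augmented complex of finitely generated graded free modules over \<open>R\<close>
  (elements of type \<open>'r\<close>), \<open>\<dots> \<rightarrow> F\<^sub>2 \<rightarrow> F\<^sub>1 \<rightarrow> F\<^sub>0 \<rightarrow> R\<close>.
  \<open>F\<^sub>i\<close> has the basis \<open>e\<^sub>i\<^sub>,\<^sub>a\<close> for \<open>a < rk C i\<close>, where \<open>e\<^sub>i\<^sub>,\<^sub>a\<close> has degree \<open>bdeg C i a\<close>.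
  The differential maps \<open>e\<^sub>i\<^sub>+\<^sub>1\<^sub>,\<^sub>a\<close> to the sum of all \<open>dmat C i a b \<cdot> e\<^sub>i\<^sub>,\<^sub>b\<close>, and the
  augmentation maps \<open>e\<^sub>0\<^sub>,\<^sub>a\<close> to \<open>aug C a\<close>.
\<close>

record 'r free_complex =
  rk :: "nat \<Rightarrow> nat"
  bdeg :: "nat \<Rightarrow> nat \<Rightarrow> int"
  dmat :: "nat \<Rightarrow> nat \<Rightarrow> nat \<Rightarrow> 'r"
  aug :: "nat \<Rightarrow> 'r"

definition free_mod :: "('x, 'k::field) mpoly free_complex \<Rightarrow> nat \<Rightarrow> (nat \<Rightarrow> ('x, 'k) mpoly) set" where
  "free_mod C i = {u. \<forall>a\<ge>rk C i. u a = 0}"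

text \<open>The map from \<open>F\<^sub>i\<^sub>+\<^sub>1\<close> to \<open>F\<^sub>i\<close>.\<close>

definition bd ::
  "('x, 'k::field) mpoly free_complex \<Rightarrow> nat \<Rightarrow> (nat \<Rightarrow> ('x, 'k) mpoly) \<Rightarrow> nat \<Rightarrow> ('x, 'k) mpoly" where
  "bd C i u = (\<lambda>b. if b < rk C i then \<Sum>a<rk C (Suc i). u a * dmat C i a b else 0)"

definition augment ::
  "('x, 'k::field) mpoly free_complex \<Rightarrow> (nat \<Rightarrow> ('x, 'k) mpoly) \<Rightarrow> ('x, 'k) mpoly" where
  "augment C u = (\<Sum>a<rk C 0. u a * aug C a)"

definition graded_free_resolution ::
  "('x::finite, 'k::field) mpoly free_complex \<Rightarrow> ('x, 'k) mpoly set \<Rightarrow> bool" where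
  "graded_free_resolution C I \<longleftrightarrow>
     (\<forall>a<rk C 0. homogeneous (bdeg C 0 a) (aug C a)) \<and>
     (\<forall>i. \<forall>a<rk C (Suc i). \<forall>b<rk C i.
        homogeneous (bdeg C (Suc i) a - bdeg C i b) (dmat C i a b)) \<and>
     augment C ` free_mod C 0 = I \<and>
     {u \<in> free_mod C 0. augment C u = 0} = bd C 0 ` free_mod C 1 \<and>
     (\<forall>i. {u \<in> free_mod C (Suc i). bd C i u = 0} = bd C (Suc i) ` free_mod C (Suc (Suc i)))"

text \<open>
  The complex \<open>F \<otimes> k\<close>: here \<open>F\<^sub>i \<otimes> k\<close> is the \<open>k\<close>-vector space on the same basis, and a matrix
  entry acts on \<open>k\<close> (the residue field at the ideal of all variables) through its constant
  coefficient.
\<close>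

definition tens :: "('x, 'k::field) mpoly free_complex \<Rightarrow> nat \<Rightarrow> int \<Rightarrow> (nat \<Rightarrow> 'k) set" where
  "tens C i j = {v. \<forall>a. v a \<noteq> 0 \<longrightarrow> a < rk C i \<and> bdeg C i a = j}"

definition tens_bd ::
  "('x, 'k::field) mpoly free_complex \<Rightarrow> nat \<Rightarrow> (nat \<Rightarrow> 'k) \<Rightarrow> nat \<Rightarrow> 'k" where
  "tens_bd C i v =
    (\<lambda>b. if b < rk C i
         then \<Sum>a<rk C (Suc i). v a * Poly_Mapping.lookup (dmat C i a b) 0 else 0)"

definition tor_cycles :: "('x, 'k::field) mpoly free_complex \<Rightarrow> nat \<Rightarrow> int \<Rightarrow> (nat \<Rightarrow> 'k) set" where
  "tor_cycles C i j =
    (case i of 0 \<Rightarrow> tens C 0 j | Suc i' \<Rightarrow> {v \<in> tens C (Suc i') j. tens_bd C i' v = 0})"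

definition tor_boundaries :: "('x, 'k::field) mpoly free_complex \<Rightarrow> nat \<Rightarrow> int \<Rightarrow> (nat \<Rightarrow> 'k) set" where
  "tor_boundaries C i j = tens_bd C i ` tens C (Suc i) j"

abbreviation vdim :: "(nat \<Rightarrow> 'k::field) set \<Rightarrow> nat" where
  "vdim \<equiv> vector_space.dim (\<lambda>c v a. c * v a)"

text \<open>
  Dimension of the degree \<open>j\<close> part of \<open>H\<^sub>i(F \<otimes> k)\<close>; the boundaries lie in the cycles, and all
  spaces involved are finite-dimensional.
\<close>

definition tor_dim :: "('x, 'k::field) mpoly free_complex \<Rightarrow> nat \<Rightarrow> int \<Rightarrow> nat" where
  "tor_dim C i j = vdim (tor_cycles C i j) - vdim (tor_boundaries C i j)"

text \<open>
  Meaningful for homogeneous ideals \<open>I\<close>: they have such a resolution, and the value does not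
  depend on its choice.  The values at \<open>i = -1\<close> are a convention valid for every \<open>I\<close>,
  including the zero ideal.
\<close>

definition betti :: "('x::finite, 'k::field) mpoly set \<Rightarrow> int \<Rightarrow> int \<Rightarrow> nat" where
  "betti I i j =
    (if i \<ge> 0 then tor_dim (SOME C. graded_free_resolution C I) (nat i) j
     else if i = -1 \<and> j = 0 then 1 else 0)"

section \<open>Simplicial complexes and facet ideals\<close>

definition simplicial_complex :: "'x set \<Rightarrow> 'x set set \<Rightarrow> bool" where
  "simplicial_complex V \<Delta> \<longleftrightarrow>
     \<Delta> \<subseteq> Pow V \<and> (\<forall>F\<in>\<Delta>. \<forall>G. G \<subseteq> F \<longrightarrow> G \<in> \<Delta>) \<and> (\<forall>x\<in>V. {x} \<in> \<Delta>)"

definition facets :: "'x set set \<Rightarrow> 'x set set" where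
  "facets \<Delta> = {F \<in> \<Delta>. \<not> (\<exists>G\<in>\<Delta>. F \<subset> G)}"

text \<open>
  For an inclusion antichain \<open>A\<close> on a finite type, this is the complex with facet set \<open>A\<close>, on
  the vertices occurring in \<open>A\<close>.  If \<open>A\<close> is empty, so is the complex, and it has no facets.
\<close>

definition complex_of_facets :: "'x set set \<Rightarrow> 'x set set" where
  "complex_of_facets A = {G. \<exists>F\<in>A. G \<subseteq> F}"

definition facet_ideal :: "'k::field itself \<Rightarrow> 'x set set \<Rightarrow> ('x, 'k) mpoly set" where
  "facet_ideal k \<Delta> = ideal_gen (monom ` indicator ` facets \<Delta>)"

definition delete_facet :: "'x set set \<Rightarrow> 'x set \<Rightarrow> 'x set set" where
  "delete_facet \<Delta> F = complex_of_facets (facets \<Delta> - {F})"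

definition delete_subcomplex :: "'x set set \<Rightarrow> 'x set set \<Rightarrow> 'x set set" where
  "delete_subcomplex \<Delta> \<Gamma> = complex_of_facets (facets \<Delta> - facets \<Gamma>)"

definition facets_connected :: "'x set set \<Rightarrow> 'x set \<Rightarrow> 'x set \<Rightarrow> bool" where
  "facets_connected \<Delta> F G \<longleftrightarrow> F \<in> facets \<Delta> \<and> G \<in> facets \<Delta> \<and>
     (\<lambda>A B. A \<in> facets \<Delta> \<and> B \<in> facets \<Delta> \<and> A \<inter> B \<noteq> {})\<^sup>*\<^sup>* F G"

definition conn :: "'x set set \<Rightarrow> 'x set \<Rightarrow> 'x set set" where
  "conn \<Delta> F = complex_of_facets {G. facets_connected \<Delta> F G}"

definition conn_bar :: "'x set set \<Rightarrow> 'x set \<Rightarrow> 'x set set" where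
  "conn_bar \<Delta> F =
    (let \<G> = (\<lambda>G. G - F) ` facets (delete_facet (conn \<Delta> F) F)
     in complex_of_facets {H \<in> \<G>. \<not> (\<exists>H'\<in>\<G>. H' \<subset> H)})"

definition splitting_facet :: "'k::field itself \<Rightarrow> 'x set set \<Rightarrow> 'x set \<Rightarrow> bool" where
  "splitting_facet k \<Delta> F \<longleftrightarrow> F \<in> facets \<Delta> \<and>
     is_splitting (facet_ideal k \<Delta>) (ideal_gen {monom (indicator F)})
       (facet_ideal k (delete_facet \<Delta> F))"

end

theory Submission
  imports Defs
begin

text \<open>
  All ideals involved are computed through explicit resolutions of \<open>R / I\<close>: the homology of
  \<open>E \<otimes> k\<close> does not depend on the graded resolution \<open>E\<close>, because chain maps lift and are unique up
  to homotopy.  Write \<open>K\<close> for the facet ideal of \<open>\<Delta> \<setminus> F\<close>.  The colon ideal \<open>K : F\<close> is generated by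
  the sets \<open>G \<setminus> F\<close>, so it is the sum of the facet ideals of \<open>conn_bar\<close> and \<open>\<Omega>\<close>, which live in disjoint
  variables.  The function \<open>\<psi>\<close> of the splitting induces a map from the Taylor complex of \<open>K : F\<close>,
  shifted by \<open>F\<close>, to the one of \<open>K\<close>; its mapping cone resolves \<open>R / (K + (F))\<close>, and by the strict
  divisibility in the definition of a splitting the map vanishes after tensoring with \<open>k\<close>.  So
  \<open>\<beta>\<^sub>i\<^sub>,\<^sub>j\<close> of \<open>K + (F)\<close> is the sum of \<open>\<beta>\<^sub>i\<^sub>,\<^sub>j\<close> of \<open>K\<close> and of \<open>\<beta>\<close> of \<open>K : F\<close> at \<open>i - 1\<close> and \<open>j - |F|\<close>.  The
  latter is given by the Kuenneth formula, since the Taylor complex of a sum of two ideals in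
  disjoint variables is a tensor product.
\<close>

section \<open>Dimension counts\<close>

text \<open>The index -1 shapes the set-up. For an ideal inside the ideal of all variables, Tor_i of
  the ideal is Tor_{i+1} of \<open>R / I\<close>, and the convention at -1 is exactly Tor_0 of
  \<open>R / I\<close>, which is \<open>k\<close>. Resolving \<open>R / I\<close> therefore makes
  the zero ideal and the summands with index -1 ordinary cases of the Kuenneth formula; the price is
  to check that no ideal involved contains a polynomial with a constant term. \<open>betti\<close>
  picks its resolution by \<open>SOME\<close>, so besides independence of the choice the existence
  of a resolution in record form has to be proved. None of the explicit resolutions is minimal. What
  separates the cone into two parts is only that no entry of the connecting map is a unit. The cone
  is built on the minimal generators of the intersection of \<open>(F)\<close> and \<open>K\<close>,
  because \<open>\<psi>\<close> is given only there. The intersection is \<open>F\<close> times the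
  colon ideal, whence the shift by the degree of \<open>F\<close>. The Kuenneth formula needs other
  generators of the same colon ideal, and independence of the resolution allows the change.\<close>

context vector_space begin

lemma finite_independent_in_span:
  assumes "finite S" "independent B" "B \<subseteq> span S"
  shows "finite B"
  using independent_span_bound assms by blast

text \<open>\<open>dim\<close> is a cardinality and is 0 when bases are infinite. Functions on
  possibly infinite types occur below, hence the explicit finite spanning set
  \<open>S\<close>.\<close>

lemma card_independent_le_dim:
  assumes "finite S" "Z \<subseteq> span S" "independent B" "B \<subseteq> Z"
  shows "card B \<le> dim Z"
proof -
  obtain C where C: "B \<subseteq> C" "C \<subseteq> Z" "independent C" "Z \<subseteq> span C"
    using maximal_independent_subset_extend[OF assms(4) assms(3)] by metis
  have "finite C" using finite_independent_in_span assms C by blast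
  then show ?thesis using C basis_card_eq_dim[of C Z] card_mono[of C B] by auto
qed

lemma dim_mono_finite:
  assumes "finite S" "Z \<subseteq> span S" "B \<subseteq> Z"
  shows "dim B \<le> dim Z"
  by (metis assms basis_exists card_independent_le_dim order_trans)

end

context vector_space_pair begin

text \<open>The map induced from \<open>Z / B\<close> to \<open>Z' / B'\<close> is injective.\<close>

lemma dim_quotient_le:
  assumes f: "Vector_Spaces.linear s1 s2 f"
    and Z: "vs1.subspace Z" "finite S" "Z \<subseteq> vs1.span S" and B: "vs1.subspace B" "B \<subseteq> Z"
    and Z': "vs2.subspace Z'" "finite S'" "Z' \<subseteq> vs2.span S'" and B': "vs2.subspace B'" "B' \<subseteq> Z'"
    and fZ: "\<And>z. z \<in> Z \<Longrightarrow> f z \<in> Z'" and fB: "\<And>z. z \<in> Z \<Longrightarrow> f z \<in> B' \<Longrightarrow> z \<in> B"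
  shows "vs1.dim Z - vs1.dim B \<le> vs2.dim Z' - vs2.dim B'"
proof -
  obtain C where C: "C \<subseteq> B" "vs1.independent C" "B \<subseteq> vs1.span C"
    using vs1.maximal_independent_subset by metis
  obtain D where D: "C \<subseteq> D" "D \<subseteq> Z" "vs1.independent D" "Z \<subseteq> vs1.span D"
    using vs1.maximal_independent_subset_extend[of C Z] C B by (metis order_trans)
  obtain C' where C': "C' \<subseteq> B'" "vs2.independent C'" "B' \<subseteq> vs2.span C'"
    using vs2.maximal_independent_subset by metis
  have finD: "finite D" using vs1.finite_independent_in_span Z D by blast
  have finC': "finite C'" using vs2.finite_independent_in_span Z' C' B' by blast
  have spC: "vs1.span C = B" using C B by (metis vs1.span_minimal subset_antisym)
  have spC': "vs2.span C' = B'" using C' B' by (metis vs2.span_minimal subset_antisym)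
  have cards: "card D = vs1.dim Z" "card C = vs1.dim B" "card C' = vs2.dim B'"
    using C D C' vs1.basis_card_eq_dim vs2.basis_card_eq_dim by auto
  \<comment> \<open>\<open>f\<close> is injective only modulo \<open>B\<close>. So the images of
    \<open>D - C\<close> are adjoined to the basis \<open>C'\<close> of \<open>B'\<close>, one
    vector at a time.\<close>
  have main: "W \<subseteq> D - C \<Longrightarrow> vs2.independent (f ` W \<union> C') \<and> card (f ` W \<union> C') = card W + card C'"
    if "finite W" for W
    using that
  proof (induction W rule: finite_induct)
    case empty
    then show ?case using C' by simp
  next
    case (insert w W)
    have IH: "vs2.independent (f ` W \<union> C')" "card (f ` W \<union> C') = card W + card C'"
      using insert by auto
    have "f w \<notin> vs2.span (f ` W \<union> C')"
    proof
      assume "f w \<in> vs2.span (f ` W \<union> C')"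
      then obtain x y where xy: "f w = x + y" "x \<in> vs2.span (f ` W)" "y \<in> vs2.span C'"
        unfolding vs2.span_Un by auto
      \<comment> \<open>With \<open>u\<close> a preimage of \<open>x\<close>, the vector
        \<open>w - u\<close> is mapped into \<open>B'\<close>, so it lies in \<open>B\<close>, the
        span of \<open>C\<close>. Then \<open>w\<close> depends on other members of
        \<open>D\<close>.\<close>
      then obtain u where u: "u \<in> vs1.span W" "x = f u"
        using linear_span_image[OF f] by auto
      have WZ: "W \<subseteq> Z" "w \<in> Z" using insert D by auto
      then have uZ: "u \<in> Z" using u Z vs1.span_minimal by blast
      have "f (w - u) = y" using xy u linear_diff[OF f] by simp
      then have "w - u \<in> B" using fB[of "w - u"] xy spC' WZ uZ Z(1) vs1.subspace_diff by auto
      then have "(w - u) + u \<in> vs1.span (W \<union> C)"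
        using spC u(1) vs1.span_mono[of W "W \<union> C"] vs1.span_mono[of C "W \<union> C"]
        by (intro vs1.span_add) auto
      then have "w \<in> vs1.span (W \<union> C)" by simp
      moreover have "W \<union> C \<subseteq> D - {w}" using insert D by auto
      ultimately have "w \<in> vs1.span (D - {w})" using vs1.span_mono by blast
      moreover have "w \<in> D" using insert by auto
      ultimately show False using D(3) vs1.dependent_def by blast
    qed
    moreover from this have "f w \<notin> f ` W \<union> C'" using vs2.span_base[of "f w" "f ` W \<union> C'"] by metis
    ultimately show ?case using IH insert.hyps finC' vs2.independent_insertI by simp
  qed
  have fin: "finite (D - C)" "finite C" using finD finite_subset[OF D(1)] by auto
  have "f ` (D - C) \<union> C' \<subseteq> Z'" using fZ D(2) C'(1) B'(2) by blast
  then have "card (D - C) + card C' \<le> vs2.dim Z'"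
    using main[OF fin(1) order_refl] vs2.card_independent_le_dim[OF Z'(2,3)] by metis
  moreover have "card (D - C) = card D - card C" using card_Diff_subset[OF fin(2) D(1)] .
  ultimately show ?thesis using cards by simp
qed

end

text \<open>A name for the scalar multiplication that \<open>vdim\<close> contains as an anonymous
  function, over any index type, so that the vector space locales can be interpreted.\<close>

definition fscale :: "'k::field \<Rightarrow> ('a \<Rightarrow> 'k) \<Rightarrow> 'a \<Rightarrow> 'k" where
  "fscale c v = (\<lambda>a. c * v a)"

lemma sum_fun_apply: "(\<Sum>a\<in>X. f a) b = (\<Sum>a\<in>X. f a b)" for f :: "'a \<Rightarrow> 'b \<Rightarrow> 'c::comm_monoid_add"
  by (induction X rule: infinite_finite_induct) auto

interpretation fs: vector_space "fscale :: 'k::field \<Rightarrow> ('a \<Rightarrow> 'k) \<Rightarrow> 'a \<Rightarrow> 'k"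
  by unfold_locales (auto simp: fscale_def fun_eq_iff algebra_simps)

interpretation fsp: vector_space_pair "fscale :: 'k::field \<Rightarrow> ('a \<Rightarrow> 'k) \<Rightarrow> 'a \<Rightarrow> 'k"
    "fscale :: 'k::field \<Rightarrow> ('b \<Rightarrow> 'k) \<Rightarrow> 'b \<Rightarrow> 'k"
  by unfold_locales

definition fsupp :: "'a set \<Rightarrow> ('a \<Rightarrow> 'r::zero) set" where
  "fsupp X = {u. \<forall>a. a \<notin> X \<longrightarrow> u a = 0}"

lemma fsupp_subspace: "fs.subspace (fsupp X)"
  by (auto simp: fs.subspace_def fsupp_def fscale_def)

definition delta :: "'a \<Rightarrow> 'a \<Rightarrow> 'r::{zero,one}" where
  "delta a = (\<lambda>b. if b = a then 1 else 0)"

lemma sum_delta_left [simp]: "finite X \<Longrightarrow> (\<Sum>a\<in>X. delta b a * (f a :: 'r::semiring_1)) = (if b \<in> X then f b else 0)"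
  by (simp add: delta_def if_distrib[of "\<lambda>x. x * _"] sum.delta cong: if_cong)

lemma fsupp_in_span:
  assumes "finite X" shows "fsupp X \<subseteq> fs.span (delta ` X :: ('a \<Rightarrow> 'k::field) set)"
proof
  fix u :: "'a \<Rightarrow> 'k" assume u: "u \<in> fsupp X"
  have "u = (\<Sum>a\<in>X. fscale (u a) (delta a))"
  proof
    fix b
    have "(\<Sum>a\<in>X. fscale (u a) (delta a)) b = (\<Sum>a\<in>X. if a = b then u a else 0)"
      unfolding sum_fun_apply by (intro sum.cong) (auto simp: delta_def fscale_def)
    then show "u b = (\<Sum>a\<in>X. fscale (u a) (delta a)) b"
      using u assms by (auto simp: fsupp_def)
  qed
  also have "\<dots> \<in> fs.span (delta ` X)"
    by (intro fs.span_sum fs.span_scale fs.span_base) auto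
  finally show "u \<in> fs.span (delta ` X)" .
qed

lemma dim_quotient_le_fsupp:
  assumes "Vector_Spaces.linear fscale fscale f"
    and "fs.subspace Z" "finite X" "Z \<subseteq> fsupp X" "fs.subspace B" "B \<subseteq> Z"
    and "fs.subspace Z'" "finite X'" "Z' \<subseteq> fsupp X'" "fs.subspace B'" "B' \<subseteq> Z'"
    and "\<And>z. z \<in> Z \<Longrightarrow> f z \<in> Z'" "\<And>z. z \<in> Z \<Longrightarrow> f z \<in> B' \<Longrightarrow> z \<in> B"
  shows "fs.dim Z - fs.dim B \<le> fs.dim Z' - fs.dim B'"
  by (rule fsp.dim_quotient_le[where S = "delta ` X" and S' = "delta ` X'" and f = f])
    (use assms fsupp_in_span[of X] fsupp_in_span[of X'] in auto)

lemma fs_dim_singleton_0 [simp]: "fs.dim {0} = 0"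
  using fs.dim_unique[of "{}" "{0}" 0] by (auto simp: fs.independent_empty)

text \<open>A vector on pairs is a family of blocks: \<open>emb\<close> fills one block,
  \<open>pr\<close> reads one. The embedded bases of all \<open>S y\<close> together form a
  basis.\<close>

lemma dim_direct_sum:
  fixes S :: "'i \<Rightarrow> ('b \<Rightarrow> 'k::field) set"
  assumes "finite Y" "\<And>y. y \<in> Y \<Longrightarrow> fs.subspace (S y)" "\<And>y. y \<in> Y \<Longrightarrow> S y \<subseteq> fsupp (X y)"
    "\<And>y. y \<in> Y \<Longrightarrow> finite (X y)"
  shows "fs.dim {z. \<forall>y. (\<lambda>b. z (y, b)) \<in> (if y \<in> Y then S y else {0})} = (\<Sum>y\<in>Y. fs.dim (S y))"
proof -
  have "\<forall>y\<in>Y. \<exists>B. B \<subseteq> S y \<and> fs.independent B \<and> S y \<subseteq> fs.span B"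
    using fs.maximal_independent_subset by metis
  then obtain B where B: "\<And>y. y \<in> Y \<Longrightarrow> B y \<subseteq> S y \<and> fs.independent (B y) \<and> S y \<subseteq> fs.span (B y)"
    by metis
  have finB: "finite (B y)" if "y \<in> Y" for y
    using fs.finite_independent_in_span[of "delta ` X y" "B y"] B assms that fsupp_in_span[of "X y"]
    by blast
  define emb :: "'i \<Rightarrow> ('b \<Rightarrow> 'k) \<Rightarrow> 'i \<times> 'b \<Rightarrow> 'k" where
    "emb y v = (\<lambda>(y', b). if y' = y then v b else 0)" for y v
  define pr :: "'i \<Rightarrow> ('i \<times> 'b \<Rightarrow> 'k) \<Rightarrow> 'b \<Rightarrow> 'k" where "pr y z = (\<lambda>b. z (y, b))" for y z
  have lin_emb: "Vector_Spaces.linear fscale fscale (emb y)" for y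
    by unfold_locales (auto simp: emb_def fscale_def fun_eq_iff algebra_simps)
  have lin_pr: "Vector_Spaces.linear fscale fscale (pr y)" for y
    by unfold_locales (auto simp: pr_def fscale_def fun_eq_iff algebra_simps)
  have pr_emb: "pr y (emb y' v) = (if y = y' then v else 0)" for y y' v
    by (auto simp: pr_def emb_def fun_eq_iff)
  let ?U = "\<Union>y\<in>Y. emb y ` B y"
  have nz: "0 \<notin> B y" if "y \<in> Y" for y using B that fs.dependent_zero by blast
  have inj: "inj (emb y)" for y by (rule injI) (metis pr_emb)
  have disj: "emb y ` B y \<inter> emb y' ` B y' = {}" if "y \<in> Y" "y' \<in> Y" "y \<noteq> y'" for y y'
  proof (rule ccontr)
    assume "emb y ` B y \<inter> emb y' ` B y' \<noteq> {}"
    then obtain v v' where "v \<in> B y" "v' \<in> B y'" "emb y v = emb y' v'" by blast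
    then have "v = 0" using pr_emb[of y y v] pr_emb[of y y' v'] that by simp
    then show False using nz that \<open>v \<in> B y\<close> by blast
  qed
  have ind: "fs.independent ?U"
    unfolding fs.dependent_def
  proof
    assume "\<exists>a\<in>?U. a \<in> fs.span (?U - {a})"
    then obtain y v where yv: "y \<in> Y" "v \<in> B y" "emb y v \<in> fs.span (?U - {emb y v})" by blast
    \<comment> \<open>Reading block \<open>y\<close> kills the basis vectors of all other blocks, so
      a dependence would already hold inside \<open>B y\<close>.\<close>
    have "pr y (emb y v) \<in> fs.span (pr y ` (?U - {emb y v}))"
      using yv(3) fsp.linear_span_image[OF lin_pr] by blast
    moreover have "pr y ` (?U - {emb y v}) \<subseteq> insert 0 (B y - {v})"
      by (auto simp: pr_emb split: if_splits)
    ultimately have "pr y (emb y v) \<in> fs.span (insert 0 (B y - {v}))"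
      using fs.span_mono by blast
    then have "v \<in> fs.span (B y - {v})" by (simp add: pr_emb)
    then show False using B[OF yv(1)] yv(2) fs.dependent_def by auto
  qed
  let ?Z = "{z. \<forall>y. (\<lambda>b. z (y, b)) \<in> (if y \<in> Y then S y else {0})}"
  have sub: "?U \<subseteq> ?Z"
  proof clarsimp
    fix y v y' assume "y \<in> Y" "v \<in> B y"
    then show "(y' \<in> Y \<longrightarrow> (\<lambda>b. emb y v (y', b)) \<in> S y') \<and> (y' \<notin> Y \<longrightarrow> (\<lambda>b. emb y v (y', b)) = 0)"
      using pr_emb[of y' y v] B[of y] assms(2)[of y'] fs.subspace_0 unfolding pr_def by auto
  qed
  have sp: "?Z \<subseteq> fs.span ?U"
  proof
    fix z assume z: "z \<in> ?Z"
    have "z = (\<Sum>y\<in>Y. emb y (pr y z))"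
    proof
      fix x :: "'i \<times> 'b"
      obtain y b where x: "x = (y, b)" by fastforce
      have "(\<Sum>y\<in>Y. emb y (pr y z)) x = (if y \<in> Y then z (y, b) else 0)"
        unfolding sum_fun_apply x emb_def pr_def using assms(1) by simp
      moreover have "y \<notin> Y \<Longrightarrow> z (y, b) = 0" using z by (auto simp: fun_eq_iff split: if_splits)
      ultimately show "z x = (\<Sum>y\<in>Y. emb y (pr y z)) x" using x by auto
    qed
    also have "\<dots> \<in> fs.span ?U"
    proof (rule fs.span_sum)
      fix y assume y: "y \<in> Y"
      then have "pr y z \<in> S y" using z unfolding pr_def by (auto dest!: spec[of _ y])
      then have "emb y (pr y z) \<in> fs.span (emb y ` B y)"
        using B[OF y] fsp.linear_span_image[OF lin_emb] by blast
      then show "emb y (pr y z) \<in> fs.span ?U" using fs.span_mono[of "emb y ` B y" ?U] y by blast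
    qed
    finally show "z \<in> fs.span ?U" .
  qed
  have "fs.dim ?Z = card ?U" using fs.basis_card_eq_dim[OF sub sp ind] by simp
  also have "\<dots> = (\<Sum>y\<in>Y. card (emb y ` B y))"
    by (rule card_UN_disjoint) (use assms finB disj in auto)
  also have "\<dots> = (\<Sum>y\<in>Y. fs.dim (S y))"
  proof (rule sum.cong)
    fix y assume "y \<in> Y"
    then show "card (emb y ` B y) = fs.dim (S y)"
      using card_image[of "emb y" "B y"] inj fs.basis_card_eq_dim[of "B y" "S y"] B[of y]
      by (auto simp: inj_on_def inj_def)
  qed simp
  finally show ?thesis .
qed

section \<open>Complexes of based free modules\<close>

text \<open>Vectors are rows, so a matrix acts from the right.\<close>

definition app :: "'a set \<Rightarrow> ('a \<Rightarrow> 'b \<Rightarrow> 'r) \<Rightarrow> ('a \<Rightarrow> 'r) \<Rightarrow> 'b \<Rightarrow> 'r::comm_ring_1" where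
  "app X A u = (\<lambda>b. \<Sum>a\<in>X. u a * A a b)"

lemma app_cong:
  assumes "X = X'" "\<And>a. a \<in> X' \<Longrightarrow> u a = v a" "\<And>a. a \<in> X' \<Longrightarrow> A a = B a"
  shows "app X A u = app X' B v"
  using assms by (auto simp: app_def intro!: sum.cong)

lemma app_add: "app X A (u + v) = app X A u + app X A v"
  by (auto simp: app_def fun_eq_iff algebra_simps sum.distrib)

lemma app_diff: "app X A (u - v) = app X A u - app X A v"
  by (auto simp: app_def fun_eq_iff algebra_simps sum_subtractf)

lemma app_uminus: "app X A (- u) = - app X A u"
  by (auto simp: app_def fun_eq_iff sum_negf)

lemma app_scale: "app X A (\<lambda>a. c * u a) = (\<lambda>b. c * app X A u b)"
  by (auto simp: app_def fun_eq_iff sum_distrib_left mult.assoc)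

lemma app_fscale: "app X A (fscale c u) = fscale c (app X A u)"
  unfolding fscale_def by (rule app_scale)

lemma app_zero [simp]: "app X A 0 = 0"
  by (auto simp: app_def fun_eq_iff)

lemma app_mat_add: "app X (\<lambda>a. A a + B a) u = app X A u + app X B u"
  by (auto simp: app_def fun_eq_iff algebra_simps sum.distrib)

lemma app_mat_diff: "app X (\<lambda>a. A a - B a) u = app X A u - app X B u"
  by (auto simp: app_def fun_eq_iff algebra_simps sum_subtractf)

lemma app_mat_zero: "(\<And>a. a \<in> X \<Longrightarrow> A a = 0) \<Longrightarrow> app X A u = 0"
  by (auto simp: app_def fun_eq_iff)

lemma app_app: "app Y B (app X A u) = app X (\<lambda>a. app Y B (A a)) u"
proof
  fix c
  have "app Y B (app X A u) c = (\<Sum>b\<in>Y. \<Sum>a\<in>X. u a * (A a b * B b c))"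
    by (simp add: app_def sum_distrib_right mult.assoc)
  also have "\<dots> = app X (\<lambda>a. app Y B (A a)) u c"
    unfolding app_def by (subst sum.swap) (simp add: sum_distrib_left)
  finally show "app Y B (app X A u) c = app X (\<lambda>a. app Y B (A a)) u c" .
qed

lemma app_delta: "finite X \<Longrightarrow> a \<in> X \<Longrightarrow> app X A (delta a) = A a"
  by (auto simp: app_def)

lemma app_mat_delta: "finite X \<Longrightarrow> u \<in> fsupp X \<Longrightarrow> app X delta u = u"
  by (auto simp: app_def fun_eq_iff delta_def fsupp_def if_distrib[of "\<lambda>x. _ * x"] cong: if_cong)

lemma app_linear: "Vector_Spaces.linear fscale fscale (app X (A :: 'a \<Rightarrow> 'b \<Rightarrow> 'k::field))"
  by unfold_locales (auto simp: app_def fscale_def fun_eq_iff algebra_simps sum.distrib sum_distrib_left)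

lemma app_fsupp: "(\<And>a. a \<in> X \<Longrightarrow> A a \<in> fsupp Y) \<Longrightarrow> app X A u \<in> fsupp Y"
  by (auto simp: app_def fsupp_def)

lemma app_restrict: "finite X \<Longrightarrow> Y \<subseteq> X \<Longrightarrow> u \<in> fsupp Y \<Longrightarrow> app X A u = app Y A u"
  by (auto simp: app_def fsupp_def fun_eq_iff intro!: sum.mono_neutral_right)

lemma app_nonzeroE:
  assumes "app X A u b \<noteq> 0" obtains a where "a \<in> X" "u a \<noteq> 0" "A a b \<noteq> 0"
proof -
  obtain a where "a \<in> X" "u a * A a b \<noteq> 0"
    using assms sum.neutral[of X "\<lambda>a. u a * A a b"] unfolding app_def by blast
  then show ?thesis using that[of a] mult_not_zero[of "u a" "A a b"] by blast
qed

lemma fsupp_diff: "u \<in> fsupp X \<Longrightarrow> v \<in> fsupp X \<Longrightarrow> u - v \<in> fsupp (X :: 'a set)" for u v :: "'a \<Rightarrow> 'r::group_add"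
  by (auto simp: fsupp_def)

lemma fsupp_delta: "a \<in> X \<Longrightarrow> delta a \<in> fsupp X"
  by (auto simp: fsupp_def delta_def)

subsection \<open>Homology of complexes of vector spaces\<close>

text \<open>The matrix \<open>c m\<close> leads from degree \<open>Suc m\<close> to degree
  \<open>m\<close>. No differential leaves degree 0, so every vector there is a cycle.\<close>

definition cyc :: "(nat \<Rightarrow> 'a set) \<Rightarrow> (nat \<Rightarrow> 'a \<Rightarrow> int) \<Rightarrow> (nat \<Rightarrow> 'a \<Rightarrow> 'a \<Rightarrow> 'k::field) \<Rightarrow>
    nat \<Rightarrow> int \<Rightarrow> ('a \<Rightarrow> 'k) set" where
  "cyc X deg c n j = {v \<in> fsupp {a \<in> X n. deg n a = j}. \<forall>m. n = Suc m \<longrightarrow> app (X n) (c m) v = 0}"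

definition bnd :: "(nat \<Rightarrow> 'a set) \<Rightarrow> (nat \<Rightarrow> 'a \<Rightarrow> int) \<Rightarrow> (nat \<Rightarrow> 'a \<Rightarrow> 'a \<Rightarrow> 'k::field) \<Rightarrow>
    nat \<Rightarrow> int \<Rightarrow> ('a \<Rightarrow> 'k) set" where
  "bnd X deg c n j = app (X (Suc n)) (c n) ` fsupp {a \<in> X (Suc n). deg (Suc n) a = j}"

text \<open>The truncated subtraction is a true quotient dimension in a \<open>kcx\<close>, by
  \<open>bnd_subset_cyc\<close>.\<close>

definition hdim :: "(nat \<Rightarrow> 'a set) \<Rightarrow> (nat \<Rightarrow> 'a \<Rightarrow> int) \<Rightarrow> (nat \<Rightarrow> 'a \<Rightarrow> 'a \<Rightarrow> 'k::field) \<Rightarrow>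
    nat \<Rightarrow> int \<Rightarrow> nat" where
  "hdim X deg c n j = fs.dim (cyc X deg c n j) - fs.dim (bnd X deg c n j)"

locale kcx =
  fixes X :: "nat \<Rightarrow> 'a set" and deg :: "nat \<Rightarrow> 'a \<Rightarrow> int" and c :: "nat \<Rightarrow> 'a \<Rightarrow> 'a \<Rightarrow> 'k::field"
  assumes fin: "finite (X n)"
    and graded: "a \<in> X (Suc n) \<Longrightarrow> c n a b \<noteq> 0 \<Longrightarrow> b \<in> X n \<and> deg n b = deg (Suc n) a"
    and dd: "a \<in> X (Suc (Suc n)) \<Longrightarrow> app (X (Suc n)) (c n) (c (Suc n) a) = 0"
begin

lemma dd_app: "app (X (Suc n)) (c n) (app (X (Suc (Suc n))) (c (Suc n)) u) = 0"
  by (simp add: app_app app_mat_zero dd)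

lemma cyc_subspace: "fs.subspace (cyc X deg c n j)"
proof (rule fs.subspaceI)
  fix u v assume "u \<in> cyc X deg c n j" "v \<in> cyc X deg c n j"
  then show "u + v \<in> cyc X deg c n j"
    by (simp add: cyc_def app_add fs.subspace_add[OF fsupp_subspace])
next
  fix r u assume "u \<in> cyc X deg c n j"
  then show "fscale r u \<in> cyc X deg c n j"
    by (auto simp: cyc_def app_fscale intro!: fs.subspace_scale[OF fsupp_subspace])
qed (simp add: cyc_def fs.subspace_0[OF fsupp_subspace])

lemma bnd_subspace: "fs.subspace (bnd X deg c n j)"
  unfolding bnd_def using fsp.linear_subspace_image[OF app_linear fsupp_subspace] by blast

lemma app_degree: "u \<in> fsupp {a \<in> X (Suc n). deg (Suc n) a = j} \<Longrightarrow>
    app (X (Suc n)) (c n) u \<in> fsupp {a \<in> X n. deg n a = j}"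
proof -
  assume u: "u \<in> fsupp {a \<in> X (Suc n). deg (Suc n) a = j}"
  have "b \<in> X n \<and> deg n b = j" if "app (X (Suc n)) (c n) u b \<noteq> 0" for b
    using that
  proof (rule app_nonzeroE)
    fix a assume "a \<in> X (Suc n)" "u a \<noteq> 0" "c n a b \<noteq> 0"
    then show ?thesis using graded[of a n b] u by (auto simp: fsupp_def)
  qed
  then show "app (X (Suc n)) (c n) u \<in> fsupp {a \<in> X n. deg n a = j}"
    unfolding fsupp_def by blast
qed

lemma bnd_subset_cyc: "bnd X deg c n j \<subseteq> cyc X deg c n j"
  using dd_app app_degree unfolding bnd_def cyc_def by auto

text \<open>The differential preserves the internal degree, so the part of \<open>w\<close> of
  degree \<open>j\<close> has the same image. Preimages and homotopies may therefore be
  ungraded.\<close>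

lemma bndI:
  assumes "z \<in> fsupp {a \<in> X n. deg n a = j}" "z = app (X (Suc n)) (c n) w"
  shows "z \<in> bnd X deg c n j"
proof -
  define w' where "w' = (\<lambda>a. if a \<in> X (Suc n) \<and> deg (Suc n) a = j then w a else 0)"
  have "app (X (Suc n)) (c n) w' b = z b" for b
  proof (cases "b \<in> X n \<and> deg n b = j")
    case True
    have "w' a * c n a b = w a * c n a b" if "a \<in> X (Suc n)" for a
      using graded[OF that, of b] True that by (cases "c n a b = 0") (auto simp: w'_def)
    then show ?thesis unfolding assms(2) app_def by (intro sum.cong) auto
  next
    case False
    then have "z b = 0" using assms(1) by (auto simp: fsupp_def)
    moreover have "app (X (Suc n)) (c n) w' b = 0"
      by (rule ccontr, erule app_nonzeroE) (use False graded in \<open>auto simp: w'_def split: if_splits\<close>)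
    ultimately show ?thesis by simp
  qed
  then show ?thesis unfolding bnd_def by (intro image_eqI[of _ _ w']) (auto simp: w'_def fsupp_def)
qed

end

text \<open>Such an \<open>f\<close> is injective on homology. Equalities of homology dimensions are
  later derived from two such inequalities, without constructing an isomorphism.\<close>

lemma hdim_le:
  assumes "kcx X deg c" "kcx Y deg' c'" "Vector_Spaces.linear fscale fscale f"
    and "\<And>z. z \<in> cyc X deg c n j \<Longrightarrow> f z \<in> cyc Y deg' c' n' j'"
    and "\<And>z. z \<in> cyc X deg c n j \<Longrightarrow> f z \<in> bnd Y deg' c' n' j' \<Longrightarrow> z \<in> bnd X deg c n j"
  shows "hdim X deg c n j \<le> hdim Y deg' c' n' j'"
proof -
  interpret X: kcx X deg c by fact
  interpret Y: kcx Y deg' c' by fact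
  show ?thesis unfolding hdim_def
    by (rule dim_quotient_le_fsupp[where X = "X n" and X' = "Y n'" and f = f])
      (use assms(3-) X.cyc_subspace X.bnd_subspace X.bnd_subset_cyc X.fin
        Y.cyc_subspace Y.bnd_subspace Y.bnd_subset_cyc Y.fin in \<open>auto simp: cyc_def fsupp_def\<close>)
qed

subsection \<open>Graded resolutions\<close>

abbreviation lookup :: "('a \<Rightarrow>\<^sub>0 'b::zero) \<Rightarrow> 'a \<Rightarrow> 'b" where
  "lookup \<equiv> Poly_Mapping.lookup"

lemma mdeg_add: "mdeg (m + n) = mdeg m + mdeg n"
  by (simp add: mdeg_def sum.distrib)

lemma mdeg_0 [simp]: "mdeg 0 = 0"
  by (simp add: mdeg_def)

section \<open>Homogeneous components of polynomials\<close>

definition hcomp :: "int \<Rightarrow> ('x::finite, 'k::field) mpoly \<Rightarrow> ('x, 'k) mpoly" where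
  "hcomp d p = Poly_Mapping.mapp (\<lambda>m c. if int (mdeg m) = d then c else 0) p"

lemma lookup_hcomp: "lookup (hcomp d p) m = (if int (mdeg m) = d then lookup p m else 0)"
  by (auto simp: hcomp_def lookup_mapp in_keys_iff when_def)

lemma hcomp_add: "hcomp d (p + q) = hcomp d p + hcomp d q"
  by (rule poly_mapping_eqI) (simp add: lookup_hcomp lookup_add)

lemma hcomp_sum: "hcomp d (\<Sum>a\<in>X. f a) = (\<Sum>a\<in>X. hcomp d (f a))"
  by (rule poly_mapping_eqI) (simp add: lookup_hcomp lookup_sum)

lemma hcomp_homogeneous: "homogeneous d (hcomp d p)"
  by (auto simp: homogeneous_def in_keys_iff lookup_hcomp split: if_splits)

lemma hcomp_id: "homogeneous d p \<Longrightarrow> hcomp d p = p"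
  by (rule poly_mapping_eqI) (auto simp: homogeneous_def in_keys_iff lookup_hcomp)

lemma homogeneous_mult: "homogeneous d p \<Longrightarrow> homogeneous e q \<Longrightarrow> homogeneous (d + e) (p * q)"
  using keys_mult[of p q] by (fastforce simp: homogeneous_def mdeg_add)

lemma homogeneous_sum: "(\<And>a. a \<in> X \<Longrightarrow> homogeneous d (f a)) \<Longrightarrow> homogeneous d (\<Sum>a\<in>X. f a)"
  using keys_sum[of f X] by (force simp: homogeneous_def)

text \<open>The rest \<open>r\<close> of \<open>p\<close> has no monomial of degree
  \<open>d\<close>, so \<open>r * q\<close> has none of degree \<open>d'\<close>.\<close>

lemma hcomp_mult:
  assumes q: "homogeneous e q" and "d' = d + e" shows "hcomp d' (p * q) = hcomp d p * q"
proof -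
  define r where "r = p - hcomp d p"
  have r: "int (mdeg m) \<noteq> d" if "m \<in> Poly_Mapping.keys r" for m
    using that by (auto simp: r_def in_keys_iff lookup_minus lookup_hcomp)
  have "hcomp d' (r * q) = 0"
  proof (rule poly_mapping_eqI)
    fix m
    have "m \<notin> Poly_Mapping.keys (r * q)" if "int (mdeg m) = d'"
      using keys_mult[of r q] r q that assms(2) by (fastforce simp: homogeneous_def mdeg_add)
    then show "lookup (hcomp d' (r * q)) m = lookup 0 m" by (auto simp: lookup_hcomp in_keys_iff)
  qed
  moreover have "p * q = hcomp d p * q + r * q" by (simp add: r_def algebra_simps)
  ultimately show ?thesis
    using hcomp_id[OF homogeneous_mult[OF hcomp_homogeneous q]] assms(2) by (simp add: hcomp_add)
qed

text \<open>Exponent vectors add up to 0 only if both are 0. So taking constant coefficients is a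
  ring homomorphism, and tensoring with \<open>k\<close> can be done entry by entry.\<close>

lemma lookup_mult_0: "lookup (p * q) 0 = lookup p 0 * lookup (q :: ('x, 'k::field) mpoly) 0"
proof -
  have "(0 = l + m) \<longleftrightarrow> l = 0 \<and> m = 0" for l m :: "'x monomial" by (auto simp: fun_eq_iff)
  then have "(\<lambda>m. lookup q m when 0 = l + m) = (\<lambda>m. (lookup q m when l = 0) when m = 0)" for l
    by (auto simp: when_def fun_eq_iff)
  then have "(\<Sum>m. lookup q m when 0 = l + m) = (lookup q 0 when l = 0)" for l
    by (simp only: Sum_any_when_equal)
  then show ?thesis by (simp only: lookup_mult mult_when Sum_any_when_equal)
qed

lemma homogeneous_lookup_0: "homogeneous d p \<Longrightarrow> lookup p 0 \<noteq> 0 \<Longrightarrow> d = 0"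
  by (auto simp: homogeneous_def in_keys_iff dest!: bspec[of _ _ 0])

abbreviation cst :: "('a \<Rightarrow> 'b \<Rightarrow> ('x, 'k::field) mpoly) \<Rightarrow> 'a \<Rightarrow> 'b \<Rightarrow> 'k" where
  "cst A \<equiv> \<lambda>a b. lookup (A a b) 0"

lemma lookup_app: "lookup (app X A u b) 0 = app X (cst A) (\<lambda>a. lookup (u a) 0) b"
  by (simp add: app_def lookup_sum lookup_mult_0)

text \<open>
  A graded free resolution \<open>\<dots> \<rightarrow> E\<^sub>2 \<rightarrow> E\<^sub>1 \<rightarrow> E\<^sub>0 = R\<close> of \<open>R / I\<close>, where \<open>E\<^sub>n\<close> has the basis \<open>X n\<close>;
  so the index is larger by one than in a resolution of \<open>I\<close>.
\<close>

locale gres =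
  fixes X :: "nat \<Rightarrow> 'a set" and x0 :: 'a and deg :: "nat \<Rightarrow> 'a \<Rightarrow> int"
    and D :: "nat \<Rightarrow> 'a \<Rightarrow> 'a \<Rightarrow> ('x::finite, 'k::field) mpoly" and I :: "('x, 'k) mpoly set"
  assumes fin: "finite (X n)"
    and X0: "X 0 = {x0}" and deg0: "deg 0 x0 = 0"
    and D_supp: "a \<in> X (Suc n) \<Longrightarrow> D n a \<in> fsupp (X n)"
    and D_hom: "a \<in> X (Suc n) \<Longrightarrow> b \<in> X n \<Longrightarrow> homogeneous (deg (Suc n) a - deg n b) (D n a b)"
    and image: "(\<lambda>u. app (X 1) (D 0) u x0) ` fsupp (X 1) = I"
    and exact: "{u \<in> fsupp (X (Suc n)). app (X (Suc n)) (D n) u = 0} =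
      app (X (Suc (Suc n))) (D (Suc n)) ` fsupp (X (Suc (Suc n)))"
begin

lemma DD_app:
  "u \<in> fsupp (X (Suc (Suc n))) \<Longrightarrow> app (X (Suc n)) (D n) (app (X (Suc (Suc n))) (D (Suc n)) u) = 0"
  using exact[of n] by blast

lemma DD: "a \<in> X (Suc (Suc n)) \<Longrightarrow> app (X (Suc n)) (D n) (D (Suc n) a) = 0"
  using DD_app[of "delta a" n] by (simp add: fsupp_delta app_delta fin)

lemma image0: "r \<in> fsupp (X 0) \<Longrightarrow> r x0 \<in> I \<Longrightarrow> r \<in> app (X (Suc 0)) (D 0) ` fsupp (X (Suc 0))"
proof -
  assume r: "r \<in> fsupp (X 0)" "r x0 \<in> I"
  then obtain u where u: "u \<in> fsupp (X 1)" "r x0 = app (X 1) (D 0) u x0" using image by blast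
  moreover have "app (X 1) (D 0) u \<in> fsupp (X 0)" by (intro app_fsupp) (simp add: D_supp)
  ultimately have "r a = app (X 1) (D 0) u a" for a
    using r(1) X0 by (cases "a = x0") (auto simp: fsupp_def)
  then have "r = app (X 1) (D 0) u" by blast
  then show ?thesis using u by simp
qed

lemma D0_in: "a \<in> X (Suc 0) \<Longrightarrow> D 0 a x0 \<in> I"
  using image fin fsupp_delta[of a "X 1"] app_delta[of "X 1" a "D 0"] by force

text \<open>Each coefficient of an arbitrary preimage is cut down to the degree it ought to have.
  The entries of \<open>D n\<close> are homogeneous, so this cuts the image down to its component of
  the right degree, which is \<open>r\<close> itself.\<close>

lemma hom_preimage:
  assumes "r \<in> app (X (Suc n)) (D n) ` fsupp (X (Suc n))"
    and "\<And>b. b \<in> X n \<Longrightarrow> homogeneous (e - deg n b) (r b)"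
  obtains w where "w \<in> fsupp (X (Suc n))" "app (X (Suc n)) (D n) w = r"
    "\<And>a. a \<in> X (Suc n) \<Longrightarrow> homogeneous (e - deg (Suc n) a) (w a)"
proof -
  obtain u where u: "u \<in> fsupp (X (Suc n))" "app (X (Suc n)) (D n) u = r" using assms(1) by blast
  define w where "w a = hcomp (e - deg (Suc n) a) (u a)" for a
  have "app (X (Suc n)) (D n) w b = r b" for b
  proof (cases "b \<in> X n")
    case True
    have "app (X (Suc n)) (D n) w b = (\<Sum>a\<in>X (Suc n). hcomp (e - deg n b) (u a * D n a b))"
      unfolding app_def w_def
    proof (intro sum.cong refl)
      fix a assume "a \<in> X (Suc n)"
      from hcomp_mult[OF D_hom[OF this True], of "e - deg n b" "e - deg (Suc n) a" "u a"]
      show "hcomp (e - deg (Suc n) a) (u a) * D n a b = hcomp (e - deg n b) (u a * D n a b)"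
        by simp
    qed
    also have "\<dots> = hcomp (e - deg n b) (r b)"
      by (simp flip: hcomp_sum u(2) add: app_def)
    finally show ?thesis using assms(2) True by (simp add: hcomp_id)
  next
    case False
    moreover have "app (X (Suc n)) (D n) v \<in> fsupp (X n)" for v
      by (intro app_fsupp) (simp add: D_supp)
    ultimately show ?thesis using u(2) by (auto simp: fsupp_def)
  qed
  moreover have "hcomp d (0 :: ('x, 'k) mpoly) = 0" for d
    by (rule poly_mapping_eqI) (simp add: lookup_hcomp)
  then have "w \<in> fsupp (X (Suc n))" using u(1) by (auto simp: fsupp_def w_def)
  ultimately show ?thesis using that[of w] by (auto simp: w_def hcomp_homogeneous)
qed

lemma kcx: "kcx X deg (\<lambda>n. cst (D n))"
proof
  fix a n b assume a: "a \<in> X (Suc n)" "lookup (D n a b) 0 \<noteq> 0"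
  then have b: "b \<in> X n" using D_supp[OF a(1)] by (auto simp: fsupp_def)
  then show "b \<in> X n \<and> deg n b = deg (Suc n) a"
    using homogeneous_lookup_0[OF D_hom[OF a(1) b]] a(2) by auto
next
  fix a n assume "a \<in> X (Suc (Suc n))"
  then show "app (X (Suc n)) (cst (D n)) (cst (D (Suc n)) a) = 0"
    using DD[of a n] by (auto simp: fun_eq_iff simp flip: lookup_app)
qed (rule fin)

text \<open>Applied to the difference of two lifts of the identity of \<open>R / I\<close>.
  Exactness allows the homotopy to be chosen degree by degree, starting from 0.\<close>

lemma null_homotopy:
  assumes h: "\<And>n a. a \<in> X n \<Longrightarrow> h n a \<in> fsupp (X n)" and h0: "h 0 x0 = 0"
    and chain: "\<And>n a. a \<in> X (Suc n) \<Longrightarrow> app (X (Suc n)) (D n) (h (Suc n) a) = app (X n) (h n) (D n a)"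
  shows "\<exists>s. \<forall>n. \<forall>a\<in>X (Suc n). h (Suc n) a =
    app (X (Suc (Suc n))) (D (Suc n)) (s (Suc n) a) + app (X n) (s n) (D n a)"
proof -
  \<comment> \<open>The second clause is the solvability condition for the next degree: it makes
    \<open>h (Suc n) a\<close> minus the term with \<open>s\<close> a cycle, which exactness turns
    into a boundary.\<close>
  let ?P = "\<lambda>n s. (\<forall>a\<in>X n. s a \<in> fsupp (X (Suc n))) \<and>
    (\<forall>a\<in>X (Suc n). app (X n) (h n) (D n a) = app (X (Suc n)) (D n) (app (X n) s (D n a)))"
  let ?Q = "\<lambda>n s s'. \<forall>a\<in>X (Suc n). h (Suc n) a =
    app (X (Suc (Suc n))) (D (Suc n)) (s' a) + app (X n) s (D n a)"
  have "\<exists>s. \<forall>n. ?P n (s n) \<and> ?Q n (s n) (s (Suc n))"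
  proof (rule dependent_nat_choice)
    have "?P 0 (\<lambda>_. 0)" using h0 by (auto simp: X0 fsupp_def app_mat_zero intro!: app_mat_zero)
    then show "\<exists>s. ?P 0 s" by - (rule exI[where x = "\<lambda>_. 0"], assumption)
  next
    fix s n assume P: "?P n s"
    have "\<forall>a\<in>X (Suc n). \<exists>w\<in>fsupp (X (Suc (Suc n))).
        h (Suc n) a - app (X n) s (D n a) = app (X (Suc (Suc n))) (D (Suc n)) w"
    proof
      fix a assume a: "a \<in> X (Suc n)"
      have "h (Suc n) a - app (X n) s (D n a) \<in> fsupp (X (Suc n))"
        using P a by (intro fsupp_diff app_fsupp h) auto
      moreover have "app (X (Suc n)) (D n) (h (Suc n) a - app (X n) s (D n a)) = 0"
        using P a chain[OF a] by (simp add: app_diff)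
      ultimately show "\<exists>w\<in>fsupp (X (Suc (Suc n))).
          h (Suc n) a - app (X n) s (D n a) = app (X (Suc (Suc n))) (D (Suc n)) w"
        using exact[of n] by blast
    qed
    then obtain s' where s': "\<And>a. a \<in> X (Suc n) \<Longrightarrow> s' a \<in> fsupp (X (Suc (Suc n)))"
      "\<And>a. a \<in> X (Suc n) \<Longrightarrow>
        h (Suc n) a - app (X n) s (D n a) = app (X (Suc (Suc n))) (D (Suc n)) (s' a)"
      by metis
    then have Q: "?Q n s s'" by (metis diff_eq_eq)
    have "app (X (Suc n)) (h (Suc n)) (D (Suc n) a) =
        app (X (Suc (Suc n))) (D (Suc n)) (app (X (Suc n)) s' (D (Suc n) a))"
      if a: "a \<in> X (Suc (Suc n))" for a
    proof -
      have "app (X (Suc n)) (h (Suc n)) (D (Suc n) a) =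
          app (X (Suc n)) (\<lambda>b. app (X (Suc (Suc n))) (D (Suc n)) (s' b) + app (X n) s (D n b)) (D (Suc n) a)"
        using Q by (intro app_cong) auto
      also have "\<dots> = app (X (Suc n)) (\<lambda>b. app (X (Suc (Suc n))) (D (Suc n)) (s' b)) (D (Suc n) a)
          + app (X n) s (app (X (Suc n)) (D n) (D (Suc n) a))"
        by (simp add: app_mat_add app_app)
      finally show ?thesis using DD[OF a] by (simp add: app_app)
    qed
    then show "\<exists>s'. ?P (Suc n) s' \<and> ?Q n s s'" using s' Q by blast
  qed
  then show ?thesis by blast
qed

end

text \<open>The comparison theorem for resolutions. Homogeneity of the entries is carried along,
  because the lift must respect internal degrees after tensoring with \<open>k\<close>.\<close>

lemma chain_lift:
  assumes "gres X x0 deg D I" "gres Y y0 deg' D' I"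
  obtains f where "f 0 x0 = delta y0"
    "\<And>n a. a \<in> X n \<Longrightarrow> f n a \<in> fsupp (Y n)"
    "\<And>n a b. a \<in> X n \<Longrightarrow> b \<in> Y n \<Longrightarrow> homogeneous (deg n a - deg' n b) (f n a b)"
    "\<And>n a. a \<in> X (Suc n) \<Longrightarrow> app (Y (Suc n)) (D' n) (f (Suc n) a) = app (X n) (f n) (D n a)"
proof -
  interpret X: gres X x0 deg D I by fact
  interpret Y: gres Y y0 deg' D' I by fact
  \<comment> \<open>The last clause says that the part built so far can be lifted one step further.
    In degree 0 it holds because both resolutions have the same image \<open>I\<close> in
    \<open>R\<close>.\<close>
  let ?P = "\<lambda>n f. (n = 0 \<longrightarrow> f x0 = delta y0) \<and>
    (\<forall>a\<in>X n. f a \<in> fsupp (Y n) \<and> (\<forall>b\<in>Y n. homogeneous (deg n a - deg' n b) (f a b))) \<and>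
    (\<forall>a\<in>X (Suc n). app (X n) f (D n a) \<in> app (Y (Suc n)) (D' n) ` fsupp (Y (Suc n)))"
  let ?Q = "\<lambda>n f f'. \<forall>a\<in>X (Suc n). app (Y (Suc n)) (D' n) (f' a) = app (X n) f (D n a)"
  have "\<exists>f. \<forall>n. ?P n (f n) \<and> ?Q n (f n) (f (Suc n))"
  proof (rule dependent_nat_choice)
    have "?P 0 (\<lambda>_. delta y0)"
    proof (intro conjI ballI impI refl)
      fix a b assume "a \<in> X 0" "b \<in> Y 0"
      then show "homogeneous (deg 0 a - deg' 0 b) (delta y0 b)"
        using X.X0 Y.X0 X.deg0 Y.deg0 by (simp add: delta_def homogeneous_def)
    next
      fix a assume a: "a \<in> X (Suc 0)"
      show "app (X 0) (\<lambda>_. delta y0) (D 0 a) \<in> app (Y (Suc 0)) (D' 0) ` fsupp (Y (Suc 0))"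
      proof (rule Y.image0)
        show "app (X 0) (\<lambda>_. delta y0) (D 0 a) \<in> fsupp (Y 0)"
          by (intro app_fsupp) (simp add: Y.X0 fsupp_delta)
        show "app (X 0) (\<lambda>_. delta y0) (D 0 a) y0 \<in> I"
          using X.D0_in[OF a] by (simp add: X.X0 app_def delta_def)
      qed
    qed (auto simp: Y.X0 fsupp_delta)
    then show "\<exists>f. ?P 0 f" by - (rule exI[where x = "\<lambda>_. delta y0"], assumption)
  next
    fix f n assume P: "?P n f"
    have "\<forall>a\<in>X (Suc n). \<exists>w. w \<in> fsupp (Y (Suc n)) \<and>
        app (Y (Suc n)) (D' n) w = app (X n) f (D n a) \<and>
        (\<forall>b\<in>Y (Suc n). homogeneous (deg (Suc n) a - deg' (Suc n) b) (w b))"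
    proof
      fix a assume a: "a \<in> X (Suc n)"
      have hom: "homogeneous (deg (Suc n) a - deg' n b) (app (X n) f (D n a) b)" if "b \<in> Y n" for b
        unfolding app_def
      proof (rule homogeneous_sum)
        fix x assume x: "x \<in> X n"
        then show "homogeneous (deg (Suc n) a - deg' n b) (D n a x * f x b)"
          using homogeneous_mult[OF X.D_hom[OF a x], of "deg n x - deg' n b" "f x b"] P that by simp
      qed
      obtain w where "w \<in> fsupp (Y (Suc n))" "app (Y (Suc n)) (D' n) w = app (X n) f (D n a)"
        "\<And>b. b \<in> Y (Suc n) \<Longrightarrow> homogeneous (deg (Suc n) a - deg' (Suc n) b) (w b)"
        by (rule Y.hom_preimage[OF _ hom]) (use P a in auto)
      then show "\<exists>w. w \<in> fsupp (Y (Suc n)) \<and>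
        app (Y (Suc n)) (D' n) w = app (X n) f (D n a) \<and>
        (\<forall>b\<in>Y (Suc n). homogeneous (deg (Suc n) a - deg' (Suc n) b) (w b))" by blast
    qed
    then obtain f' where f': "\<And>a. a \<in> X (Suc n) \<Longrightarrow> f' a \<in> fsupp (Y (Suc n)) \<and>
        app (Y (Suc n)) (D' n) (f' a) = app (X n) f (D n a) \<and>
        (\<forall>b\<in>Y (Suc n). homogeneous (deg (Suc n) a - deg' (Suc n) b) (f' a b))" by metis
    have "app (X (Suc n)) f' (D (Suc n) a) \<in> app (Y (Suc (Suc n))) (D' (Suc n)) ` fsupp (Y (Suc (Suc n)))"
      if a: "a \<in> X (Suc (Suc n))" for a
    proof -
      have "app (Y (Suc n)) (D' n) (app (X (Suc n)) f' (D (Suc n) a)) =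
          app (X (Suc n)) (\<lambda>b. app (X n) f (D n b)) (D (Suc n) a)"
        unfolding app_app using f' by (intro app_cong) auto
      also have "\<dots> = app (X n) f (app (X (Suc n)) (D n) (D (Suc n) a))" by (simp add: app_app)
      finally have "app (Y (Suc n)) (D' n) (app (X (Suc n)) f' (D (Suc n) a)) = 0"
        using X.DD[OF a] by simp
      moreover have "app (X (Suc n)) f' (D (Suc n) a) \<in> fsupp (Y (Suc n))"
        using f' by (intro app_fsupp) auto
      ultimately show ?thesis using Y.exact[of n] by blast
    qed
    then show "\<exists>f'. ?P (Suc n) f' \<and> ?Q n f f'" using f' by (intro exI[of _ f']) auto
  qed
  then show ?thesis using that by metis
qed

lemma cst_chain:
  assumes "app Y B (f a) = app X g (A a)"
  shows "app Y (cst B) (cst f a) = app X (cst g) (cst A a)"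
  using assms by (auto simp: fun_eq_iff simp flip: lookup_app)

text \<open>Lifting the identity in both directions gives \<open>f\<close> and \<open>g\<close> with
  \<open>g\<close> after \<open>f\<close> homotopic to the identity, so \<open>f\<close> is
  injective on homology. Exchanging the resolutions gives the other inequality.\<close>

lemma hdim_le_of_gres:
  assumes "gres X x0 deg D I" "gres Y y0 deg' D' I"
  shows "hdim X deg (\<lambda>n. cst (D n)) n j \<le> hdim Y deg' (\<lambda>n. cst (D' n)) n j"
proof -
  interpret X: gres X x0 deg D I by fact
  interpret Y: gres Y y0 deg' D' I by fact
  interpret XK: kcx X deg "\<lambda>n. cst (D n)" by (rule X.kcx)
  obtain f where f: "f 0 x0 = delta y0" "\<And>n a. a \<in> X n \<Longrightarrow> f n a \<in> fsupp (Y n)"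
    "\<And>n a b. a \<in> X n \<Longrightarrow> b \<in> Y n \<Longrightarrow> homogeneous (deg n a - deg' n b) (f n a b)"
    "\<And>n a. a \<in> X (Suc n) \<Longrightarrow> app (Y (Suc n)) (D' n) (f (Suc n) a) = app (X n) (f n) (D n a)"
    by (rule chain_lift[OF assms]) (rule that; assumption)
  obtain g where g: "g 0 y0 = delta x0" "\<And>n a. a \<in> Y n \<Longrightarrow> g n a \<in> fsupp (X n)"
    "\<And>n a b. a \<in> Y n \<Longrightarrow> b \<in> X n \<Longrightarrow> homogeneous (deg' n a - deg n b) (g n a b)"
    "\<And>n a. a \<in> Y (Suc n) \<Longrightarrow> app (X (Suc n)) (D n) (g (Suc n) a) = app (Y n) (g n) (D' n a)"
    by (rule chain_lift[OF assms(2,1)]) (rule that; assumption)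
  define h where "h n a = app (Y n) (g n) (f n a) - delta a" for n a
  have "\<exists>s. \<forall>n. \<forall>a\<in>X (Suc n). h (Suc n) a =
    app (X (Suc (Suc n))) (D (Suc n)) (s (Suc n) a) + app (X n) (s n) (D n a)"
  proof (rule X.null_homotopy)
    show "h 0 x0 = 0" by (simp add: h_def f(1) g(1) app_delta Y.X0)
  next
    fix n a assume "a \<in> X n"
    then show "h n a \<in> fsupp (X n)" unfolding h_def
      by (intro fsupp_diff app_fsupp g fsupp_delta)
  next
    fix n a assume a: "a \<in> X (Suc n)"
    have "app (X (Suc n)) (D n) (h (Suc n) a) =
      app (Y (Suc n)) (\<lambda>b. app (Y n) (g n) (D' n b)) (f (Suc n) a) - D n a"
      unfolding h_def app_diff app_app
      using g(4) a by (simp add: app_delta X.fin cong: app_cong)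
    also have "\<dots> = app (Y n) (g n) (app (X n) (f n) (D n a)) - D n a"
      using f(4)[OF a] by (simp flip: app_app)
    also have "\<dots> = app (X n) (h n) (D n a)"
      using X.D_supp[OF a] by (simp add: h_def[abs_def] app_mat_diff app_app app_mat_delta X.fin)
    finally show "app (X (Suc n)) (D n) (h (Suc n) a) = app (X n) (h n) (D n a)" .
  qed
  then obtain s where s: "\<And>n a. a \<in> X (Suc n) \<Longrightarrow> h (Suc n) a =
    app (X (Suc (Suc n))) (D (Suc n)) (s (Suc n) a) + app (X n) (s n) (D n a)" by metis
  have fch: "app (Y (Suc n)) (cst (D' n)) (app (X (Suc n)) (cst (f (Suc n))) z) =
      app (X n) (cst (f n)) (app (X (Suc n)) (cst (D n)) z)" for n z
    unfolding app_app by (intro app_cong cst_chain f(4)) auto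
  have gch: "app (X (Suc n)) (cst (D n)) (app (Y (Suc n)) (cst (g (Suc n))) z) =
      app (Y n) (cst (g n)) (app (Y (Suc n)) (cst (D' n)) z)" for n z
    unfolding app_app by (intro app_cong cst_chain g(4)) auto
  \<comment> \<open>Reduced to constant coefficients, the homotopy shows that a cycle
    \<open>z\<close> differs by a boundary from its image under \<open>g\<close> after
    \<open>f\<close>. In degree 0 \<open>h\<close> itself vanishes.\<close>
  have htpy: "\<exists>w. z = app (Y n) (cst (g n)) (app (X n) (cst (f n)) z) - app (X (Suc n)) (cst (D n)) w"
    if z: "z \<in> cyc X deg (\<lambda>n. cst (D n)) n j" for z
  proof -
    have zs: "z \<in> fsupp (X n)" using z by (auto simp: cyc_def fsupp_def)
    have ch: "cst (h n) a = app (Y n) (cst (g n)) (cst (f n) a) - delta a" for a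
      by (auto simp: h_def lookup_minus lookup_app delta_def fun_eq_iff)
    have e1: "app (X n) (cst (h n)) z = app (Y n) (cst (g n)) (app (X n) (cst (f n)) z) - z"
      using zs by (simp add: ch app_mat_diff app_app app_mat_delta X.fin)
    show ?thesis
    proof (cases n)
      case 0
      have "app (X n) (cst (h n)) z = 0"
        by (rule app_mat_zero) (auto simp: 0 X.X0 h_def f(1) g(1) app_delta Y.X0)
      then show ?thesis using e1 by (intro exI[of _ 0]) simp
    next
      case (Suc m)
      have "cst (h (Suc m)) a = app (X (Suc (Suc m))) (cst (D (Suc m))) (cst (s (Suc m)) a) +
          app (X m) (cst (s m)) (cst (D m) a)" if "a \<in> X (Suc m)" for a
        using s[OF that] by (auto simp: fun_eq_iff lookup_add lookup_app)
      then have "app (X n) (cst (h n)) z =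
         app (X n) (\<lambda>a. app (X (Suc (Suc m))) (cst (D (Suc m))) (cst (s (Suc m)) a) +
          app (X m) (cst (s m)) (cst (D m) a)) z"
        using Suc by (intro app_cong) auto
      also have "\<dots> = app (X (Suc n)) (cst (D n)) (app (X n) (cst (s n)) z) +
          app (X m) (cst (s m)) (app (X n) (cst (D m)) z)"
        by (simp add: app_mat_add app_app Suc)
      also have "app (X n) (cst (D m)) z = 0" using z Suc by (auto simp: cyc_def)
      finally have e2: "app (Y n) (cst (g n)) (app (X n) (cst (f n)) z) - z =
          app (X (Suc n)) (cst (D n)) (app (X n) (cst (s n)) z)"
        using e1 by (simp only: app_zero add_0_right)
      show ?thesis
        by (intro exI[of _ "app (X n) (cst (s n)) z"])
          (simp only: diff_diff_eq2 add_diff_cancel_left' flip: e2)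
    qed
  qed
  show ?thesis
  proof (rule hdim_le[OF X.kcx Y.kcx app_linear[of "X n" "cst (f n)"]])
    fix z assume z: "z \<in> cyc X deg (\<lambda>n. cst (D n)) n j"
    show "app (X n) (cst (f n)) z \<in> cyc Y deg' (\<lambda>n. cst (D' n)) n j"
      unfolding cyc_def
    proof (intro CollectI conjI allI impI)
      show "app (X n) (cst (f n)) z \<in> fsupp {a \<in> Y n. deg' n a = j}"
        unfolding fsupp_def
      proof (intro CollectI allI impI, rule ccontr)
        fix b assume b: "b \<notin> {a \<in> Y n. deg' n a = j}" "app (X n) (cst (f n)) z b \<noteq> 0"
        then obtain a where a: "a \<in> X n" "z a \<noteq> 0" "lookup (f n a b) 0 \<noteq> 0"
          using app_nonzeroE[OF b(2)] by blast
        then have "b \<in> Y n" using f(2)[of a n] by (auto simp: fsupp_def)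
        then show False using f(3)[of a n b] a b z homogeneous_lookup_0[of _ "f n a b"]
          by (force simp: cyc_def fsupp_def)
      qed
    next
      fix m assume "n = Suc m"
      then show "app (Y n) (cst (D' m)) (app (X n) (cst (f n)) z) = 0"
        using z fch by (auto simp: cyc_def)
    qed
    assume "app (X n) (cst (f n)) z \<in> bnd Y deg' (\<lambda>n. cst (D' n)) n j"
    then obtain y where y: "app (X n) (cst (f n)) z = app (Y (Suc n)) (cst (D' n)) y"
      by (auto simp: bnd_def)
    obtain w where w: "z = app (Y n) (cst (g n)) (app (X n) (cst (f n)) z) - app (X (Suc n)) (cst (D n)) w"
      using htpy[OF z] by blast
    have "z = app (X (Suc n)) (cst (D n)) (app (Y (Suc n)) (cst (g (Suc n))) y - w)"
      using w by (simp add: y app_diff flip: gch)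
    then show "z \<in> bnd X deg (\<lambda>n. cst (D n)) n j"
      using z by (intro XK.bndI) (auto simp: cyc_def)
  qed
qed

lemma hdim_gres_unique:
  assumes "gres X x0 deg D I" "gres Y y0 deg' D' I"
  shows "hdim X deg (\<lambda>n. cst (D n)) n j = hdim Y deg' (\<lambda>n. cst (D' n)) n j"
  by (rule antisym[OF hdim_le_of_gres[OF assms] hdim_le_of_gres[OF assms(2,1)]])

subsection \<open>Betti numbers from an arbitrary resolution\<close>

lemma dim_fsupp:
  assumes "finite X" shows "fs.dim (fsupp X :: ('a \<Rightarrow> 'k::field) set) = card X"
proof -
  let ?B = "delta ` X :: ('a \<Rightarrow> 'k) set"
  have "fs.independent ?B"
    unfolding fs.dependent_def
  proof
    assume "\<exists>v\<in>?B. v \<in> fs.span (?B - {v})"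
    then obtain a where a: "(delta a :: 'a \<Rightarrow> 'k) \<in> fs.span (?B - {delta a})" by blast
    have "?B - {delta a} \<subseteq> fsupp (- {a})" by (auto simp: fsupp_def delta_def)
    then have "(delta a :: 'a \<Rightarrow> 'k) \<in> fsupp (- {a})"
      using fs.span_minimal[OF _ fsupp_subspace] a by blast
    then show False by (simp add: fsupp_def delta_def)
  qed
  moreover have "card ?B = card X"
  proof (intro card_image inj_onI)
    fix a b :: 'a assume "(delta a :: 'a \<Rightarrow> 'k) = delta b"
    from fun_cong[OF this, of a] show "a = b" by (simp add: delta_def split: if_splits)
  qed
  moreover have "?B \<subseteq> fsupp X" by (intro image_subsetI fsupp_delta)
  ultimately show ?thesis
    using fs.basis_card_eq_dim[OF _ fsupp_in_span[OF assms]] by metis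
qed

lemma hdim_cong:
  assumes "\<And>n a. a \<in> X (Suc n) \<Longrightarrow> c n a = c' n a"
  shows "hdim X deg c n j = hdim X deg c' n j"
proof -
  have "app (X (Suc m)) (c m) = app (X (Suc m)) (c' m)" for m
    by (rule ext, rule app_cong) (simp_all add: assms)
  then have "cyc X deg c n j = cyc X deg c' n j" "bnd X deg c n j = bnd X deg c' n j"
    by (auto simp: cyc_def bnd_def)
  then show ?thesis by (simp add: hdim_def)
qed

text \<open>\<open>I\<close> lies in the ideal generated by the variables. For the unit ideal the
  conventional value 1 at index -1 would not be the dimension of Tor_0 of
  \<open>R / I\<close>.\<close>

definition proper :: "('x, 'k::field) mpoly set \<Rightarrow> bool" where
  "proper I \<longleftrightarrow> (\<forall>p\<in>I. lookup p 0 = 0)"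

text \<open>The entries of \<open>D 0\<close> lie in \<open>I\<close>, hence vanish modulo the
  variables, and all of \<open>k\<close> survives. These are the conventional Betti numbers at index
  -1.\<close>

lemma (in gres) hdim_0:
  assumes "proper I" shows "hdim X deg (\<lambda>n. cst (D n)) 0 j = (if j = 0 then 1 else 0)"
proof -
  have "cst (D 0) a = 0" if "a \<in> X (Suc 0)" for a
  proof
    fix b show "lookup (D 0 a b) 0 = 0 b"
      using D0_in[OF that] D_supp[OF that] assms X0
      by (cases "b = x0") (auto simp: proper_def fsupp_def)
  qed
  then have "app (X (Suc 0)) (cst (D 0)) u = 0" for u by (rule app_mat_zero)
  moreover have "(0 :: 'a \<Rightarrow> 'k) \<in> fsupp {a \<in> X (Suc 0). deg (Suc 0) a = j}" by (simp add: fsupp_def)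
  ultimately have "bnd X deg (\<lambda>n. cst (D n)) 0 j = {0}" unfolding bnd_def by auto
  moreover have "cyc X deg (\<lambda>n. cst (D n)) 0 j = fsupp (if j = 0 then {x0} else {})"
    unfolding cyc_def using X0 deg0 by (auto intro!: arg_cong[of _ _ fsupp])
  ultimately show ?thesis by (simp add: hdim_def dim_fsupp)
qed

context
  fixes C :: "('x::finite, 'k::field) mpoly free_complex" and I
  assumes C: "graded_free_resolution C I"
begin

text \<open>The ring is spliced in at index 0 and the augmentation becomes the first differential,
  which turns a resolution of \<open>I\<close> into one of \<open>R / I\<close>.\<close>

definition res_X :: "nat \<Rightarrow> nat set" where
  "res_X n = (case n of 0 \<Rightarrow> {0} | Suc i \<Rightarrow> {..<rk C i})"

definition res_deg :: "nat \<Rightarrow> nat \<Rightarrow> int" where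
  "res_deg n = (case n of 0 \<Rightarrow> (\<lambda>_. 0) | Suc i \<Rightarrow> bdeg C i)"

definition res_D :: "nat \<Rightarrow> nat \<Rightarrow> nat \<Rightarrow> ('x, 'k) mpoly" where
  "res_D n = (case n of 0 \<Rightarrow> (\<lambda>a b. if b = 0 then aug C a else 0)
     | Suc i \<Rightarrow> (\<lambda>a b. if b < rk C i then dmat C i a b else 0))"

lemma res_simps [simp]: "res_X 0 = {0}" "res_X (Suc i) = {..<rk C i}" "res_deg 0 = (\<lambda>_. 0)"
    "res_deg (Suc i) = bdeg C i" "res_D 0 = (\<lambda>a b. if b = 0 then aug C a else 0)"
    "res_D (Suc i) = (\<lambda>a b. if b < rk C i then dmat C i a b else 0)"
  by (simp_all add: res_X_def res_deg_def res_D_def)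

lemma res_gres: "gres res_X 0 res_deg res_D I"
proof
  have fm: "free_mod C i = fsupp (res_X (Suc i))" for i
    by (auto simp: free_mod_def fsupp_def not_less)
  have bd: "bd C i u = app (res_X (Suc (Suc i))) (res_D (Suc i)) u" for i u
    by (auto simp: bd_def app_def fun_eq_iff)
  have aug: "app (res_X (Suc 0)) (res_D 0) u = (\<lambda>b. if b = 0 then augment C u else 0)" for u
    by (auto simp: augment_def app_def fun_eq_iff)
  show "finite (res_X n)" for n by (cases n) auto
  show "res_X 0 = {0}" "res_deg 0 0 = 0" by auto
  show "res_D n a \<in> fsupp (res_X n)" for n a by (cases n) (auto simp: fsupp_def)
  show "homogeneous (res_deg (Suc n) a - res_deg n b) (res_D n a b)"
    if "a \<in> res_X (Suc n)" "b \<in> res_X n" for n a b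
    using that C by (cases n) (auto simp: graded_free_resolution_def)
  show "(\<lambda>u. app (res_X 1) (res_D 0) u 0) ` fsupp (res_X 1) = I"
    using C fm[of 0] aug by (simp add: graded_free_resolution_def image_def)
  fix n
  show "{u \<in> fsupp (res_X (Suc n)). app (res_X (Suc n)) (res_D n) u = 0} =
      app (res_X (Suc (Suc n))) (res_D (Suc n)) ` fsupp (res_X (Suc (Suc n)))"
  proof (cases n)
    case 0
    have "app (res_X (Suc 0)) (res_D 0) u = 0 \<longleftrightarrow> augment C u = 0" for u
      unfolding aug by (auto simp: fun_eq_iff)
    moreover have "bd C 0 = app (res_X (Suc (Suc 0))) (res_D (Suc 0))" by (rule ext) (rule bd)
    ultimately show ?thesis unfolding 0 fm[symmetric]
      using C by (simp add: graded_free_resolution_def flip: fm)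
  next
    case (Suc i)
    have "bd C i = app (res_X (Suc (Suc i))) (res_D (Suc i))" for i by (rule ext) (rule bd)
    then show ?thesis unfolding Suc fm[symmetric]
      using C by (simp only: graded_free_resolution_def)
  qed
qed

text \<open>For \<open>i = 0\<close>, \<open>tor_cycles\<close> imposes no condition, whereas
  \<open>cyc\<close> asks the spliced-in augmentation to vanish after tensoring. Properness of
  \<open>I\<close> makes the two agree.\<close>

lemma tor_dim_eq_hdim:
  assumes "proper I"
  shows "tor_dim C i j = hdim res_X res_deg (\<lambda>n. cst (res_D n)) (Suc i) j"
proof -
  interpret gres res_X 0 res_deg res_D I by (rule res_gres)
  have tens: "tens C i j = fsupp {a \<in> res_X (Suc i). res_deg (Suc i) a = j}" for i
    by (auto simp: tens_def fsupp_def)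
  have bd: "tens_bd C i = app (res_X (Suc (Suc i))) (cst (res_D (Suc i)))" for i
    by (auto simp: tens_bd_def app_def fun_eq_iff)
  have aug: "app (res_X (Suc 0)) (cst (res_D 0)) u = 0" for u
  proof (rule app_mat_zero)
    fix a assume "a \<in> res_X (Suc 0)"
    from D0_in[OF this] show "cst (res_D 0) a = 0"
      using assms by (auto simp: fun_eq_iff proper_def)
  qed
  have "tor_cycles C i j = cyc res_X res_deg (\<lambda>n. cst (res_D n)) (Suc i) j"
    using aug by (cases i) (simp_all add: tor_cycles_def cyc_def tens bd)
  moreover have "tor_boundaries C i j = bnd res_X res_deg (\<lambda>n. cst (res_D n)) (Suc i) j"
    by (simp only: tor_boundaries_def bnd_def tens bd)
  moreover have "(\<lambda>c v a. c * v a) = (fscale :: 'k \<Rightarrow> (nat \<Rightarrow> 'k) \<Rightarrow> _)" by (simp add: fscale_def[abs_def])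
  ultimately show ?thesis by (simp add: tor_dim_def hdim_def)
qed

end

text \<open>Gives the \<open>SOME\<close> in \<open>betti\<close> something to choose. Each basis is
  enumerated by \<open>e n\<close>, and \<open>S n\<close> transports vectors along the
  enumeration.\<close>

lemma (in gres) ex_resolution: "\<exists>C. graded_free_resolution C I"
proof -
  have "\<exists>e. bij_betw e {..<card (X (Suc n))} (X (Suc n))" for n
    using ex_bij_betw_nat_finite[OF fin] by (metis lessThan_atLeast0)
  then obtain e where e: "\<And>n. bij_betw (e n) {..<card (X (Suc n))} (X (Suc n))" by metis
  define C where "C = \<lparr>rk = \<lambda>n. card (X (Suc n)), bdeg = \<lambda>n a. deg (Suc n) (e n a),
    dmat = \<lambda>n a b. D (Suc n) (e (Suc n) a) (e n b), aug = \<lambda>a. D 0 (e 0 a) x0\<rparr>"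
  have Csel [simp]: "rk C = (\<lambda>n. card (X (Suc n)))" "bdeg C = (\<lambda>n a. deg (Suc n) (e n a))"
    "dmat C = (\<lambda>n a b. D (Suc n) (e (Suc n) a) (e n b))" "aug C = (\<lambda>a. D 0 (e 0 a) x0)"
    by (simp_all add: C_def)
  define S :: "nat \<Rightarrow> ('a \<Rightarrow> ('x, 'k) mpoly) \<Rightarrow> nat \<Rightarrow> ('x, 'k) mpoly" where
    "S n v = (\<lambda>i. if i < card (X (Suc n)) then v (e n i) else 0)" for n v
  have e_in: "e n i \<in> X (Suc n)" if "i < card (X (Suc n))" for n i
    using bij_betwE[OF e] that by blast
  have S_surj: "S n ` fsupp (X (Suc n)) = free_mod C n" for n
  proof
    show "S n ` fsupp (X (Suc n)) \<subseteq> free_mod C n" by (auto simp: S_def free_mod_def)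
    show "free_mod C n \<subseteq> S n ` fsupp (X (Suc n))"
    proof
      fix u assume u: "u \<in> free_mod C n"
      define v where "v = (\<lambda>a. if a \<in> X (Suc n) then u (the_inv_into {..<card (X (Suc n))} (e n) a) else 0)"
      have "S n v = u"
        using u e_in e[of n] by (auto simp: S_def v_def free_mod_def fun_eq_iff the_inv_into_f_f bij_betw_def)
      then show "u \<in> S n ` fsupp (X (Suc n))"
        by (intro image_eqI[of _ _ v]) (auto simp: v_def fsupp_def)
    qed
  qed
  have S_inj: "v = 0" if v: "v \<in> fsupp (X (Suc n))" "S n v = 0" for n v
  proof
    fix a show "v a = 0 a"
    proof (cases "a \<in> X (Suc n)")
      case True
      then have "a \<in> e n ` {..<card (X (Suc n))}" using bij_betw_imp_surj_on[OF e] by blast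
      then obtain i where "i < card (X (Suc n))" "e n i = a" by blast
      then show ?thesis using fun_cong[OF v(2), of i] by (simp add: S_def)
    qed (use v in \<open>simp add: fsupp_def\<close>)
  qed
  have reindex: "(\<Sum>i<card (X (Suc n)). f (e n i)) = (\<Sum>a\<in>X (Suc n). f a)" for n and f :: "'a \<Rightarrow> ('x, 'k) mpoly"
    using sum.reindex_bij_betw[OF e] by simp
  have bd: "bd C n (S (Suc n) v) = S n (app (X (Suc (Suc n))) (D (Suc n)) v)" for n v
    by (auto simp: bd_def S_def app_def fun_eq_iff simp flip: reindex)
  have au: "augment C (S 0 v) = app (X 1) (D 0) v x0" for v
    by (simp add: augment_def S_def app_def flip: reindex)
  have app_in: "app (X (Suc n)) (D n) v \<in> fsupp (X n)" for n v
    by (intro app_fsupp) (rule D_supp)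
  have bd0: "bd C n (S (Suc n) v) = 0 \<longleftrightarrow> app (X (Suc (Suc n))) (D (Suc n)) v = 0" for n v
    unfolding bd using S_inj[OF app_in, of n v] by (auto simp: S_def fun_eq_iff)
  have au0: "augment C (S 0 v) = 0 \<longleftrightarrow> app (X (Suc 0)) (D 0) v = 0" for v
  proof -
    have "app (X (Suc 0)) (D 0) v b = 0" if "b \<noteq> x0" for b
      using app_in[of 0 v] X0 that by (auto simp: fsupp_def)
    then show ?thesis unfolding au by (auto simp: fun_eq_iff) metis
  qed
  have ker: "{u \<in> S n ` V. P u} = S n ` {v \<in> V. P (S n v)}" for n V P by blast
  have bdim: "bd C n ` (S (Suc n) ` V) = S n ` (app (X (Suc (Suc n))) (D (Suc n)) ` V)" for n V
    by (simp add: image_image bd)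
  have "graded_free_resolution C I"
    unfolding graded_free_resolution_def
  proof (intro conjI allI impI)
    fix a assume "a < rk C 0"
    then show "homogeneous (bdeg C 0 a) (aug C a)"
      using D_hom[of "e 0 a" 0 x0] e_in[of a 0] X0 deg0 by simp
  next
    fix i a b assume "a < rk C (Suc i)" "b < rk C i"
    then show "homogeneous (bdeg C (Suc i) a - bdeg C i b) (dmat C i a b)"
      using D_hom[of "e (Suc i) a" "Suc i" "e i b"] e_in by simp
  next
    show "augment C ` free_mod C 0 = I" by (simp flip: S_surj add: image_image au image[simplified])
  next
    show "{u \<in> free_mod C 0. augment C u = 0} = bd C 0 ` free_mod C 1"
      using exact[of 0] by (simp flip: S_surj add: ker au0 bdim)
  next
    fix i
    show "{u \<in> free_mod C (Suc i). bd C i u = 0} = bd C (Suc i) ` free_mod C (Suc (Suc i))"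
      using exact[of "Suc i"] by (simp flip: S_surj add: ker bd0 bdim)
  qed
  then show ?thesis by blast
qed

text \<open>Existence and independence of resolutions combined: any resolution of
  \<open>R / I\<close> computes the Betti numbers, including the conventional ones at -1.\<close>

theorem betti_eq_hdim:
  assumes "gres X x0 deg D I" "proper I" "i \<ge> -1"
  shows "betti I i j = hdim X deg (\<lambda>n. cst (D n)) (nat (i + 1)) j"
proof (cases "i = -1")
  case True
  then show ?thesis using gres.hdim_0[OF assms(1,2)] by (simp add: betti_def)
next
  case False
  let ?C = "SOME C. graded_free_resolution C I"
  have C: "graded_free_resolution ?C I" by (rule someI_ex[OF gres.ex_resolution[OF assms(1)]])
  have "Suc (nat i) = nat (i + 1)" using False assms(3) by linarith
  then show ?thesis
    using tor_dim_eq_hdim[OF C assms(2)] hdim_gres_unique[OF res_gres[OF C] assms(1)] False assms(3)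
    by (simp add: betti_def)
qed

section \<open>Complexes labelled by monomials\<close>

interpretation pm: module "(*) :: ('x, 'k::field) mpoly \<Rightarrow> _"
  by unfold_locales (simp_all add: algebra_simps)

lemma sum_single_keys: "p = (\<Sum>m\<in>Poly_Mapping.keys p. Poly_Mapping.single m (lookup p m))"
  by (rule poly_mapping_eqI)
    (auto simp: lookup_sum lookup_single when_def in_keys_iff sum.delta)

text \<open>The right-hand side defines an ideal containing the generators, and each term of such a
  \<open>p\<close> is a multiple of one of them. Questions about monomial ideals thus become
  questions about divisibility.\<close>

lemma mem_ideal_gen_monom:
  "p \<in> ideal_gen (monom ` A) \<longleftrightarrow> (\<forall>m\<in>Poly_Mapping.keys p. \<exists>a\<in>A. a \<le> m)"
  for p :: "('x, 'k::field) mpoly"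
proof
  let ?U = "{p :: ('x, 'k) mpoly. \<forall>m\<in>Poly_Mapping.keys p. \<exists>a\<in>A. a \<le> m}"
  assume p: "p \<in> ideal_gen (monom ` A)"
  have "pm.subspace ?U"
  proof (rule pm.subspaceI)
    fix p q assume "p \<in> ?U" "q \<in> ?U"
    then show "p + q \<in> ?U" using keys_add[of p q] by blast
  next
    fix r p assume p: "p \<in> ?U"
    show "r * p \<in> ?U"
    proof (intro CollectI ballI)
      fix m assume "m \<in> Poly_Mapping.keys (r * p)"
      then obtain m1 m2 where m: "m = m1 + m2" "m2 \<in> Poly_Mapping.keys p" using keys_mult[of r p] by blast
      then obtain a where "a \<in> A" "a \<le> m2" using p by blast
      then show "\<exists>a\<in>A. a \<le> m" using m(1) by (intro bexI[of _ a]) (auto simp: le_fun_def trans_le_add2)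
    qed
  qed simp
  moreover have "monom ` A \<subseteq> ?U" by (auto simp: monom_def)
  ultimately show "\<forall>m\<in>Poly_Mapping.keys p. \<exists>a\<in>A. a \<le> m" using pm.span_minimal p by blast
next
  assume *: "\<forall>m\<in>Poly_Mapping.keys p. \<exists>a\<in>A. a \<le> m"
  have "Poly_Mapping.single m c \<in> ideal_gen (monom ` A)" if m: "m \<in> Poly_Mapping.keys p" for m and c :: 'k
  proof -
    obtain a where a: "a \<in> A" "a \<le> m" using bspec[OF * m] by blast
    then have "m - a + a = m" by (auto simp: le_fun_def fun_eq_iff)
    then have "Poly_Mapping.single m c = Poly_Mapping.single (m - a) c * monom a"
      by (simp add: monom_def mult_single)
    then show ?thesis using a by (auto intro: pm.span_scale pm.span_base)
  qed
  then show "p \<in> ideal_gen (monom ` A)" by (subst sum_single_keys) (auto intro: pm.span_sum)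
qed

lemma lookup_mult_single:
  "lookup (p * Poly_Mapping.single q c) m = (if q \<le> m then lookup p (m - q) * c else 0)"
  for p :: "('x, 'k::field) mpoly"
proof -
  have "(\<lambda>q'. lookup (Poly_Mapping.single q c) q' when m = l + q') =
      (\<lambda>q'. (c when m = l + q) when q' = q)" for l
    by (auto simp: lookup_single when_def)
  then have "lookup (p * Poly_Mapping.single q c) m = (\<Sum>l. lookup p l * (c when m = l + q))"
    by (simp only: lookup_mult Sum_any_when_equal)
  also have "\<dots> = (if q \<le> m then lookup p (m - q) * c else 0)"
  proof (cases "q \<le> m")
    case True
    then have "m = l + q \<longleftrightarrow> l = m - q" for l
      by (simp add: le_fun_def fun_eq_iff eq_diff_iff[symmetric]) (metis add_diff_cancel_right' le_add_diff_inverse2)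
    then show ?thesis using True by (simp add: mult_when)
  next
    case False
    then have "m \<noteq> l + q" for l by (auto simp: le_fun_def)
    then show ?thesis using False by simp
  qed
  finally show ?thesis .
qed

text \<open>
  The matrix of a labelled complex has the entries \<open>c n a b \<cdot> l a / l b\<close>.  In the part of multidegree
  \<open>m\<close> the basis elements with label dividing \<open>m\<close> survive, and the matrix becomes \<open>c\<close>.
\<close>

locale lcx =
  fixes X :: "nat \<Rightarrow> 'a set" and x0 :: 'a and l :: "'a \<Rightarrow> 'x::finite monomial"
    and c :: "nat \<Rightarrow> 'a \<Rightarrow> 'a \<Rightarrow> 'k::field"
  assumes fin: "finite (X n)"
    and X0: "X 0 = {x0}" and l0: "l x0 = 0"
    and c_supp: "a \<in> X (Suc n) \<Longrightarrow> c n a b \<noteq> 0 \<Longrightarrow> b \<in> X n \<and> l b \<le> l a"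
    and c0: "a \<in> X (Suc 0) \<Longrightarrow> c 0 a x0 \<noteq> 0"
    and dd: "a \<in> X (Suc (Suc n)) \<Longrightarrow> app (X (Suc n)) (c n) (c (Suc n) a) = 0"
    and exact: "v \<in> fsupp {a \<in> X (Suc n). l a \<le> m} \<Longrightarrow> app (X (Suc n)) (c n) v = 0 \<Longrightarrow>
      \<exists>w \<in> fsupp {a \<in> X (Suc (Suc n)). l a \<le> m}. app (X (Suc (Suc n))) (c (Suc n)) w = v"
begin

definition ldeg :: "nat \<Rightarrow> 'a \<Rightarrow> int" where
  "ldeg n a = int (mdeg (l a))"

definition lD :: "nat \<Rightarrow> 'a \<Rightarrow> 'a \<Rightarrow> ('x, 'k) mpoly" where
  "lD n a b = Poly_Mapping.single (l a - l b) (c n a b)"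

text \<open>\<open>lD\<close> tensored with \<open>k\<close>: an entry is a nonzero constant only
  where the two labels agree.\<close>

definition red :: "nat \<Rightarrow> 'a \<Rightarrow> 'a \<Rightarrow> 'k" where
  "red n a b = (if l a = l b then c n a b else 0)"

text \<open>The component of multidegree \<open>m\<close>. The basis element \<open>a\<close> has
  multidegree \<open>l a\<close>, so the relevant term of its coefficient has exponent
  \<open>m - l a\<close>.\<close>

definition slice :: "'x monomial \<Rightarrow> ('a \<Rightarrow> ('x, 'k) mpoly) \<Rightarrow> 'a \<Rightarrow> 'k" where
  "slice m u a = (if l a \<le> m then lookup (u a) (m - l a) else 0)"

lemma slice_inj: assumes "\<And>m. slice m u = slice m v" shows "u = v"
proof
  fix a show "u a = v a"
  proof (rule poly_mapping_eqI)
    fix p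
    have "l a \<le> p + l a" "p + l a - l a = p" by (auto simp: le_fun_def)
    then show "lookup (u a) p = lookup (v a) p"
      using fun_cong[OF assms[of "p + l a"], of a] by (simp add: slice_def)
  qed
qed

text \<open>The monomial factors telescope, since the exponents \<open>m - l a\<close> and
  \<open>l a - l b\<close> add up to \<open>m - l b\<close>. Only the scalar matrix
  \<open>c n\<close> is left.\<close>

lemma slice_app: "slice m (app (X (Suc n)) (lD n) u) = app (X (Suc n)) (c n) (slice m u)"
proof
  fix b
  have eq: "(if l b \<le> m then lookup (u a * lD n a b) (m - l b) else 0) = slice m u a * c n a b"
    if a: "a \<in> X (Suc n)" for a
  proof (cases "c n a b = 0")
    case False
    then have le: "l b \<le> l a" using c_supp a by blast
    show ?thesis
    proof (cases "l a \<le> m")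
      case True
      have "l b \<le> m" using le True by (rule order_trans)
      moreover have "l a - l b \<le> m - l b" using True by (auto simp: le_fun_def diff_le_mono)
      moreover have "m - l b - (l a - l b) = m - l a" using le by (auto simp: le_fun_def fun_eq_iff)
      ultimately show ?thesis using True by (simp add: lD_def lookup_mult_single slice_def)
    next
      case nle: False
      have "\<not> l a - l b \<le> m - l b" if "l b \<le> m"
        using nle that by (auto simp: le_fun_def) (metis le_diff_conv le_add_diff_inverse2 le_diff_iff' linear nat_le_linear order_trans)
      then show ?thesis using nle by (simp add: lD_def lookup_mult_single slice_def)
    qed
  qed (simp add: lD_def)
  have "slice m (app (X (Suc n)) (lD n) u) b =
      (\<Sum>a\<in>X (Suc n). if l b \<le> m then lookup (u a * lD n a b) (m - l b) else 0)"
    by (simp add: slice_def app_def lookup_sum)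
  also have "\<dots> = app (X (Suc n)) (c n) (slice m u) b"
    unfolding app_def by (rule sum.cong[OF refl eq])
  finally show "slice m (app (X (Suc n)) (lD n) u) b = app (X (Suc n)) (c n) (slice m u) b" .
qed

text \<open>Preimages over \<open>k\<close>, found separately in each multidegree, are assembled
  into one vector over \<open>R\<close>. This reduces image and exactness statements over
  \<open>R\<close> to linear algebra over \<open>k\<close>.\<close>

lemma glue:
  assumes r: "r \<in> fsupp (X n)"
    and ex: "\<And>m. \<exists>w\<in>fsupp {a \<in> X (Suc n). l a \<le> m}. app (X (Suc n)) (c n) w = slice m r"
  shows "r \<in> app (X (Suc n)) (lD n) ` fsupp (X (Suc n))"
proof -
  obtain w where w: "\<And>m. w m \<in> fsupp {a \<in> X (Suc n). l a \<le> m}"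
    "\<And>m. app (X (Suc n)) (c n) (w m) = slice m r"
    using ex by metis
  \<comment> \<open>The finitely many multidegrees of terms of \<open>r\<close>. Outside
    \<open>M\<close> the slice of \<open>r\<close> is 0, so nothing has to be hit there and the sum
    defining \<open>u\<close> can be finite.\<close>
  define M where "M = (\<Union>b\<in>X n. (\<lambda>p. p + l b) ` Poly_Mapping.keys (r b))"
  have finM: "finite M" using fin by (auto simp: M_def)
  define u where "u a = (\<Sum>m\<in>M. Poly_Mapping.single (m - l a) (w m a))" for a
  have slice_u: "slice m u = (if m \<in> M then w m else 0)" for m
  proof
    fix a
    show "slice m u a = (if m \<in> M then w m else 0) a"
    proof (cases "l a \<le> m")
      case True
      have "lookup (Poly_Mapping.single (m' - l a) (w m' a)) (m - l a) = (if m' = m then w m a else 0)" for m'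
      proof (cases "w m' a = 0")
        case False
        then have "l a \<le> m'" using w(1)[of m'] by (auto simp: fsupp_def)
        then have "m' - l a = m - l a \<longleftrightarrow> m' = m"
          using True by (auto simp: le_fun_def fun_eq_iff) (metis eq_diff_iff)
        then show ?thesis by (auto simp: lookup_single)
      qed auto
      then show ?thesis using True finM by (simp add: slice_def u_def lookup_sum)
    next
      case False
      then show ?thesis using w(1)[of m] by (auto simp: slice_def fsupp_def)
    qed
  qed
  have "app (X (Suc n)) (lD n) u = r"
  proof (rule slice_inj)
    fix m
    have "slice m r = 0" if m: "m \<notin> M"
    proof
      fix b
      have "lookup (r b) (m - l b) = 0" if le: "l b \<le> m"
      proof (rule ccontr)
        assume *: "lookup (r b) (m - l b) \<noteq> 0"
        then have "b \<in> X n" using r by (auto simp: fsupp_def)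
        moreover have "m = (m - l b) + l b" using le by (auto simp: le_fun_def fun_eq_iff)
        ultimately have "m \<in> M" using * unfolding M_def by (auto simp: in_keys_iff intro!: bexI[of _ b] image_eqI[of _ _ "m - l b"])
        then show False using m by blast
      qed
      then show "slice m r b = 0 b" by (simp add: slice_def)
    qed
    then show "slice m (app (X (Suc n)) (lD n) u) = slice m r"
      by (simp add: slice_app slice_u w(2))
  qed
  moreover have "u \<in> fsupp (X (Suc n))"
    using w(1) by (auto simp: fsupp_def u_def)
  ultimately show ?thesis by blast
qed

lemma slice_fsupp: "u \<in> fsupp (X n) \<Longrightarrow> slice m u \<in> fsupp {a \<in> X n. l a \<le> m}"
  by (auto simp: fsupp_def slice_def)

lemma slice_0 [simp]: "slice m 0 = 0"
  by (auto simp: slice_def)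

lemma gres: "gres X x0 ldeg lD (ideal_gen (monom ` l ` X (Suc 0)))"
proof
  show "finite (X n)" "X 0 = {x0}" for n by (rule fin, rule X0)
  show "ldeg 0 x0 = 0" by (simp add: ldeg_def l0)
  have lD0: "lD n a b = 0" if "a \<in> X (Suc n)" "b \<notin> X n" for n a b
    using c_supp[OF that(1), of b] that(2) by (cases "c n a b = 0") (auto simp: lD_def)
  show "lD n a \<in> fsupp (X n)" if "a \<in> X (Suc n)" for n a
    using lD0[OF that] by (simp add: fsupp_def)
  show "homogeneous (ldeg (Suc n) a - ldeg n b) (lD n a b)" if "a \<in> X (Suc n)" for n a b
  proof (cases "c n a b = 0")
    case False
    then have "l b \<le> l a" using c_supp that by blast
    then have "l a = (l a - l b) + l b" by (auto simp: le_fun_def fun_eq_iff)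
    then have "mdeg (l a) = mdeg (l a - l b) + mdeg (l b)" by (metis mdeg_add)
    then show ?thesis by (simp add: homogeneous_def lD_def ldeg_def)
  qed (simp add: homogeneous_def lD_def)
  show "(\<lambda>u. app (X 1) (lD 0) u x0) ` fsupp (X 1) = ideal_gen (monom ` l ` X (Suc 0))"
  proof (intro set_eqI iffI)
    fix p assume "p \<in> (\<lambda>u. app (X 1) (lD 0) u x0) ` fsupp (X 1)"
    then obtain u where u: "u \<in> fsupp (X (Suc 0))" "p = app (X (Suc 0)) (lD 0) u x0" by auto
    have "\<exists>a\<in>X (Suc 0). l a \<le> m" if "m \<in> Poly_Mapping.keys p" for m
    proof -
      have "(0 :: 'x monomial) \<le> m" "m - 0 = m" by (auto simp: le_fun_def)
      then have "app (X (Suc 0)) (c 0) (slice m u) x0 \<noteq> 0"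
        using that u(2) fun_cong[OF slice_app[of m 0 u], of x0] by (simp add: slice_def l0 in_keys_iff)
      then obtain a where "a \<in> X (Suc 0)" "slice m u a \<noteq> 0" using app_nonzeroE by metis
      then show ?thesis by (auto simp: slice_def split: if_splits)
    qed
    then show "p \<in> ideal_gen (monom ` l ` X (Suc 0))" by (auto simp: mem_ideal_gen_monom)
  next
    fix p :: "('x, 'k) mpoly" assume p: "p \<in> ideal_gen (monom ` l ` X (Suc 0))"
    define r where "r = (\<lambda>b. if b = x0 then p else 0)"
    have "r \<in> app (X (Suc 0)) (lD 0) ` fsupp (X (Suc 0))"
    proof (rule glue)
      show "r \<in> fsupp (X 0)" by (simp add: r_def X0 fsupp_def)
      fix m
      have m: "(0 :: 'x monomial) \<le> m" "m - 0 = m" by (auto simp: le_fun_def)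
      show "\<exists>w\<in>fsupp {a \<in> X (Suc 0). l a \<le> m}. app (X (Suc 0)) (c 0) w = slice m r"
      proof (cases "lookup p m = 0")
        case True
        then have "slice m r = 0" using m by (auto simp: slice_def r_def l0)
        then show ?thesis by (intro bexI[of _ 0]) (auto simp: fsupp_def)
      next
        case False
        then have "m \<in> Poly_Mapping.keys p" by (simp add: in_keys_iff)
        then have "\<exists>a\<in>l ` X (Suc 0). a \<le> m" using p unfolding mem_ideal_gen_monom by (rule bspec[rotated])
        then obtain a where a: "a \<in> X (Suc 0)" "l a \<le> m" by blast
        \<comment> \<open>One basis element whose label divides \<open>m\<close> is enough: division
          by its nonzero entry \<open>c 0 a x0\<close> produces the coefficient of \<open>p\<close>
          at \<open>m\<close>.\<close>
        have "app (X (Suc 0)) (c 0) (\<lambda>x. lookup p m / c 0 a x0 * delta a x) b = slice m r b" for b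
        proof (cases "b = x0")
          case True
          then show ?thesis using c0[OF a(1)] m
            by (simp only: app_scale app_delta[OF fin a(1)]) (simp add: slice_def r_def l0)
        next
          case False
          then have "c 0 a b = 0" using c_supp[OF a(1)] X0 by blast
          then show ?thesis using False
            by (simp only: app_scale app_delta[OF fin a(1)]) (simp add: slice_def r_def)
        qed
        then show ?thesis using a
          by (intro bexI[of _ "\<lambda>x. lookup p m / c 0 a x0 * delta a x"]) (auto simp: fsupp_def delta_def)
      qed
    qed
    then obtain u where "u \<in> fsupp (X (Suc 0))" "r = app (X (Suc 0)) (lD 0) u" by blast
    then show "p \<in> (\<lambda>u. app (X 1) (lD 0) u x0) ` fsupp (X 1)"
      by (intro image_eqI[of _ _ u]) (auto simp: r_def dest!: fun_cong[of _ _ x0])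
  qed
  fix n
  show "{u \<in> fsupp (X (Suc n)). app (X (Suc n)) (lD n) u = 0} =
      app (X (Suc (Suc n))) (lD (Suc n)) ` fsupp (X (Suc (Suc n)))" (is "?K = ?M")
  proof
    show "?K \<subseteq> ?M"
    proof
      fix u assume u: "u \<in> ?K"
      show "u \<in> ?M"
      proof (rule glue)
        fix m
        show "\<exists>w\<in>fsupp {a \<in> X (Suc (Suc n)). l a \<le> m}. app (X (Suc (Suc n))) (c (Suc n)) w = slice m u"
          using u slice_app[of m n u] by (intro exact slice_fsupp) auto
      qed (use u in auto)
    qed
    show "?M \<subseteq> ?K"
    proof clarify
      fix w :: "'a \<Rightarrow> ('x, 'k) mpoly" assume "w \<in> fsupp (X (Suc (Suc n)))"
      have "app (X (Suc n)) (lD n) (app (X (Suc (Suc n))) (lD (Suc n)) w) = 0"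
        by (rule slice_inj) (simp only: slice_app slice_0, simp add: app_app app_mat_zero dd)
      moreover have "app (X (Suc (Suc n))) (lD (Suc n)) w \<in> fsupp (X (Suc n))"
        by (rule app_fsupp) (simp add: fsupp_def lD0)
      ultimately show "app (X (Suc (Suc n))) (lD (Suc n)) w \<in> fsupp (X (Suc n)) \<and>
          app (X (Suc n)) (lD n) (app (X (Suc (Suc n))) (lD (Suc n)) w) = 0" by blast
    qed
  qed
qed

lemma cst_lD: "a \<in> X (Suc n) \<Longrightarrow> cst (lD n) a = red n a"
proof
  fix b assume a: "a \<in> X (Suc n)"
  show "lookup (lD n a b) 0 = red n a b"
  proof (cases "c n a b = 0")
    case False
    then have "l b \<le> l a" using c_supp a by blast
    then have "l a - l b = 0 \<longleftrightarrow> l a = l b" by (auto simp: le_fun_def fun_eq_iff) (metis antisym)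
    then show ?thesis by (auto simp: lD_def red_def lookup_single when_def)
  qed (simp add: lD_def red_def)
qed

lemma kcx_red: "kcx X ldeg red"
proof -
  interpret G: gres X x0 ldeg lD "ideal_gen (monom ` l ` X (Suc 0))" by (rule gres)
  interpret K: kcx X ldeg "\<lambda>n. cst (lD n)" by (rule G.kcx)
  show ?thesis
  proof
    show "b \<in> X n \<and> ldeg n b = ldeg (Suc n) a" if "a \<in> X (Suc n)" "red n a b \<noteq> 0" for a n b
      using K.graded that by (simp flip: cst_lD)
    show "app (X (Suc n)) (red n) (red (Suc n) a) = 0" if "a \<in> X (Suc (Suc n))" for a n
    proof -
      have "app (X (Suc n)) (red n) (red (Suc n) a) = app (X (Suc n)) (cst (lD n)) (cst (lD (Suc n)) a)"
        using fun_cong[OF cst_lD[OF that]] cst_lD by (intro app_cong) auto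
      then show ?thesis using K.dd[OF that] by simp
    qed
  qed (rule fin)
qed

lemma proper_labels:
  assumes "\<And>a. a \<in> X (Suc 0) \<Longrightarrow> l a \<noteq> 0"
  shows "proper (ideal_gen (monom ` l ` X (Suc 0)) :: ('x, 'k) mpoly set)"
proof -
  have "\<not> l a \<le> 0" if "a \<in> X (Suc 0)" for a
    using assms[OF that] by (auto simp: le_fun_def fun_eq_iff)
  then have "0 \<notin> Poly_Mapping.keys p" if "p \<in> ideal_gen (monom ` l ` X (Suc 0))" for p :: "('x, 'k) mpoly"
    using that unfolding mem_ideal_gen_monom by blast
  then show ?thesis by (auto simp: proper_def in_keys_iff)
qed

theorem betti_labelled:
  assumes "\<And>a. a \<in> X (Suc 0) \<Longrightarrow> l a \<noteq> 0" "i \<ge> -1"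
  shows "betti (ideal_gen (monom ` l ` X (Suc 0)) :: ('x, 'k) mpoly set) i j = hdim X ldeg red (nat (i + 1)) j"
  using betti_eq_hdim[OF gres proper_labels[OF assms(1)] assms(2)] hdim_cong[of X, OF cst_lD] by simp

end

section \<open>Tensor products of complexes\<close>

text \<open>One matrix serves all degrees and \<open>r\<close> recovers the degree of a basis
  element, so the signs of a tensor product can be read off the elements. Rows in degree 0 are zero,
  which spares case distinctions in \<open>tc\<close>.\<close>

locale ucx =
  fixes X :: "nat \<Rightarrow> 'a set" and r :: "'a \<Rightarrow> nat" and c :: "'a \<Rightarrow> 'a \<Rightarrow> 'k::field"
  assumes fin: "finite (X n)"
    and rank: "a \<in> X n \<Longrightarrow> r a = n"
    and supp: "a \<in> X (Suc n) \<Longrightarrow> c a \<in> fsupp (X n)"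
    and supp0: "a \<in> X 0 \<Longrightarrow> c a = 0"
    and dd: "a \<in> X (Suc n) \<Longrightarrow> app (X n) c (c a) = 0"

definition TX :: "(nat \<Rightarrow> 'a set) \<Rightarrow> (nat \<Rightarrow> 'b set) \<Rightarrow> nat \<Rightarrow> ('a \<times> 'b) set" where
  "TX X Y n = (\<Union>p\<le>n. X p \<times> Y (n - p))"

definition tp :: "('a \<Rightarrow> 'k::field) \<Rightarrow> ('b \<Rightarrow> 'k) \<Rightarrow> 'a \<times> 'b \<Rightarrow> 'k" where
  "tp u v = (\<lambda>(a, b). u a * v b)"

definition sgn_pow :: "nat \<Rightarrow> ('a \<Rightarrow> 'k::field) \<Rightarrow> 'a \<Rightarrow> 'k" where
  "sgn_pow p u = (\<lambda>x. (-1) ^ p * u x)"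

text \<open>The Leibniz rule for tensor products of complexes, with the Koszul sign given by the
  rank of the first component.\<close>

definition tc :: "('a \<Rightarrow> nat) \<Rightarrow> ('a \<Rightarrow> 'a \<Rightarrow> 'k::field) \<Rightarrow> ('b \<Rightarrow> 'b \<Rightarrow> 'k) \<Rightarrow> 'a \<times> 'b \<Rightarrow> 'a \<times> 'b \<Rightarrow> 'k" where
  "tc r c c' = (\<lambda>(a, b). tp (c a) (delta b) + sgn_pow (r a) (tp (delta a) (c' b)))"

section \<open>Calculus of elementary tensors\<close>

lemma tp_0 [simp]: "tp 0 v = 0" "tp u 0 = 0"
  by (auto simp: tp_def)

lemma sgn_pow_0 [simp]: "sgn_pow p 0 = 0"
  by (auto simp: sgn_pow_def)

lemma sgn_pow_diff: "sgn_pow p (u - v) = sgn_pow p u - sgn_pow p v"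
  by (auto simp: sgn_pow_def algebra_simps)

lemma sgn_pow_sgn_pow [simp]: "sgn_pow p (sgn_pow p u) = u"
  by (auto simp: sgn_pow_def power_mult_distrib simp flip: mult.assoc power_add mult_2)

lemma sgn_pow_Suc: "sgn_pow (Suc p) u = - sgn_pow p u"
  by (auto simp: sgn_pow_def)

lemma tp_diff: "tp (u - v) w = tp u w - tp v w" "tp w (x - y) = tp w x - tp w y"
  by (auto simp: tp_def algebra_simps)

lemma app_sgn_pow: "app X A (sgn_pow p u) = sgn_pow p (app X A u)"
  unfolding sgn_pow_def by (rule app_scale)

lemma delta_pair: "delta (a, b) = tp (delta a) (delta b)"
  by (auto simp: delta_def tp_def)

lemma TX_iff: "(a, b) \<in> TX X Y n \<longleftrightarrow> (\<exists>p q. p + q = n \<and> a \<in> X p \<and> b \<in> Y q)"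
  by (auto simp: TX_def) (metis le_add_diff_inverse)

lemma finite_TX: "(\<And>n. finite (X n)) \<Longrightarrow> (\<And>n. finite (Y n)) \<Longrightarrow> finite (TX X Y n)"
  by (auto simp: TX_def)

lemma tp_fsupp: "u \<in> fsupp (X p) \<Longrightarrow> v \<in> fsupp (Y q) \<Longrightarrow> p + q = n \<Longrightarrow> tp u v \<in> fsupp (TX X Y n)"
  unfolding fsupp_def tp_def by (auto simp: TX_iff)

lemma sgn_pow_fsupp: "u \<in> fsupp Z \<Longrightarrow> sgn_pow p u \<in> fsupp Z"
  by (auto simp: fsupp_def sgn_pow_def)

lemma fsupp_add: "u \<in> fsupp Z \<Longrightarrow> v \<in> fsupp Z \<Longrightarrow> u + v \<in> fsupp Z" for u :: "'a \<Rightarrow> 'k::field"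
  by (auto simp: fsupp_def)

lemma app_tp:
  assumes "\<And>n. finite (X n)" "\<And>n. finite (Y n)" "u \<in> fsupp (X p)" "v \<in> fsupp (Y q)" "p + q = n"
  shows "app (TX X Y n) C (tp u v) = app (X p) (\<lambda>a. app (Y q) (\<lambda>b. C (a, b)) v) u"
proof
  fix x
  have "app (TX X Y n) C (tp u v) x = app (X p \<times> Y q) C (tp u v) x"
  proof (rule fun_cong[OF app_restrict])
    show "finite (TX X Y n)" using assms by (intro finite_TX)
    show "X p \<times> Y q \<subseteq> TX X Y n" using assms(5) by (auto simp: TX_iff) blast
    show "tp u v \<in> fsupp (X p \<times> Y q)" using assms(3,4) by (auto simp: fsupp_def tp_def)
  qed
  then show "app (TX X Y n) C (tp u v) x = app (X p) (\<lambda>a. app (Y q) (\<lambda>b. C (a, b)) v) u x"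
    by (simp add: app_def tp_def sum.cartesian_product' sum_distrib_left mult.assoc)
qed

lemma app_tp_left:
  fixes A :: "'a \<Rightarrow> 'c \<Rightarrow> 'k::field" and v :: "'b \<Rightarrow> 'k"
  assumes "finite X" "finite Y" "v \<in> fsupp Y"
  shows "app X (\<lambda>a. app Y (\<lambda>b. tp (A a) (delta b)) v) u = tp (app X A u) v"
proof
  fix x :: "'c \<times> 'b"
  obtain a' b' where x: "x = (a', b')" by fastforce
  have "app Y (\<lambda>b. tp (A a) (delta b)) v (a', b') = A a a' * v b'" for a
  proof -
    have "app Y (\<lambda>b. tp (A a) (delta b)) v (a', b') = A a a' * app Y delta v b'"
      by (simp add: app_def tp_def sum_distrib_left algebra_simps)
    then show ?thesis using assms by (simp add: app_mat_delta)
  qed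
  then show "app X (\<lambda>a. app Y (\<lambda>b. tp (A a) (delta b)) v) u x = tp (app X A u) v x"
    by (simp add: x app_def[of X] tp_def sum_distrib_left algebra_simps)
qed

lemma app_tp_right:
  fixes B :: "'b \<Rightarrow> 'c \<Rightarrow> 'k::field" and u :: "'a \<Rightarrow> 'k"
  assumes "finite X" "finite Y" "u \<in> fsupp X"
  shows "app X (\<lambda>a. app Y (\<lambda>b. tp (delta a) (B b)) v) u = tp u (app Y B v)"
proof
  fix x :: "'a \<times> 'c"
  obtain a' b' where x: "x = (a', b')" by fastforce
  have "app Y (\<lambda>b. tp (delta a) (B b)) v (a', b') = delta a a' * app Y B v b'" for a :: 'a
    by (simp add: app_def tp_def sum_distrib_left algebra_simps)
  then have "app X (\<lambda>a. app Y (\<lambda>b. tp (delta a) (B b)) v) u x = app X delta u a' * app Y B v b'"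
    by (simp add: x app_def[of X] sum_distrib_left algebra_simps)
  then show "app X (\<lambda>a. app Y (\<lambda>b. tp (delta a) (B b)) v) u x = tp u (app Y B v) x"
    using assms by (simp add: app_mat_delta tp_def x)
qed

lemma app_sgn_mat: "app X (\<lambda>a. sgn_pow p (A a)) u = sgn_pow p (app X A u)"
  by (auto simp: app_def sgn_pow_def sum_distrib_left algebra_simps)

lemma app_tc:
  assumes "\<And>n. finite (X n)" "\<And>n. finite (Y n)" "\<And>a. a \<in> X p \<Longrightarrow> r a = p"
    "u \<in> fsupp (X p)" "v \<in> fsupp (Y q)" "p + q = n"
  shows "app (TX X Y n) (tc r c c') (tp u v) = tp (app (X p) c u) v + sgn_pow p (tp u (app (Y q) c' v))"
proof -
  have "app (TX X Y n) (tc r c c') (tp u v) =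
      app (X p) (\<lambda>a. app (Y q) (\<lambda>b. tp (c a) (delta b) + sgn_pow p (tp (delta a) (c' b))) v) u"
    unfolding app_tp[where X = X and Y = Y, OF assms(1,2,4,5,6)] using assms(3) by (intro app_cong) (auto simp: tc_def)
  then show ?thesis
    by (simp add: app_mat_add app_sgn_mat app_tp_left app_tp_right assms)
qed

text \<open>In the square of the differential both mixed terms are \<open>tp (c a) (c' b)\<close> up
  to sign. The first component has dropped by one rank in only one of them, so they cancel.\<close>

lemma tensor_ucx:
  assumes "ucx X r c" "ucx Y r' c'"
  shows "ucx (TX X Y) (\<lambda>(a, b). r a + r' b) (tc r c c')"
proof -
  interpret X: ucx X r c by fact
  interpret Y: ucx Y r' c' by fact
  show ?thesis
  proof
    show "finite (TX X Y n)" for n by (intro finite_TX X.fin Y.fin)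
    show "(case x of (a, b) \<Rightarrow> r a + r' b) = n" if "x \<in> TX X Y n" for x n
      using that X.rank Y.rank by (cases x) (auto simp: TX_iff)
  next
    fix x n assume "x \<in> TX X Y (Suc n)"
    then obtain a b p q where x: "x = (a, b)" "p + q = Suc n" "a \<in> X p" "b \<in> Y q"
      by (cases x) (auto simp: TX_iff)
    have d: "delta a \<in> fsupp (X p)" "delta b \<in> fsupp (Y q)" using x by (simp_all add: fsupp_delta)
    have 1: "tp (c a) (delta b) \<in> fsupp (TX X Y n)"
    proof (cases p)
      case 0 then show ?thesis using X.supp0 x by (simp add: fsupp_def)
    next
      case (Suc p') then show ?thesis using X.supp[of a p'] d x by (intro tp_fsupp) auto
    qed
    have 2: "tp (delta a) (c' b) \<in> fsupp (TX X Y n)"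
    proof (cases q)
      case 0 then show ?thesis using Y.supp0 x by (simp add: fsupp_def)
    next
      case (Suc q') then show ?thesis using Y.supp[of b q'] d x by (intro tp_fsupp) auto
    qed
    show "tc r c c' x \<in> fsupp (TX X Y n)"
      unfolding x tc_def using 1 2 by (auto intro!: fsupp_add sgn_pow_fsupp)
    have "app (TX X Y n) (tc r c c') (tp (c a) (delta b)) = - sgn_pow p (tp (c a) (c' b))"
    proof (cases p)
      case 0 then show ?thesis using X.supp0 x by simp
    next
      case (Suc p')
      have "app (TX X Y n) (tc r c c') (tp (c a) (delta b)) =
          tp (app (X p') c (c a)) (delta b) + sgn_pow p' (tp (c a) (app (Y q) c' (delta b)))"
        by (rule app_tc[where X = X and Y = Y, OF X.fin Y.fin X.rank]) (use Suc x X.supp[of a p'] d in auto)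
      then show ?thesis
        using X.dd[of a p'] x Suc by (simp add: app_delta Y.fin sgn_pow_Suc)
    qed
    moreover have "app (TX X Y n) (tc r c c') (tp (delta a) (c' b)) = tp (c a) (c' b)"
    proof (cases q)
      case 0 then show ?thesis using Y.supp0 x by simp
    next
      case (Suc q')
      have "app (TX X Y n) (tc r c c') (tp (delta a) (c' b)) =
          tp (app (X p) c (delta a)) (c' b) + sgn_pow p (tp (delta a) (app (Y q') c' (c' b)))"
        by (rule app_tc[where X = X and Y = Y, OF X.fin Y.fin X.rank]) (use Suc x Y.supp[of b q'] d in auto)
      then show ?thesis
        using Y.dd[of b q'] x Suc by (simp add: app_delta X.fin)
    qed
    ultimately show "app (TX X Y n) (tc r c c') (tc r c c' x) = 0"
      using X.rank[OF x(3)] by (simp add: x tc_def[of r c c'] app_add app_sgn_pow)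
  next
    fix x assume "x \<in> TX X Y 0"
    then obtain a b where "x = (a, b)" "a \<in> X 0" "b \<in> Y 0" by (cases x) (auto simp: TX_iff)
    then show "tc r c c' x = 0" using X.supp0 Y.supp0 by (simp add: tc_def)
  qed
qed

lemma homotopy_exact:
  assumes "finite Z" "v \<in> fsupp Z" "app Z c v = 0"
    and "\<And>a. a \<in> Z \<Longrightarrow> app Z' c' (h a) + app Y h (c a) = delta a"
  shows "app Z' c' (app Z h v) = v"
proof -
  have "app Z' c' (app Z h v) = app Z (\<lambda>a. delta a - app Y h (c a)) v"
    unfolding app_app using assms(4) by (intro app_cong refl) (metis add_diff_cancel_right')
  also have "\<dots> = v - app Y h (app Z c v)"
    using assms(1,2) by (simp add: app_mat_diff app_mat_delta app_app)
  finally show ?thesis using assms(3) by simp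
qed

section \<open>Taylor complexes on sequences of generators\<close>

text \<open>
  The basis in homological degree \<open>n\<close> consists of all sequences of \<open>n\<close> generators, repetitions
  allowed, and the differential is the alternating sum of the deletions of an entry.  A map of
  generators then induces a chain map without any signs.
\<close>

primrec del_coeff :: "'g list \<Rightarrow> 'g list \<Rightarrow> 'k::field" where
  "del_coeff [] t = 0"
| "del_coeff (x # s) t = (if t = s then 1 else 0) -
     (case t of [] \<Rightarrow> 0 | y # t' \<Rightarrow> if y = x then del_coeff s t' else 0)"

definition seqs :: "'g set \<Rightarrow> nat \<Rightarrow> 'g list set" where
  "seqs A n = {s. set s \<subseteq> A \<and> length s = n}"

primrec lcm_seq :: "('g \<Rightarrow> 'x monomial) \<Rightarrow> 'g list \<Rightarrow> 'x monomial" where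
  "lcm_seq e [] = 0"
| "lcm_seq e (x # s) = sup (e x) (lcm_seq e s)"

definition prepend :: "'g \<Rightarrow> ('g list \<Rightarrow> 'k::field) \<Rightarrow> 'g list \<Rightarrow> 'k" where
  "prepend g v = (\<lambda>s. case s of [] \<Rightarrow> 0 | x # s' \<Rightarrow> if x = g then v s' else 0)"

lemma monomial_ge_0 [simp]: "0 \<le> (m :: 'x monomial)"
  by (simp add: le_fun_def)

lemma lcm_seq_le_iff: "lcm_seq e s \<le> m \<longleftrightarrow> (\<forall>g\<in>set s. e g \<le> m)"
  by (induction s) (simp_all only: lcm_seq.simps monomial_ge_0 sup.bounded_iff list.set ball_simps)

lemma lcm_seq_mono: "set t \<subseteq> set s \<Longrightarrow> lcm_seq e t \<le> lcm_seq e s"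
  using lcm_seq_le_iff[of e s "lcm_seq e s"] lcm_seq_le_iff[of e t "lcm_seq e s"] by auto

lemma finite_seqs: "finite A \<Longrightarrow> finite (seqs A n)"
  using finite_lists_length_eq by (simp add: seqs_def)

lemma seqs_0 [simp]: "seqs A 0 = {[]}"
  by (auto simp: seqs_def)

lemma seqs_Suc: "seqs A (Suc n) = (\<lambda>(x, s). x # s) ` (A \<times> seqs A n)"
  by (auto simp: seqs_def length_Suc_conv image_def)

lemma Cons_in_seqs: "x # s \<in> seqs A (Suc n) \<longleftrightarrow> x \<in> A \<and> s \<in> seqs A n"
  by (auto simp: seqs_def)

lemma del_coeff_Nil [simp]: "del_coeff [] = 0"
  by (rule ext) simp

lemma del_coeff_Cons: "del_coeff (x # s) = delta s - prepend x (del_coeff s)"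
  by (rule ext) (simp add: delta_def prepend_def split: list.splits)

lemmas [simp del] = del_coeff.simps

lemma del_coeff_nonzero: "del_coeff s t \<noteq> (0 :: 'k::field) \<Longrightarrow> length s = Suc (length t) \<and> set t \<subseteq> set s"
proof (induction s arbitrary: t)
  case (Cons x s)
  show ?case
  proof (cases "t = s")
    case False
    then obtain t' where "t = x # t'" "del_coeff s t' \<noteq> (0 :: 'k)"
      using Cons.prems by (auto simp: del_coeff.simps split: list.splits if_splits)
    then show ?thesis using Cons.IH by auto
  qed auto
qed (simp add: del_coeff.simps)

lemma prepend_delta: "prepend g (delta s) = delta (g # s)"
  by (auto simp: prepend_def delta_def fun_eq_iff split: list.splits)

lemma prepend_0 [simp]: "prepend g 0 = 0"
  by (auto simp: prepend_def fun_eq_iff split: list.splits)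

lemma app_mat_prepend: "app X (\<lambda>a. prepend g (A a)) u = prepend g (app X A u)"
  by (auto simp: app_def prepend_def fun_eq_iff split: list.splits)

lemma app_prepend:
  assumes "finite A" "g \<in> A"
  shows "app (seqs A (Suc n)) C (prepend g v) = app (seqs A n) (\<lambda>s. C (g # s)) v"
proof
  fix t
  have "app (seqs A (Suc n)) C (prepend g v) t = (\<Sum>s\<in>(#) g ` seqs A n. prepend g v s * C s t)"
    unfolding app_def
  proof (rule sum.mono_neutral_right)
    show "finite (seqs A (Suc n))" "(#) g ` seqs A n \<subseteq> seqs A (Suc n)"
      using assms finite_seqs by (auto simp: Cons_in_seqs)
    show "\<forall>s\<in>seqs A (Suc n) - (#) g ` seqs A n. prepend g v s * C s t = 0"
      by (auto simp: prepend_def Cons_in_seqs split: list.splits)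
  qed
  also have "\<dots> = app (seqs A n) (\<lambda>s. C (g # s)) v t"
    by (subst sum.reindex) (auto simp: app_def prepend_def)
  finally show "app (seqs A (Suc n)) C (prepend g v) t = app (seqs A n) (\<lambda>s. C (g # s)) v t" .
qed

text \<open>Prepending a fixed generator is a contracting homotopy of the whole sequence complex.
  This is the source of all exactness statements for Taylor complexes below.\<close>

lemma app_del_coeff_prepend:
  assumes "finite A" "g \<in> A" "v \<in> fsupp (seqs A n)"
  shows "app (seqs A (Suc n)) del_coeff (prepend g v) = v - prepend g (app (seqs A n) del_coeff v)"
  by (simp add: app_prepend assms del_coeff_Cons app_mat_diff app_mat_delta finite_seqs app_mat_prepend)

lemma del_coeff_supp: "s \<in> seqs A (Suc n) \<Longrightarrow> del_coeff s \<in> fsupp (seqs A n)"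
  using del_coeff_nonzero[of s] by (force simp: seqs_def fsupp_def)

text \<open>For \<open>s = x # s'\<close>, the recursion gives \<open>d s = s' - x d s'\<close>.
  Applying \<open>d\<close> again, the two copies of \<open>d s'\<close> cancel and
  \<open>x d (d s')\<close> remains, which is 0 by induction.\<close>

lemma del_coeff_dd:
  assumes "finite A" "s \<in> seqs A (Suc n)"
  shows "app (seqs A n) del_coeff (del_coeff s :: _ \<Rightarrow> 'k::field) = 0"
  using assms(2)
proof (induction n arbitrary: s)
  case 0
  show ?case by (rule app_mat_zero) (simp only: seqs_0 singleton_iff del_coeff_Nil)
next
  case (Suc n)
  then obtain x s' where s: "s = x # s'" "x \<in> A" "s' \<in> seqs A (Suc n)" by (auto simp: seqs_Suc)
  have "app (seqs A (Suc n)) del_coeff (del_coeff s :: _ \<Rightarrow> 'k) = prepend x (app (seqs A n) del_coeff (del_coeff s'))"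
    unfolding s(1) del_coeff_Cons[of x] app_diff
    using s assms(1) by (simp add: app_del_coeff_prepend del_coeff_supp app_delta finite_seqs)
  then show ?case using Suc.IH[OF s(3)] by (simp only: prepend_0)
qed

lemma seqs_ucx: "finite A \<Longrightarrow> ucx (seqs A) length (del_coeff :: _ \<Rightarrow> _ \<Rightarrow> 'k::field)"
  by unfold_locales (simp_all add: finite_seqs del_coeff_supp del_coeff_dd, simp add: seqs_def)

text \<open>If a generator \<open>g\<close> divides \<open>m\<close>, prepending \<open>g\<close>
  keeps labels below \<open>m\<close> and contracts the part of multidegree \<open>m\<close>.
  Otherwise no nonempty sequence has a label dividing \<open>m\<close>.\<close>

lemma taylor_lcx:
  assumes "finite A"
  shows "lcx (seqs A) [] (lcm_seq e) (\<lambda>_. del_coeff :: _ \<Rightarrow> _ \<Rightarrow> 'k::field)"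
proof -
  interpret ucx "seqs A" length "del_coeff :: _ \<Rightarrow> _ \<Rightarrow> 'k" by (rule seqs_ucx[OF assms])
  show ?thesis
  proof
    fix a b n assume a: "a \<in> seqs A (Suc n)" "del_coeff a b \<noteq> (0 :: 'k)"
    then have "set b \<subseteq> set a" "b \<in> seqs A n" using del_coeff_nonzero supp[OF a(1)] by (auto simp: fsupp_def)
    then show "b \<in> seqs A n \<and> lcm_seq e b \<le> lcm_seq e a" using lcm_seq_mono by blast
  next
    fix a assume "a \<in> seqs A (Suc 0)"
    then show "del_coeff a [] \<noteq> (0 :: 'k)" by (auto simp: seqs_Suc del_coeff.simps)
  next
    fix v :: "'a list \<Rightarrow> 'k" and n m
    assume v: "v \<in> fsupp {a \<in> seqs A (Suc n). lcm_seq e a \<le> m}" "app (seqs A (Suc n)) del_coeff v = 0"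
    have v1: "v \<in> fsupp (seqs A (Suc n))" using v by (auto simp: fsupp_def)
    show "\<exists>w\<in>fsupp {a \<in> seqs A (Suc (Suc n)). lcm_seq e a \<le> m}. app (seqs A (Suc (Suc n))) del_coeff w = v"
    proof (cases "\<exists>g\<in>A. e g \<le> m")
      case True
      then obtain g where g: "g \<in> A" "e g \<le> m" by blast
      have "app (seqs A (Suc (Suc n))) del_coeff (prepend g v) = v"
        using app_del_coeff_prepend[OF assms g(1) v1] v(2) by simp
      moreover have "prepend g v \<in> fsupp {a \<in> seqs A (Suc (Suc n)). lcm_seq e a \<le> m}"
        using g v(1) by (auto simp: fsupp_def prepend_def Cons_in_seqs split: list.splits)
      ultimately show ?thesis by blast
    next
      case False
      have "v a = 0" for a
        using v(1) False by (cases a) (auto simp: fsupp_def seqs_def)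
      then have "v = 0" by (simp add: fun_eq_iff)
      then show ?thesis by (intro bexI[of _ 0]) (auto simp: fsupp_def)
    qed
  qed (auto simp: fin dd)
qed

text \<open>The contraction of the first factor alone contracts the tensor product. Since
  \<open>h\<close> raises the rank of the first component, the two terms with the differential of
  \<open>t\<close> have opposite signs.\<close>

lemma homotopy_fst:
  assumes "finite A" "finite B" "g \<in> A" "x \<in> TX (seqs A) (seqs B) (Suc n)"
  defines "h \<equiv> \<lambda>(s, t). tp (delta (g # s)) (delta t) :: _ \<Rightarrow> 'k::field"
  shows "app (TX (seqs A) (seqs B) (Suc (Suc n))) (tc length del_coeff del_coeff) (h x)
    + app (TX (seqs A) (seqs B) n) h (tc length del_coeff del_coeff x) = delta x"
proof -
  interpret A: ucx "seqs A" length "del_coeff :: _ \<Rightarrow> _ \<Rightarrow> 'k" by (rule seqs_ucx[OF assms(1)])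
  interpret B: ucx "seqs B" length "del_coeff :: _ \<Rightarrow> _ \<Rightarrow> 'k" by (rule seqs_ucx[OF assms(2)])
  obtain s t p q where x: "x = (s, t)" "p + q = Suc n" "s \<in> seqs A p" "t \<in> seqs B q"
    using assms(4) by (cases x) (auto simp: TX_iff)
  have d: "delta s \<in> fsupp (seqs A p)" "delta t \<in> fsupp (seqs B q)"
    "delta (g # s) \<in> fsupp (seqs A (Suc p))"
    using x assms(3) by (simp_all add: Cons_in_seqs fsupp_delta)
  have h_tp: "app (TX (seqs A) (seqs B) n') h (tp u v) = tp (prepend g u) v"
    if "u \<in> fsupp (seqs A p')" "v \<in> fsupp (seqs B q')" "p' + q' = n'" for n' p' q' u v
    using that assms(1-3)
    by (simp add: app_tp[where X = "seqs A" and Y = "seqs B", OF A.fin B.fin that] h_def app_tp_left finite_seqs app_mat_prepend app_mat_delta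
        flip: prepend_delta)
  have "app (TX (seqs A) (seqs B) (Suc (Suc n))) (tc length del_coeff del_coeff) (h x) =
      tp (app (seqs A (Suc p)) del_coeff (delta (g # s))) (delta t) +
      sgn_pow (Suc p) (tp (delta (g # s)) (app (seqs B q) del_coeff (delta t)))"
    unfolding h_def x prod.case by (rule app_tc[where X = "seqs A" and Y = "seqs B", OF A.fin B.fin A.rank]) (use x d in auto)
  also have "\<dots> = tp (delta s) (delta t) - tp (prepend g (del_coeff s)) (delta t)
      - sgn_pow p (tp (delta (g # s)) (del_coeff t))"
  proof -
    have "app (seqs A (Suc p)) del_coeff (delta (g # s)) = (del_coeff (g # s) :: _ \<Rightarrow> 'k)"
      "app (seqs B q) del_coeff (delta t) = (del_coeff t :: _ \<Rightarrow> 'k)"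
      using x assms(1-3) by (simp_all add: app_delta finite_seqs Cons_in_seqs)
    then show ?thesis by (simp only: del_coeff_Cons[of g s] tp_diff sgn_pow_Suc, simp only: diff_conv_add_uminus)
  qed
  finally have 1: "app (TX (seqs A) (seqs B) (Suc (Suc n))) (tc length del_coeff del_coeff) (h x) =
     tp (delta s) (delta t) - tp (prepend g (del_coeff s)) (delta t)
      - sgn_pow p (tp (delta (g # s)) (del_coeff t))" .
  have "app (TX (seqs A) (seqs B) n) h (tp (del_coeff s) (delta t)) = tp (prepend g (del_coeff s)) (delta t)"
  proof (cases p)
    case 0 then show ?thesis using x by simp
  next
    case (Suc p') then show ?thesis using x d A.supp[of s p'] by (intro h_tp[of _ p' _ q]) auto
  qed
  moreover have "app (TX (seqs A) (seqs B) n) h (tp (delta s) (del_coeff t)) = tp (delta (g # s)) (del_coeff t)"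
  proof (cases q)
    case 0 then show ?thesis using x by simp
  next
    case (Suc q')
    then show ?thesis using x d B.supp[of t q']
      unfolding prepend_delta[symmetric] by (intro h_tp[of _ p _ q']) auto
  qed
  ultimately have 2: "app (TX (seqs A) (seqs B) n) h (tc length del_coeff del_coeff x) =
      tp (prepend g (del_coeff s)) (delta t) + sgn_pow p (tp (delta (g # s)) (del_coeff t))"
    using A.rank[OF x(3)] by (simp add: x(1) tc_def app_add app_sgn_pow)
  show ?thesis unfolding 1 2 by (simp add: x(1) delta_pair)
qed

text \<open>The sign in \<open>h\<close> comes from moving the contraction past the first component;
  it makes the two terms with the differential of \<open>s\<close> cancel.\<close>

lemma homotopy_snd:
  assumes "finite A" "finite B" "g \<in> B" "x \<in> TX (seqs A) (seqs B) (Suc n)"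
  defines "h \<equiv> \<lambda>(s, t). sgn_pow (length s) (tp (delta s) (delta (g # t))) :: _ \<Rightarrow> 'k::field"
  shows "app (TX (seqs A) (seqs B) (Suc (Suc n))) (tc length del_coeff del_coeff) (h x)
    + app (TX (seqs A) (seqs B) n) h (tc length del_coeff del_coeff x) = delta x"
proof -
  interpret A: ucx "seqs A" length "del_coeff :: _ \<Rightarrow> _ \<Rightarrow> 'k" by (rule seqs_ucx[OF assms(1)])
  interpret B: ucx "seqs B" length "del_coeff :: _ \<Rightarrow> _ \<Rightarrow> 'k" by (rule seqs_ucx[OF assms(2)])
  obtain s t p q where x: "x = (s, t)" "p + q = Suc n" "s \<in> seqs A p" "t \<in> seqs B q"
    using assms(4) by (cases x) (auto simp: TX_iff)
  have d: "delta s \<in> fsupp (seqs A p)" "delta t \<in> fsupp (seqs B q)"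
    "delta (g # t) \<in> fsupp (seqs B (Suc q))"
    using x assms(3) by (simp_all add: Cons_in_seqs fsupp_delta)
  have len: "length s = p" using x(3) A.rank by blast
  have h_tp: "app (TX (seqs A) (seqs B) n') h (tp u v) = sgn_pow p' (tp u (prepend g v))"
    if "u \<in> fsupp (seqs A p')" "v \<in> fsupp (seqs B q')" "p' + q' = n'" for n' p' q' u v
  proof -
    have "app (TX (seqs A) (seqs B) n') h (tp u v) =
        app (seqs A p') (\<lambda>a. app (seqs B q') (\<lambda>b. sgn_pow p' (tp (delta a) (prepend g (delta b)))) v) u"
      unfolding app_tp[where X = "seqs A" and Y = "seqs B", OF A.fin B.fin that] using A.rank
      by (intro app_cong) (auto simp: h_def prepend_delta)
    then show ?thesis
      using that assms(1-3) by (simp add: app_sgn_mat app_tp_right finite_seqs app_mat_prepend app_mat_delta)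
  qed
  have "app (TX (seqs A) (seqs B) (Suc (Suc n))) (tc length del_coeff del_coeff)
      (tp (delta s) (delta (g # t)) :: _ \<Rightarrow> 'k) = tp (app (seqs A p) del_coeff (delta s)) (delta (g # t)) +
      sgn_pow p (tp (delta s) (app (seqs B (Suc q)) del_coeff (delta (g # t))))"
    by (rule app_tc[where X = "seqs A" and Y = "seqs B", OF A.fin B.fin A.rank]) (use x d in auto)
  also have "\<dots> = tp (del_coeff s) (delta (g # t)) +
      (sgn_pow p (tp (delta s) (delta t)) - sgn_pow p (tp (delta s) (prepend g (del_coeff t))))"
  proof -
    have "app (seqs A p) del_coeff (delta s) = (del_coeff s :: _ \<Rightarrow> 'k)"
      "app (seqs B (Suc q)) del_coeff (delta (g # t)) = (del_coeff (g # t) :: _ \<Rightarrow> 'k)"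
      using x assms(1-3) by (simp_all add: app_delta finite_seqs Cons_in_seqs)
    then show ?thesis by (simp only: del_coeff_Cons[of g t] tp_diff sgn_pow_diff)
  qed
  finally have 1: "app (TX (seqs A) (seqs B) (Suc (Suc n))) (tc length del_coeff del_coeff) (h x) =
     sgn_pow p (tp (del_coeff s) (delta (g # t))) + (tp (delta s) (delta t) - tp (delta s) (prepend g (del_coeff t)))"
    using len by (simp add: h_def x(1) app_sgn_pow)
      (auto simp: sgn_pow_def algebra_simps fun_eq_iff simp flip: power_add mult.assoc mult_2)
  have "app (TX (seqs A) (seqs B) n) h (tp (del_coeff s) (delta t)) = - sgn_pow p (tp (del_coeff s) (delta (g # t)))"
  proof (cases p)
    case 0 then show ?thesis using x by simp
  next
    case (Suc p')
    then have "app (TX (seqs A) (seqs B) n) h (tp (del_coeff s) (delta t)) =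
        sgn_pow p' (tp (del_coeff s) (prepend g (delta t)))"
      using x d A.supp[of s p'] by (intro h_tp[of _ p' _ q]) auto
    then show ?thesis using Suc by (simp add: sgn_pow_Suc prepend_delta)
  qed
  moreover have "app (TX (seqs A) (seqs B) n) h (tp (delta s) (del_coeff t)) =
      sgn_pow p (tp (delta s) (prepend g (del_coeff t)))"
  proof (cases q)
    case 0 then show ?thesis using x by simp
  next
    case (Suc q')
    then show ?thesis using x d B.supp[of t q'] by (intro h_tp[of _ p _ q']) auto
  qed
  ultimately have 2: "app (TX (seqs A) (seqs B) n) h (tc length del_coeff del_coeff x) =
      - sgn_pow p (tp (del_coeff s) (delta (g # t))) + tp (delta s) (prepend g (del_coeff t))"
    using len by (simp add: x(1) tc_def app_add app_sgn_pow)
  show ?thesis unfolding 1 2 by (simp add: x(1) delta_pair)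
qed

text \<open>In multidegree \<open>m\<close>, a generator on either side that divides
  \<open>m\<close> contracts the factor to which it belongs, hence the product. If there is none,
  only the pair of empty sequences remains.\<close>

lemma pair_lcx:
  assumes "finite A" "finite B"
  shows "lcx (TX (seqs A) (seqs B)) ([], []) (\<lambda>(s, t). sup (lcm_seq e s) (lcm_seq e' t))
    (\<lambda>_. tc length del_coeff del_coeff :: _ \<Rightarrow> _ \<Rightarrow> 'k::field)" (is "lcx ?X _ ?l _")
proof -
  let ?c = "tc length del_coeff del_coeff :: 'a list \<times> 'b list \<Rightarrow> _ \<Rightarrow> 'k"
  interpret ucx ?X "\<lambda>(a, b). length a + length b" ?c
    by (intro tensor_ucx seqs_ucx assms)
  have nz: "?l b \<le> ?l a" if "?c a b \<noteq> 0" for a b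
  proof -
    obtain s t s' t' where ab: "a = (s, t)" "b = (s', t')" by (cases a, cases b)
    then have "(del_coeff s s' \<noteq> (0 :: 'k) \<and> t' = t) \<or> (s' = s \<and> del_coeff t t' \<noteq> (0 :: 'k))"
      using that by (auto simp: tc_def tp_def delta_def sgn_pow_def split: if_splits)
    then have "lcm_seq e s' \<le> lcm_seq e s \<and> lcm_seq e' t' \<le> lcm_seq e' t"
      using del_coeff_nonzero[of s s', where 'k = 'k] del_coeff_nonzero[of t t', where 'k = 'k]
        lcm_seq_mono[of s' s e] lcm_seq_mono[of t' t e'] by (elim disjE conjE) simp_all
    then show ?thesis using ab by (simp add: le_supI1 le_supI2)
  qed
  have hsupp: "app (?X (Suc n)) h v \<in> fsupp {a \<in> ?X (Suc (Suc n)). ?l a \<le> m}"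
    if v: "v \<in> fsupp {a \<in> ?X (Suc n). ?l a \<le> m}"
      and h: "\<And>a. a \<in> ?X (Suc n) \<Longrightarrow> ?l a \<le> m \<Longrightarrow> h a \<in> fsupp {a \<in> ?X (Suc (Suc n)). ?l a \<le> m}"
    for h :: "'a list \<times> 'b list \<Rightarrow> 'a list \<times> 'b list \<Rightarrow> 'k" and v n m
  proof -
    have "app (?X (Suc n)) h v = app {a \<in> ?X (Suc n). ?l a \<le> m} h v"
      using v fin by (intro app_restrict) auto
    also have "\<dots> \<in> fsupp {a \<in> ?X (Suc (Suc n)). ?l a \<le> m}" using h by (intro app_fsupp) auto
    finally show ?thesis .
  qed
  show ?thesis
  proof
    show "?X 0 = {([], [])}" by (auto simp: TX_def)
    show "b \<in> ?X n \<and> ?l b \<le> ?l a" if "a \<in> ?X (Suc n)" "?c a b \<noteq> 0" for a b n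
      using supp[OF that(1)] that(2) nz[OF that(2)] unfolding fsupp_def by blast
  next
    fix a assume "a \<in> ?X (Suc 0)"
    then have "(\<exists>x. a = ([x], [])) \<or> (\<exists>y. a = ([], [y]))"
      by (cases a) (auto simp: TX_def seqs_Suc le_Suc_eq)
    then show "?c a ([], []) \<noteq> (0 :: 'k)"
      by (auto simp: tc_def tp_def delta_def sgn_pow_def del_coeff.simps)
  next
    fix v :: "'a list \<times> 'b list \<Rightarrow> 'k" and n m
    assume v: "v \<in> fsupp {a \<in> ?X (Suc n). ?l a \<le> m}" "app (?X (Suc n)) ?c v = 0"
    have v1: "v \<in> fsupp (?X (Suc n))" using v by (auto simp: fsupp_def)
    consider g where "g \<in> A" "e g \<le> m" | g where "g \<in> B" "e' g \<le> m" |
      "\<forall>g\<in>A. \<not> e g \<le> m" "\<forall>g\<in>B. \<not> e' g \<le> m" by blast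
    then show "\<exists>w\<in>fsupp {a \<in> ?X (Suc (Suc n)). ?l a \<le> m}. app (?X (Suc (Suc n))) ?c w = v"
    proof cases
      case (1 g)
      show ?thesis
      proof (intro bexI[of _ "app (?X (Suc n)) (\<lambda>(s, t). tp (delta (g # s)) (delta t)) v"])
        show "app (?X (Suc (Suc n))) ?c (app (?X (Suc n)) (\<lambda>(s, t). tp (delta (g # s)) (delta t)) v) = v"
          by (rule homotopy_exact[OF fin v1 v(2)], rule homotopy_fst) (use assms 1 in auto)
        show "app (?X (Suc n)) (\<lambda>(s, t). tp (delta (g # s)) (delta t)) v
            \<in> fsupp {a \<in> ?X (Suc (Suc n)). ?l a \<le> m}"
        proof (rule hsupp[OF v(1)])
          fix a assume a: "a \<in> ?X (Suc n)" "?l a \<le> m"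
          then obtain s t p q where "a = (s, t)" "p + q = Suc n" "s \<in> seqs A p" "t \<in> seqs B q"
            by (cases a) (auto simp: TX_iff)
          moreover from this have "(g # s, t) \<in> ?X (Suc (Suc n))" unfolding TX_iff
            by - (rule exI[of _ "Suc p"], rule exI[of _ q], use 1 in \<open>auto simp: Cons_in_seqs\<close>)
          ultimately have "(g # s, t) \<in> {a \<in> ?X (Suc (Suc n)). ?l a \<le> m}" using a 1 by auto
          then show "(case a of (s, t) \<Rightarrow> tp (delta (g # s)) (delta t)) \<in> fsupp {a \<in> ?X (Suc (Suc n)). ?l a \<le> m}"
            unfolding \<open>a = (s, t)\<close> prod.case delta_pair[symmetric] by (rule fsupp_delta)
        qed
      qed
    next
      case (2 g)
      show ?thesis
      proof (intro bexI[of _ "app (?X (Suc n)) (\<lambda>(s, t). sgn_pow (length s) (tp (delta s) (delta (g # t)))) v"])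
        show "app (?X (Suc (Suc n))) ?c
            (app (?X (Suc n)) (\<lambda>(s, t). sgn_pow (length s) (tp (delta s) (delta (g # t)))) v) = v"
          by (rule homotopy_exact[OF fin v1 v(2)], rule homotopy_snd) (use assms 2 in auto)
        show "app (?X (Suc n)) (\<lambda>(s, t). sgn_pow (length s) (tp (delta s) (delta (g # t)))) v
            \<in> fsupp {a \<in> ?X (Suc (Suc n)). ?l a \<le> m}"
        proof (rule hsupp[OF v(1)])
          fix a assume a: "a \<in> ?X (Suc n)" "?l a \<le> m"
          then obtain s t p q where "a = (s, t)" "p + q = Suc n" "s \<in> seqs A p" "t \<in> seqs B q"
            by (cases a) (auto simp: TX_iff)
          moreover from this have "(s, g # t) \<in> ?X (Suc (Suc n))" unfolding TX_iff
            by - (rule exI[of _ p], rule exI[of _ "Suc q"], use 2 in \<open>auto simp: Cons_in_seqs\<close>)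
          ultimately have "(s, g # t) \<in> {a \<in> ?X (Suc (Suc n)). ?l a \<le> m}" using a 2 by auto
          then show "(case a of (s, t) \<Rightarrow> sgn_pow (length s) (tp (delta s) (delta (g # t))))
              \<in> fsupp {a \<in> ?X (Suc (Suc n)). ?l a \<le> m}"
            unfolding \<open>a = (s, t)\<close> prod.case delta_pair[symmetric] by (intro sgn_pow_fsupp fsupp_delta)
        qed
      qed
    next
      case 3
      have "v a = 0" for a
      proof (rule ccontr)
        assume "v a \<noteq> 0"
        then have "a \<in> {a \<in> ?X (Suc n). ?l a \<le> m}" using v(1) unfolding fsupp_def by blast
        then have a: "a \<in> ?X (Suc n)" "?l a \<le> m" by simp_all
        obtain s t where st: "a = (s, t)" by fastforce
        have "s = []" "t = []" using a 3 st
          by (auto simp: TX_iff seqs_def lcm_seq_le_iff neq_Nil_conv subset_iff)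
        then show False using a st by (auto simp: TX_iff seqs_def)
      qed
      then have "v = 0" by (simp add: fun_eq_iff)
      then show ?thesis by (intro bexI[of _ 0]) (auto simp: fsupp_def)
    qed
  qed (auto simp: fin dd)
qed

section \<open>The mapping cone of a splitting\<close>

text \<open>
  The cone of the chain map \<open>s \<mapsto> map \<psi> s\<close> from the Taylor complex on \<open>M\<close>, with all labels multiplied
  up by \<open>F\<close>, to the one on \<open>K\<close>.  The flag \<open>True\<close> marks the source of the map.
\<close>

definition cone_X :: "'g set \<Rightarrow> 'g set \<Rightarrow> nat \<Rightarrow> (bool \<times> 'g list) set" where
  "cone_X K M n = Pair False ` seqs K n \<union> (case n of 0 \<Rightarrow> {} | Suc p \<Rightarrow> Pair True ` seqs M p)"

definition join :: "('a \<Rightarrow> 'k) \<Rightarrow> ('a \<Rightarrow> 'k) \<Rightarrow> bool \<times> 'a \<Rightarrow> 'k" where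
  "join u v = (\<lambda>(b, s). if b then v s else u s)"

text \<open>The source carries the negative of its differential. As \<open>map \<psi>\<close>
  commutes with the deletions, this makes the square of the cone differential vanish.\<close>

definition cone_c :: "('g \<Rightarrow> 'g) \<Rightarrow> bool \<times> 'g list \<Rightarrow> bool \<times> 'g list \<Rightarrow> 'k::field" where
  "cone_c \<psi> = (\<lambda>(b, s). if b then join (delta (map \<psi> s)) (- del_coeff s) else join (del_coeff s) 0)"

text \<open>The empty sequence of the source gets the label \<open>F\<close>: it is the basis
  element that accounts for the additional generator \<open>F\<close>. When all generators used are
  multiples of \<open>F\<close>, the \<open>sup\<close> changes no other label.\<close>

definition cone_l :: "('g \<Rightarrow> 'x monomial) \<Rightarrow> 'x monomial \<Rightarrow> bool \<times> 'g list \<Rightarrow> 'x monomial" where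
  "cone_l e F = (\<lambda>(b, s). if b then sup F (lcm_seq e s) else lcm_seq e s)"

abbreviation push :: "('g \<Rightarrow> 'h) \<Rightarrow> 'g set \<Rightarrow> nat \<Rightarrow> ('g list \<Rightarrow> 'k::field) \<Rightarrow> 'h list \<Rightarrow> 'k" where
  "push \<psi> M n \<equiv> app (seqs M n) (\<lambda>s. delta (map \<psi> s))"

lemma join_eqs: "join u v (False, s) = u s" "join u v (True, s) = v s"
  by (simp_all add: join_def)

lemma join_0 [simp]: "join 0 0 = 0"
  by (auto simp: join_def)

text \<open>Deletion acts on positions, so it commutes with \<open>map \<psi>\<close> even where
  \<open>\<psi>\<close> identifies generators.\<close>

lemma push_del_coeff:
  assumes "finite M" "s \<in> seqs M (Suc n)"
  shows "push \<psi> M n (del_coeff s) = (del_coeff (map \<psi> s) :: _ \<Rightarrow> 'k::field)"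
  using assms(2)
proof (induction n arbitrary: s)
  case 0
  then obtain x where "s = [x]" by (auto simp: seqs_Suc)
  then show ?case by (simp add: del_coeff_Cons app_delta)
next
  case (Suc n)
  then obtain x s' where s: "s = x # s'" "x \<in> M" "s' \<in> seqs M (Suc n)" by (auto simp: seqs_Suc)
  have "push \<psi> M (Suc n) (prepend x (del_coeff s')) = prepend (\<psi> x) (push \<psi> M n (del_coeff s') :: _ \<Rightarrow> 'k)"
    by (simp add: app_prepend assms(1) s(2) app_mat_prepend flip: prepend_delta)
  moreover have "push \<psi> M (Suc n) (delta s') = (delta (map \<psi> s') :: _ \<Rightarrow> 'k)"
    using s(3) assms(1) by (simp add: app_delta finite_seqs)
  ultimately show ?case
    by (simp only: s(1) list.map del_coeff_Cons app_diff Suc.IH[OF s(3)])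
qed

lemma push_app:
  assumes "finite M" "\<And>x. x \<in> M \<Longrightarrow> \<psi> x \<in> K" "finite K"
  shows "app (seqs K (Suc n)) del_coeff (push \<psi> M (Suc n) v) =
    push \<psi> M n (app (seqs M (Suc n)) del_coeff v :: _ \<Rightarrow> 'k::field)"
  unfolding app_app
proof (rule app_cong[OF refl refl])
  fix s assume s: "s \<in> seqs M (Suc n)"
  then have "map \<psi> s \<in> seqs K (Suc n)" using assms(2) by (auto simp: seqs_def)
  then show "app (seqs K (Suc n)) del_coeff (delta (map \<psi> s)) = (push \<psi> M n (del_coeff s) :: _ \<Rightarrow> 'k)"
    by (simp add: push_del_coeff[OF assms(1) s] app_delta finite_seqs assms)
qed

lemma app_cone:
  assumes "finite K" "finite M"
  shows "app (cone_X K M (Suc n)) (cone_c \<psi>) (join u v) =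
    join (app (seqs K (Suc n)) del_coeff u + push \<psi> M n v) (- app (seqs M n) del_coeff v :: _ \<Rightarrow> 'k::field)"
proof
  fix x :: "bool \<times> 'a list"
  obtain b t where x: "x = (b, t)" by fastforce
  have "app (cone_X K M (Suc n)) (cone_c \<psi>) (join u v) x =
      (\<Sum>s\<in>seqs K (Suc n). u s * cone_c \<psi> (False, s) x) + (\<Sum>s\<in>seqs M n. v s * cone_c \<psi> (True, s) x)"
    unfolding app_def cone_X_def nat.case
    by (subst sum.union_disjoint) (auto simp: finite_seqs assms sum.reindex inj_on_def join_eqs)
  then show "app (cone_X K M (Suc n)) (cone_c \<psi>) (join u v) x =
    join (app (seqs K (Suc n)) del_coeff u + push \<psi> M n v) (- app (seqs M n) del_coeff v :: _ \<Rightarrow> 'k) x"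
    by (cases b) (simp_all add: x cone_c_def join_eqs app_def sum_negf)
qed

text \<open>For a cycle \<open>join u v\<close>, first \<open>v\<close> is contracted inside the
  complex on \<open>M\<close>, then the correction of \<open>u\<close> by the pushed contraction is
  a cycle of the exact complex on \<open>K\<close>. The hypothesis \<open>cov\<close> says that
  \<open>M\<close> covers the intersection of \<open>K\<close> with \<open>(F)\<close>; it supplies
  the contracting generator when \<open>v\<close> lives on the empty sequence.\<close>

lemma cone_lcx:
  fixes \<psi> :: "'g \<Rightarrow> 'g" and e :: "'g \<Rightarrow> 'x::finite monomial"
  assumes fin: "finite K" "finite M"
    and \<psi>: "\<And>w. w \<in> M \<Longrightarrow> \<psi> w \<in> K" "\<And>w. w \<in> M \<Longrightarrow> e (\<psi> w) \<le> e w"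
    and cov: "\<And>g m. g \<in> K \<Longrightarrow> e g \<le> m \<Longrightarrow> F \<le> m \<Longrightarrow> \<exists>w\<in>M. e w \<le> m"
  shows "lcx (cone_X K M) (False, []) (cone_l e F) (\<lambda>_. cone_c \<psi> :: _ \<Rightarrow> _ \<Rightarrow> 'k::field)"
proof -
  interpret K: lcx "seqs K" "[]" "lcm_seq e" "\<lambda>_. del_coeff :: _ \<Rightarrow> _ \<Rightarrow> 'k"
    by (rule taylor_lcx[OF fin(1)])
  let ?X = "cone_X K M" and ?c = "cone_c \<psi> :: _ \<Rightarrow> _ \<Rightarrow> 'k" and ?l = "cone_l e F"
  have split: "z = join (\<lambda>s. z (False, s)) (\<lambda>s. z (True, s))" for z :: "bool \<times> 'g list \<Rightarrow> 'k"
    by (rule ext) (auto simp: join_def)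
  have map_in: "map \<psi> s \<in> seqs K n" if "s \<in> seqs M n" for s n
    using that \<psi>(1) by (auto simp: seqs_def)
  have map_le: "lcm_seq e (map \<psi> s) \<le> lcm_seq e s" if "set s \<subseteq> M" for s
    using that \<psi>(2) order_trans lcm_seq_le_iff[of e s "lcm_seq e s"] by (auto simp: lcm_seq_le_iff subset_iff) blast
  show ?thesis
  proof
    show "finite (?X n)" for n using fin by (cases n) (auto simp: cone_X_def finite_seqs)
    show "?X 0 = {(False, [])}" by (simp add: cone_X_def)
    show "?l (False, []) = 0" by (simp add: cone_l_def)
  next
    fix a b n assume a: "a \<in> ?X (Suc n)" and nz: "?c a b \<noteq> (0 :: 'k)"
    obtain ab s where as: "a = (ab, s)" by fastforce
    obtain bb t where bt: "b = (bb, t)" by fastforce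
    show "b \<in> ?X n \<and> ?l b \<le> ?l a"
    proof (cases ab)
      case False
      then have s: "s \<in> seqs K (Suc n)" using a as by (auto simp: cone_X_def)
      have "\<not> bb" "del_coeff s t \<noteq> (0 :: 'k)" using nz False as bt by (auto simp: cone_c_def join_def split: if_splits)
      then show ?thesis using K.c_supp[OF s] False as bt by (auto simp: cone_X_def cone_l_def)
    next
      case True
      then have s: "s \<in> seqs M n" using a as by (auto simp: cone_X_def)
      then have sM: "set s \<subseteq> M" by (auto simp: seqs_def)
      show ?thesis
      proof (cases bb)
        case False
        then have "t = map \<psi> s" using nz True as bt by (auto simp: cone_c_def join_def delta_def split: if_splits)
        then show ?thesis using map_in[OF s] map_le[OF sM] False True as bt
          by (auto simp: cone_X_def cone_l_def le_supI2)
      next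
        case bb: True
        then have d: "del_coeff s t \<noteq> (0 :: 'k)" using nz True as bt by (auto simp: cone_c_def join_def)
        then have "length s = Suc (length t)" "set t \<subseteq> set s" using del_coeff_nonzero by blast+
        then have "t \<in> seqs M (n - 1)" "n = Suc (n - 1)" "lcm_seq e t \<le> lcm_seq e s"
          using s lcm_seq_mono by (auto simp: seqs_def)
        then show ?thesis using bb True as bt
          by (auto simp: cone_X_def cone_l_def le_supI2 split: nat.split)
      qed
    qed
  next
    fix a assume "a \<in> ?X (Suc 0)"
    then show "?c a (False, []) \<noteq> (0 :: 'k)"
      by (auto simp: cone_X_def seqs_Suc cone_c_def join_def delta_def del_coeff.simps)
  next
    fix a n assume a: "a \<in> ?X (Suc (Suc n))"
    show "app (?X (Suc n)) ?c (?c a) = 0"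
    proof (cases "fst a")
      case False
      then obtain s where s: "a = (False, s)" "s \<in> seqs K (Suc (Suc n))" using a by (auto simp: cone_X_def)
      have ca: "?c a = join (del_coeff s) 0" by (simp add: s(1) cone_c_def)
      show ?thesis unfolding ca app_cone[OF fin] using del_coeff_dd[OF fin(1) s(2), where 'k = 'k] by simp
    next
      case True
      then obtain s where s: "a = (True, s)" "s \<in> seqs M (Suc n)" using a by (auto simp: cone_X_def)
      have ca: "?c a = join (delta (map \<psi> s)) (- del_coeff s)" by (simp add: s(1) cone_c_def)
      show ?thesis unfolding ca app_cone[OF fin] app_uminus
        using del_coeff_dd[OF fin(2) s(2), where 'k = 'k] push_del_coeff[OF fin(2) s(2), of \<psi>, where 'k = 'k] map_in[OF s(2)]
        by (simp add: app_delta finite_seqs fin)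
    qed
  next
    fix z :: "bool \<times> 'g list \<Rightarrow> 'k" and n m
    assume z: "z \<in> fsupp {a \<in> ?X (Suc n). ?l a \<le> m}" and dz: "app (?X (Suc n)) ?c z = 0"
    define u where "u s = z (False, s)" for s
    define v where "v s = z (True, s)" for s
    have zuv: "z = join u v" unfolding u_def v_def by (rule split)
    have u: "u \<in> fsupp {s \<in> seqs K (Suc n). lcm_seq e s \<le> m}"
    proof -
      have "z (False, s) = 0" if "s \<notin> {s \<in> seqs K (Suc n). lcm_seq e s \<le> m}" for s
      proof -
        have "(False, s) \<notin> {a \<in> ?X (Suc n). ?l a \<le> m}" using that by (auto simp: cone_X_def cone_l_def)
        then show ?thesis using z unfolding fsupp_def by blast
      qed
      then show ?thesis by (simp add: fsupp_def u_def)
    qed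
    have v: "v \<in> fsupp {s \<in> seqs M n. F \<le> m \<and> lcm_seq e s \<le> m}"
    proof -
      have "z (True, s) = 0" if "s \<notin> {s \<in> seqs M n. F \<le> m \<and> lcm_seq e s \<le> m}" for s
      proof -
        have "(True, s) \<notin> {a \<in> ?X (Suc n). ?l a \<le> m}" using that by (auto simp: cone_X_def cone_l_def)
        then show ?thesis using z unfolding fsupp_def by blast
      qed
      then show ?thesis by (simp add: fsupp_def v_def)
    qed
    have v1: "v \<in> fsupp (seqs M n)" using v by (auto simp: fsupp_def)
    have "join (app (seqs K (Suc n)) del_coeff u + push \<psi> M n v) (- app (seqs M n) del_coeff v) = 0"
      using dz zuv app_cone[OF fin, of n \<psi> u v] by simp
    then have "join (app (seqs K (Suc n)) del_coeff u + push \<psi> M n v) (- app (seqs M n) del_coeff v) (b, s) = 0" for b s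
      by (simp add: fun_eq_iff)
    from this[of False] this[of True]
    have du: "app (seqs K (Suc n)) del_coeff u + push \<psi> M n v = 0" and dv: "app (seqs M n) del_coeff v = 0"
      by (auto simp: join_eqs fun_eq_iff)
    have lift: "join w w' \<in> fsupp {a \<in> ?X (Suc (Suc n)). ?l a \<le> m}"
      if "w \<in> fsupp {s \<in> seqs K (Suc (Suc n)). lcm_seq e s \<le> m}"
        "w' \<in> fsupp {s \<in> seqs M (Suc n). F \<le> m \<and> lcm_seq e s \<le> m}" for w w' :: "'g list \<Rightarrow> 'k"
      using that by (auto simp: fsupp_def join_def cone_X_def cone_l_def)
    show "\<exists>w\<in>fsupp {a \<in> ?X (Suc (Suc n)). ?l a \<le> m}. app (?X (Suc (Suc n))) ?c w = z"
    proof (cases "v = 0")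
      case True
      then obtain w where w: "w \<in> fsupp {s \<in> seqs K (Suc (Suc n)). lcm_seq e s \<le> m}"
        "app (seqs K (Suc (Suc n))) del_coeff w = u"
        using K.exact[OF u] du by auto
      have "app (?X (Suc (Suc n))) ?c (join w 0) = z"
        unfolding app_cone[OF fin] using w(2) zuv True by simp
      then show ?thesis using w lift[of w 0] by (intro bexI[of _ "join w 0"]) (auto simp: fsupp_def)
    next
      case False
      then obtain t where t: "v t \<noteq> 0" by (auto simp: fun_eq_iff)
      then have "t \<in> {s \<in> seqs M n. F \<le> m \<and> lcm_seq e s \<le> m}" using v unfolding fsupp_def by blast
      then have t': "t \<in> seqs M n" "F \<le> m" "lcm_seq e t \<le> m" by auto
      have "\<exists>x\<in>M. e x \<le> m"
      proof (cases t)
        case (Cons x t'')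
        then show ?thesis using t' by (auto simp: seqs_def)
      next
        case Nil
        then have n: "n = 0" using t' by (auto simp: seqs_def)
        \<comment> \<open>The differential of \<open>u\<close> must cancel the nonzero
          \<open>v []\<close>, so some generator of \<open>K\<close> divides \<open>m\<close>. As
          \<open>F\<close> also divides \<open>m\<close>, \<open>cov\<close> applies.\<close>
        have "push \<psi> M n v [] = v []" by (simp add: n app_def delta_def)
        then have "app (seqs K (Suc n)) del_coeff u [] \<noteq> 0"
          using fun_cong[OF du, of "[]"] t Nil by auto
        then obtain s where s: "s \<in> seqs K (Suc n)" "u s \<noteq> 0" using app_nonzeroE by metis
        then have "s \<in> {s \<in> seqs K (Suc n). lcm_seq e s \<le> m}" using u unfolding fsupp_def by blast
        then obtain g where "g \<in> K" "e g \<le> m" by (auto simp: seqs_Suc n)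
        then show ?thesis using cov t' by blast
      qed
      then obtain x where x: "x \<in> M" "e x \<le> m" by blast
      define y where "y = prepend x v"
      have y: "y \<in> fsupp {s \<in> seqs M (Suc n). F \<le> m \<and> lcm_seq e s \<le> m}"
        using x v by (auto simp: y_def fsupp_def prepend_def Cons_in_seqs split: list.splits)
      have dy: "app (seqs M (Suc n)) del_coeff y = v"
        unfolding y_def using app_del_coeff_prepend[OF fin(2) x(1) v1] dv by simp
      have "push \<psi> M (Suc n) y = app {s \<in> seqs M (Suc n). F \<le> m \<and> lcm_seq e s \<le> m} (\<lambda>s. delta (map \<psi> s)) y"
        using y fin by (intro app_restrict) (auto simp: finite_seqs)
      also have "\<dots> \<in> fsupp {s \<in> seqs K (Suc n). lcm_seq e s \<le> m}"
      proof (intro app_fsupp fsupp_delta)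
        fix s assume s: "s \<in> {s \<in> seqs M (Suc n). F \<le> m \<and> lcm_seq e s \<le> m}"
        then have "lcm_seq e (map \<psi> s) \<le> lcm_seq e s" by (intro map_le) (auto simp: seqs_def)
        then show "map \<psi> s \<in> {s \<in> seqs K (Suc n). lcm_seq e s \<le> m}"
          using s map_in order_trans by blast
      qed
      finally have "u + push \<psi> M (Suc n) y \<in> fsupp {s \<in> seqs K (Suc n). lcm_seq e s \<le> m}"
        using u by (intro fsupp_add)
      moreover have "app (seqs K (Suc n)) del_coeff (u + push \<psi> M (Suc n) y) = 0"
        using push_app[where \<psi> = \<psi> and v = y, OF fin(2) \<psi>(1) fin(1)] du by (simp add: app_add dy)
      ultimately obtain w where w: "w \<in> fsupp {s \<in> seqs K (Suc (Suc n)). lcm_seq e s \<le> m}"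
        "app (seqs K (Suc (Suc n))) del_coeff w = u + push \<psi> M (Suc n) y"
        using K.exact by blast
      \<comment> \<open>The minus sign compensates the negated differential of the source, and the
        pushed \<open>- y\<close> removes the correction that was added to \<open>u\<close>.\<close>
      have "app (?X (Suc (Suc n))) ?c (join w (- y)) = z"
        unfolding app_cone[OF fin] app_uminus w(2) dy zuv by simp
      moreover have "- y \<in> fsupp {s \<in> seqs M (Suc n). F \<le> m \<and> lcm_seq e s \<le> m}"
        using y by (auto simp: fsupp_def)
      ultimately show ?thesis using w(1) lift by blast
    qed
  qed
qed

section \<open>Homology of direct sums\<close>

text \<open>A block-diagonal complex. Homology in degree \<open>n\<close> sees only degrees up to
  \<open>Suc n\<close>, so the decomposition is required only there; this lets a finite index set
  \<open>Y\<close> suffice even when new blocks start in every degree.\<close>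

lemma hdim_direct_sum:
  fixes X :: "'i \<Rightarrow> nat \<Rightarrow> 'b set" and c :: "'i \<Rightarrow> nat \<Rightarrow> 'b \<Rightarrow> 'b \<Rightarrow> 'k::field"
  assumes Y: "finite Y" and k: "\<And>y. y \<in> Y \<Longrightarrow> kcx (X y) (deg y) (c y)"
    and W: "\<And>p. p \<le> Suc n \<Longrightarrow> W p = Sigma Y (\<lambda>y. X y p)"
    and d: "\<And>p y b. p \<le> Suc n \<Longrightarrow> y \<in> Y \<Longrightarrow> b \<in> X y p \<Longrightarrow> d p (y, b) = deg y p b"
    and cc: "\<And>p y b. p \<le> n \<Longrightarrow> y \<in> Y \<Longrightarrow> b \<in> X y (Suc p) \<Longrightarrow>
      cc p (y, b) = (\<lambda>(y', b'). if y' = y then c y p b b' else 0)"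
  shows "hdim W d cc n j = (\<Sum>y\<in>Y. hdim (X y) (deg y) (c y) n j)"
proof -
  have fin: "finite (X y p)" if "y \<in> Y" for y p using kcx.fin[OF k[OF that]] .
  let ?fib = "\<lambda>S. {z :: 'i \<times> 'b \<Rightarrow> 'k. \<forall>y. (\<lambda>b. z (y, b)) \<in> (if y \<in> Y then S y else {0})}"
  have supp: "z \<in> fsupp {a \<in> W p. d p a = j} \<longleftrightarrow> z \<in> ?fib (\<lambda>y. fsupp {b \<in> X y p. deg y p b = j})"
    if "p \<le> Suc n" for z p
  proof
    assume "z \<in> fsupp {a \<in> W p. d p a = j}"
    then show "z \<in> ?fib (\<lambda>y. fsupp {b \<in> X y p. deg y p b = j})"
      using W[OF that] d[OF that] by (auto simp: fsupp_def fun_eq_iff)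
  next
    assume z: "z \<in> ?fib (\<lambda>y. fsupp {b \<in> X y p. deg y p b = j})"
    have "y \<in> Y \<and> b \<in> X y p \<and> deg y p b = j" if nz: "z (y, b) \<noteq> 0" for y b
    proof -
      have "(\<lambda>b. z (y, b)) \<in> (if y \<in> Y then fsupp {b \<in> X y p. deg y p b = j} else {0})" using z by blast
      then show ?thesis using nz by (auto simp: fsupp_def fun_eq_iff split: if_splits)
    qed
    then show "z \<in> fsupp {a \<in> W p. d p a = j}"
      unfolding fsupp_def using W[OF that] d[OF that] by force
  qed
  have act: "(\<lambda>b. app (W (Suc p)) (cc p) z (y, b)) =
      (if y \<in> Y then app (X y (Suc p)) (c y p) (\<lambda>b. z (y, b)) else 0)" if p: "p \<le> n" for p z y
  proof
    fix b
    have "app (W (Suc p)) (cc p) z (y, b) =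
        (\<Sum>y'\<in>Y. \<Sum>b'\<in>X y' (Suc p). z (y', b') * cc p (y', b') (y, b))"
      using p by (simp add: app_def W sum.Sigma Y fin split_def)
    also have "\<dots> = (\<Sum>y'\<in>Y. if y' = y then app (X y (Suc p)) (c y p) (\<lambda>b. z (y, b)) b else 0)"
      using cc[OF p] by (intro sum.cong refl) (auto simp: app_def)
    finally show "app (W (Suc p)) (cc p) z (y, b) =
      (if y \<in> Y then app (X y (Suc p)) (c y p) (\<lambda>b. z (y, b)) else 0) b"
      using Y by simp
  qed
  have "cyc W d cc n j = ?fib (\<lambda>y. cyc (X y) (deg y) (c y) n j)"
  proof (rule set_eqI)
    fix z
    have app0: "app (W (Suc m)) (cc m) z = 0 \<longleftrightarrow>
        (\<forall>y\<in>Y. app (X y (Suc m)) (c y m) (\<lambda>b. z (y, b)) = 0)" if "m \<le> n" for m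
    proof -
      have "app (W (Suc m)) (cc m) z = 0 \<longleftrightarrow> (\<forall>y. (\<lambda>b. app (W (Suc m)) (cc m) z (y, b)) = 0)"
        by (auto simp: fun_eq_iff)
      then show ?thesis unfolding act[OF that] by auto
    qed
    have "z \<in> cyc W d cc n j \<longleftrightarrow> z \<in> ?fib (\<lambda>y. fsupp {b \<in> X y n. deg y n b = j}) \<and>
        (\<forall>m. n = Suc m \<longrightarrow> (\<forall>y\<in>Y. app (X y (Suc m)) (c y m) (\<lambda>b. z (y, b)) = 0))"
      unfolding cyc_def using supp[of n z] app0 by auto
    then show "z \<in> cyc W d cc n j \<longleftrightarrow> z \<in> ?fib (\<lambda>y. cyc (X y) (deg y) (c y) n j)"
      unfolding cyc_def by auto
  qed
  moreover have "bnd W d cc n j = ?fib (\<lambda>y. bnd (X y) (deg y) (c y) n j)"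
  proof (intro set_eqI iffI)
    fix z assume "z \<in> bnd W d cc n j"
    then obtain w where w: "w \<in> ?fib (\<lambda>y. fsupp {b \<in> X y (Suc n). deg y (Suc n) b = j})"
      "z = app (W (Suc n)) (cc n) w"
      unfolding bnd_def using supp[of "Suc n"] by auto
    have "(\<lambda>b. z (y, b)) \<in> (if y \<in> Y then bnd (X y) (deg y) (c y) n j else {0})" for y
      unfolding w(2) act[OF order_refl] bnd_def using w(1) by (auto dest!: spec[of _ y])
    then show "z \<in> ?fib (\<lambda>y. bnd (X y) (deg y) (c y) n j)" by blast
  next
    fix z assume z: "z \<in> ?fib (\<lambda>y. bnd (X y) (deg y) (c y) n j)"
    have "\<forall>y\<in>Y. \<exists>w. w \<in> fsupp {b \<in> X y (Suc n). deg y (Suc n) b = j} \<and>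
        (\<lambda>b. z (y, b)) = app (X y (Suc n)) (c y n) w"
    proof
      fix y assume "y \<in> Y"
      then have "(\<lambda>b. z (y, b)) \<in> bnd (X y) (deg y) (c y) n j" using z by (auto dest!: spec[of _ y])
      then show "\<exists>w. w \<in> fsupp {b \<in> X y (Suc n). deg y (Suc n) b = j} \<and>
        (\<lambda>b. z (y, b)) = app (X y (Suc n)) (c y n) w" by (auto simp: bnd_def)
    qed
    from bchoice[OF this] obtain w
      where w: "\<And>y. y \<in> Y \<Longrightarrow> w y \<in> fsupp {b \<in> X y (Suc n). deg y (Suc n) b = j}"
      "\<And>y. y \<in> Y \<Longrightarrow> (\<lambda>b. z (y, b)) = app (X y (Suc n)) (c y n) (w y)" by blast
    define w' where "w' = (\<lambda>(y, b). if y \<in> Y then w y b else 0)"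
    have w'y: "(\<lambda>b. w' (y, b)) = (if y \<in> Y then w y else 0)" for y by (auto simp: w'_def)
    have "w' \<in> fsupp {a \<in> W (Suc n). d (Suc n) a = j}"
      unfolding supp[OF order_refl] using w(1) by (auto simp: w'y)
    moreover have "z x = app (W (Suc n)) (cc n) w' x" for x
    proof -
      obtain y b where x: "x = (y, b)" by fastforce
      have "(\<lambda>b. z (y, b)) = (\<lambda>b. app (W (Suc n)) (cc n) w' (y, b))"
        unfolding act[OF order_refl] w'y using w(2) z by (auto dest!: spec[of _ y])
      then show ?thesis unfolding x by (rule fun_cong)
    qed
    ultimately show "z \<in> bnd W d cc n j" unfolding bnd_def by (intro image_eqI[of _ _ w']) auto
  qed
  moreover have "fs.dim (?fib (\<lambda>y. cyc (X y) (deg y) (c y) n j)) = (\<Sum>y\<in>Y. fs.dim (cyc (X y) (deg y) (c y) n j))"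
  proof (rule dim_direct_sum[where X = "\<lambda>y. X y n"])
    fix y assume "y \<in> Y"
    then show "fs.subspace (cyc (X y) (deg y) (c y) n j)" by (intro kcx.cyc_subspace k)
  qed (use Y fin in \<open>auto simp: cyc_def fsupp_def\<close>)
  moreover have "fs.dim (?fib (\<lambda>y. bnd (X y) (deg y) (c y) n j)) = (\<Sum>y\<in>Y. fs.dim (bnd (X y) (deg y) (c y) n j))"
  proof (rule dim_direct_sum[where X = "\<lambda>y. X y n"])
    fix y assume "y \<in> Y"
    then show "bnd (X y) (deg y) (c y) n j \<subseteq> fsupp (X y n)"
      using kcx.bnd_subset_cyc[OF k, of y n j] by (auto simp: cyc_def fsupp_def)
  next
    fix y assume "y \<in> Y"
    then show "fs.subspace (bnd (X y) (deg y) (c y) n j)" by (intro kcx.bnd_subspace k)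
  qed (use Y fin in auto)
  \<comment> \<open>Truncated subtraction commutes with the sum because every boundary space lies in
    its cycle space.\<close>
  moreover have "(\<Sum>y\<in>Y. hdim (X y) (deg y) (c y) n j) =
      (\<Sum>y\<in>Y. fs.dim (cyc (X y) (deg y) (c y) n j)) - (\<Sum>y\<in>Y. fs.dim (bnd (X y) (deg y) (c y) n j))"
    unfolding hdim_def
  proof (rule sum_subtractf_nat)
    fix y assume y: "y \<in> Y"
    have "cyc (X y) (deg y) (c y) n j \<subseteq> fs.span (delta ` X y n)"
      using fsupp_in_span[OF fin[OF y]] by (auto simp: cyc_def fsupp_def)
    then show "fs.dim (bnd (X y) (deg y) (c y) n j) \<le> fs.dim (cyc (X y) (deg y) (c y) n j)"
      using fs.dim_mono_finite[OF _ _ kcx.bnd_subset_cyc[OF k[OF y]]] fin[OF y] by blast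
  qed
  ultimately show ?thesis by (simp add: hdim_def)
qed

section \<open>Shifted and rescaled complexes\<close>

definition shift :: "nat \<Rightarrow> (nat \<Rightarrow> 'a set) \<Rightarrow> nat \<Rightarrow> 'a set" where
  "shift p X n = (if p \<le> n then X (n - p) else {})"

lemma app_mat_scale: "app X (\<lambda>a b. \<sigma> * c a b) u = app X c (fscale \<sigma> u)"
  by (auto simp: app_def fscale_def algebra_simps)

text \<open>A nonzero factor \<open>\<sigma>\<close> changes neither kernels nor images of the
  differential. The vanishing of \<open>c\<close> on \<open>X 0\<close> is needed because these
  elements move up to degree \<open>p\<close>, where a differential leaves.\<close>

lemma hdim_shift:
  fixes c :: "'a \<Rightarrow> 'a \<Rightarrow> 'k::field"
  assumes k: "kcx X (\<lambda>_. dg) (\<lambda>_. c)" and c0: "\<And>a. a \<in> X 0 \<Longrightarrow> c a = 0" and \<sigma>: "\<sigma> \<noteq> 0"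
  shows "kcx (shift p X) (\<lambda>_ a. dg a + d) (\<lambda>_ a b. \<sigma> * c a b)"
    and "hdim (shift p X) (\<lambda>_ a. dg a + d) (\<lambda>_ a b. \<sigma> * c a b) n j =
      (if p \<le> n then hdim X (\<lambda>_. dg) (\<lambda>_. c) (n - p) (j - d) else 0)"
proof -
  interpret kcx X "\<lambda>_. dg" "\<lambda>_. c" by fact
  have shc: "\<sigma> * c a b \<noteq> 0 \<Longrightarrow> a \<in> shift p X (Suc n) \<Longrightarrow> p \<le> n \<and> a \<in> X (Suc (n - p)) \<and> c a b \<noteq> 0" for a b n
    using c0 by (cases "p = Suc n") (auto simp: shift_def Suc_diff_le split: if_splits)
  show "kcx (shift p X) (\<lambda>_ a. dg a + d) (\<lambda>_ a b. \<sigma> * c a b)"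
  proof
    show "finite (shift p X n)" for n by (simp add: shift_def fin)
    show "b \<in> shift p X n \<and> dg b + d = dg a + d" if "a \<in> shift p X (Suc n)" "\<sigma> * c a b \<noteq> 0" for a n b
      using shc[OF that(2,1)] graded[of a "n - p" b] by (auto simp: shift_def)
    show "app (shift p X (Suc n)) (\<lambda>a b. \<sigma> * c a b) (\<lambda>b. \<sigma> * c a b) = 0" if a: "a \<in> shift p X (Suc (Suc n))" for a n
    proof -
      have "app (shift p X (Suc n)) c (c a) = 0"
      proof (cases "p \<le> n")
        case True
        then show ?thesis using dd[of a "n - p"] a by (simp add: shift_def Suc_diff_le)
      next
        case False
        then show ?thesis using c0 by (intro app_mat_zero) (auto simp: shift_def split: if_splits)
      qed
      then show ?thesis
        by (simp only: app_mat_scale app_scale[of _ _ \<sigma>] app_fscale) (simp add: fscale_def fun_eq_iff)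
    qed
  qed
  have fsc: "fscale \<sigma> ` fsupp Z = fsupp Z" for Z :: "'a set"
  proof
    show "fscale \<sigma> ` fsupp Z \<subseteq> fsupp Z" by (auto simp: fscale_def fsupp_def)
    show "fsupp Z \<subseteq> fscale \<sigma> ` fsupp Z"
    proof
      fix u :: "'a \<Rightarrow> 'k" assume "u \<in> fsupp Z"
      then show "u \<in> fscale \<sigma> ` fsupp Z"
        using \<sigma> by (intro image_eqI[of _ _ "fscale (1 / \<sigma>) u"]) (auto simp: fscale_def fsupp_def)
    qed
  qed
  have fs0: "fscale \<sigma> u = 0 \<longleftrightarrow> u = 0" for u :: "'a \<Rightarrow> 'k"
    using \<sigma> by (auto simp: fscale_def fun_eq_iff)
  show "hdim (shift p X) (\<lambda>_ a. dg a + d) (\<lambda>_ a b. \<sigma> * c a b) n j =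
      (if p \<le> n then hdim X (\<lambda>_. dg) (\<lambda>_. c) (n - p) (j - d) else 0)"
  proof (cases "p \<le> n")
    case False
    then have "cyc (shift p X) (\<lambda>_ a. dg a + d) (\<lambda>_ a b. \<sigma> * c a b) n j = {0}"
      by (auto simp: cyc_def shift_def fsupp_def fun_eq_iff)
    then show ?thesis using False by (simp add: hdim_def)
  next
    case True
    have deg: "dg a + d = j \<longleftrightarrow> dg a = j - d" for a by auto
    have "cyc (shift p X) (\<lambda>_ a. dg a + d) (\<lambda>_ a b. \<sigma> * c a b) n j = cyc X (\<lambda>_. dg) (\<lambda>_. c) (n - p) (j - d)"
    proof (cases "n = p")
      case eq: True
      have "app (X 0) c u = 0" for u using c0 by (rule app_mat_zero)
      then show ?thesis unfolding cyc_def shift_def deg app_mat_scale by (auto simp: eq)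
    next
      case False
      then obtain q where "n = Suc q" "p \<le> q" using True by (cases n) auto
      then show ?thesis unfolding cyc_def shift_def deg app_mat_scale app_fscale fs0
        by (auto simp: Suc_diff_le)
    qed
    moreover have "bnd (shift p X) (\<lambda>_ a. dg a + d) (\<lambda>_ a b. \<sigma> * c a b) n j = bnd X (\<lambda>_. dg) (\<lambda>_. c) (n - p) (j - d)"
    proof -
      have sh: "shift p X (Suc n) = X (Suc (n - p))" using True by (simp add: shift_def Suc_diff_le)
      have "bnd (shift p X) (\<lambda>_ a. dg a + d) (\<lambda>_ a b. \<sigma> * c a b) n j =
          app (X (Suc (n - p))) c ` (fscale \<sigma> ` fsupp {a \<in> X (Suc (n - p)). dg a = j - d})"
        unfolding bnd_def sh deg app_mat_scale image_image ..
      then show ?thesis unfolding fsc bnd_def .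
    qed
    ultimately show ?thesis using True by (simp add: hdim_def)
  qed
qed

section \<open>The Kuenneth formula\<close>

lemma (in vector_space) independent_of_card:
  assumes "finite S" "V \<subseteq> span S" "card S \<le> dim V"
  shows "independent S"
proof (rule ccontr)
  assume "\<not> independent S"
  then obtain a where a: "a \<in> S" "a \<in> span (S - {a})" unfolding dependent_def by blast
  then have "span (S - {a}) = span S" using span_redundant[OF a(2)] by (simp add: insert_absorb)
  then have "dim V \<le> card (S - {a})" using assms by (intro dim_le_card) auto
  then show False using assms a card_Diff1_less[of S a] by linarith
qed

lemma app_linear_mat:
  assumes "Vector_Spaces.linear fscale fscale L" "finite X" "u \<in> fsupp X"
  shows "app X (\<lambda>a. L (delta a)) u = L (u :: 'a \<Rightarrow> 'k::field)"
proof -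
  have "u = (\<Sum>a\<in>X. fscale (u a) (delta a))"
    using app_mat_delta[OF assms(2,3)] by (auto simp: app_def fun_eq_iff sum_fun_apply fscale_def)
  then have "L u = (\<Sum>a\<in>X. fscale (u a) (L (delta a)))"
    by (metis (mono_tags, lifting) fsp.linear_sum[OF assms(1)] fsp.linear_scale[OF assms(1)] sum.cong)
  then show ?thesis by (auto simp: app_def fun_eq_iff sum_fun_apply fscale_def)
qed

locale gcx = ucx X r c
  for X :: "nat \<Rightarrow> 'a set" and r and c :: "'a \<Rightarrow> 'a \<Rightarrow> 'k::field" +
  fixes dg :: "'a \<Rightarrow> int"
  assumes graded: "a \<in> X (Suc n) \<Longrightarrow> c a b \<noteq> 0 \<Longrightarrow> dg b = dg a"
begin

sublocale kcx X "\<lambda>_. dg" "\<lambda>_. c"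
proof
  show "b \<in> X n \<and> dg b = dg a" if "a \<in> X (Suc n)" "c a b \<noteq> 0" for a n b
    using supp[OF that(1)] graded[OF that] that(2) unfolding fsupp_def by blast
  show "app (X (Suc n)) c (c a) = 0" if "a \<in> X (Suc (Suc n))" for a n
    using dd[OF that] .
qed (rule fin)

definition V :: "nat \<Rightarrow> int \<Rightarrow> ('a \<Rightarrow> 'k) set" where
  "V n j = fsupp {a \<in> X n. dg a = j}"

definition Z :: "nat \<Rightarrow> int \<Rightarrow> ('a \<Rightarrow> 'k) set" where
  "Z n j = {v \<in> V n j. app (X n) c v = 0}"

lemma app_X0: "app (X 0) c u = 0"
  by (rule app_mat_zero) (rule supp0)

lemma cyc_eq: "cyc X (\<lambda>_. dg) (\<lambda>_. c) n j = Z n j"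
  using app_X0 by (cases n) (auto simp: cyc_def Z_def V_def)

lemma V_subspace: "fs.subspace (V n j)"
  unfolding V_def by (rule fsupp_subspace)

lemma d_V: "v \<in> V (Suc n) j \<Longrightarrow> app (X (Suc n)) c v \<in> Z n j"
  using bnd_subset_cyc[of n j] unfolding cyc_eq bnd_def V_def by blast

lemma finite_indep: "fs.independent B \<Longrightarrow> B \<subseteq> V n j \<Longrightarrow> finite B"
  using fs.finite_independent_in_span[of "delta ` {a \<in> X n. dg a = j}" B]
    fsupp_in_span[of "{a \<in> X n. dg a = j}"] fin[of n] unfolding V_def by fastforce

text \<open>
  Over a field the complex is a direct sum of its homology \<open>H\<close> and of pieces \<open>w \<mapsto> d w\<close>.  The maps
  \<open>f\<close> and \<open>g\<close> are the inclusion of \<open>H\<close> and the projection to it, and \<open>s\<close> inverts \<open>w \<mapsto> d w\<close>.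
\<close>

lemma ex_retract:
  obtains H :: "nat \<Rightarrow> (nat \<times> int \<times> ('a \<Rightarrow> 'k)) set"
    and hdeg f g s
  where "\<And>n. finite (H n)" "\<And>h n. h \<in> H n \<Longrightarrow> fst h = n"
    "\<And>n j. card {h \<in> H n. hdeg h = j} = hdim X (\<lambda>_. dg) (\<lambda>_. c) n j"
    "\<And>h n. h \<in> H n \<Longrightarrow> f h \<in> fsupp {a \<in> X n. dg a = hdeg h}"
    "\<And>h n. h \<in> H n \<Longrightarrow> app (X n) c (f h) = 0"
    "\<And>a n. a \<in> X n \<Longrightarrow> g a \<in> fsupp {h \<in> H n. hdeg h = dg a}"
    "\<And>a n. a \<in> X (Suc n) \<Longrightarrow> app (X n) g (c a) = 0"
    "\<And>h n. h \<in> H n \<Longrightarrow> app (X n) g (f h) = delta h"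
    "\<And>a n. a \<in> X n \<Longrightarrow> s a \<in> fsupp (X (Suc n))"
    "\<And>a n. a \<in> X n \<Longrightarrow>
      app (H n) f (g a) + app (X (Suc n)) c (s a) + app (X (n - 1)) s (c a) = delta a"
proof -
  let ?d = "\<lambda>n. app (X n) c"
  have lin: "Vector_Spaces.linear fscale fscale (?d n)" for n by (rule app_linear)
  have "\<exists>Z0 E. Z0 \<subseteq> Z n j \<and> fs.independent Z0 \<and> Z n j \<subseteq> fs.span Z0 \<and>
      Z0 \<subseteq> E \<and> E \<subseteq> V n j \<and> fs.independent E \<and> V n j \<subseteq> fs.span E" for n j
  proof -
    obtain Z0 where Z0: "Z0 \<subseteq> Z n j" "fs.independent Z0" "Z n j \<subseteq> fs.span Z0"
      using fs.maximal_independent_subset by metis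
    moreover have "Z0 \<subseteq> V n j" using Z0 by (auto simp: Z_def)
    ultimately show ?thesis using fs.maximal_independent_subset_extend by metis
  qed
  then obtain Z0 E where Z0: "\<And>n j. Z0 n j \<subseteq> Z n j" "\<And>n j. fs.independent (Z0 n j)"
      "\<And>n j. Z n j \<subseteq> fs.span (Z0 n j)" and
    E: "\<And>n j. Z0 n j \<subseteq> E n j" "\<And>n j. E n j \<subseteq> V n j" "\<And>n j. fs.independent (E n j)"
      "\<And>n j. V n j \<subseteq> fs.span (E n j)"
    by metis
  \<comment> \<open>A complement of the cycles, on which the differential is therefore
    injective.\<close>
  define W where "W n j = E n j - Z0 n j" for n j
  have W_V: "W n j \<subseteq> V n j" for n j using E(2) by (auto simp: W_def)
  have W0: "w = 0" if w: "w \<in> fs.span (W n j)" "?d n w = 0" for w n j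
  proof -
    have "w \<in> Z n j" using w fs.span_minimal[OF W_V V_subspace] by (auto simp: Z_def)
    then have wZ: "w \<in> fs.span (Z0 n j)" using Z0(3) by blast
    \<comment> \<open>The projection onto the span of \<open>W n j\<close> along the cycles. It
      fixes \<open>w\<close> as a combination of \<open>W n j\<close> and kills it as a combination
      of \<open>Z0 n j\<close>.\<close>
    define L where "L = fsp.construct (E n j) (\<lambda>e. if e \<in> W n j then e else (0 :: 'a \<Rightarrow> 'k))"
    have L: "Vector_Spaces.linear fscale fscale L" unfolding L_def by (rule fsp.linear_construct[OF E(3)])
    have Le: "L e = (if e \<in> W n j then e else 0)" if "e \<in> E n j" for e
      unfolding L_def by (rule fsp.construct_basis[OF E(3) that])
    have "L w = id w"
      by (rule fsp.linear_eq_on[OF L fs.linear_id w(1)]) (use Le in \<open>auto simp: W_def\<close>)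
    moreover have "L w = (\<lambda>_. 0) w"
      by (rule fsp.linear_eq_on[OF L fsp.linear_zero wZ]) (use Le E(1)[of n j] in \<open>auto simp: W_def subset_iff\<close>)
    ultimately show "w = 0" by simp
  qed
  have W_indep: "fs.independent (W n j)" for n j
    unfolding W_def by (rule fs.independent_mono[OF E(3)]) blast
  define dW where "dW n j = ?d (Suc n) ` W (Suc n) j" for n j
  have d_inj: "inj_on (?d n) (fs.span (W n j))" for n j
  proof (rule inj_onI)
    fix x y assume "x \<in> fs.span (W n j)" "y \<in> fs.span (W n j)" "?d n x = ?d n y"
    then show "x = y" using W0[of "x - y" n j] by (simp add: app_diff fs.span_diff)
  qed
  have dW_indep: "fs.independent (dW n j)" for n j
    unfolding dW_def by (rule fsp.linear_independent_injective_image[OF lin W_indep d_inj])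
  have dW_Z: "dW n j \<subseteq> Z n j" for n j unfolding dW_def using d_V W_V by blast
  have "\<exists>T. dW n j \<subseteq> T \<and> T \<subseteq> Z n j \<and> fs.independent T \<and> Z n j \<subseteq> fs.span T" for n j
    using fs.maximal_independent_subset_extend[OF dW_Z dW_indep] by metis
  then obtain T where T: "\<And>n j. dW n j \<subseteq> T n j" "\<And>n j. T n j \<subseteq> Z n j"
    "\<And>n j. fs.independent (T n j)" "\<And>n j. Z n j \<subseteq> fs.span (T n j)" by metis
  \<comment> \<open>\<open>T\<close> extends the basis \<open>dW\<close> of the boundaries to a
    basis of the cycles, so the new vectors represent a basis of the homology.\<close>
  define Hh where "Hh n j = T n j - dW n j" for n j
  define Bs where "Bs n j = T n j \<union> W n j" for n j
  have T_V: "T n j \<subseteq> V n j" for n j using T(2) by (auto simp: Z_def)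
  have finT: "finite (T n j)" and finE: "finite (E n j)" for n j
    using finite_indep T_V T(3) E(2,3) by blast+
  have V_Bs: "V n j \<subseteq> fs.span (Bs n j)" for n j
  proof -
    have "Z0 n j \<subseteq> fs.span (Bs n j)"
      using Z0(1)[of n j] T(4)[of n j] fs.span_mono[of "T n j" "Bs n j"] by (auto simp: Bs_def)
    moreover have "W n j \<subseteq> fs.span (Bs n j)" using fs.span_superset by (force simp: Bs_def)
    ultimately have "E n j \<subseteq> fs.span (Bs n j)" by (auto simp: W_def)
    then show ?thesis using E(4)[of n j] fs.span_minimal[OF _ fs.subspace_span] by blast
  qed
  \<comment> \<open>By counting: \<open>T\<close> and \<open>Z0\<close> are both bases of the
    cycles, so the spanning set \<open>Bs\<close> has at most as many elements as the basis
    \<open>E\<close>.\<close>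
  have Bs_indep: "fs.independent (Bs n j)" for n j
  proof (rule fs.independent_of_card[OF _ V_Bs])
    show "finite (Bs n j)" using finT finE by (simp add: Bs_def W_def)
    have "card (T n j) = card (Z0 n j)"
      using fs.basis_card_eq_dim[OF T(2) T(4) T(3)] fs.basis_card_eq_dim[OF Z0(1) Z0(3) Z0(2)] by metis
    moreover have "card (W n j) + card (Z0 n j) = card (E n j)"
      using E(1)[of n j] finE[of n j] unfolding W_def
      by (metis card_Diff_subset card_mono finite_subset le_add_diff_inverse2)
    moreover have "card (Bs n j) \<le> card (T n j) + card (W n j)" unfolding Bs_def by (rule card_Un_le)
    moreover have "card (E n j) = fs.dim (V n j)" using fs.basis_card_eq_dim[OF E(2) E(4) E(3)] .
    ultimately show "card (Bs n j) \<le> fs.dim (V n j)" by linarith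
  qed
  have W_nz: "?d n w \<noteq> 0" if "w \<in> W n j" for w n j
  proof
    assume "?d n w = 0"
    then have "w = 0" using W0 that fs.span_base by blast
    then show False using W_indep[of n j] that fs.dependent_zero by blast
  qed
  have W_T: "w \<notin> T n j" if "w \<in> W n j" for w n j
    using W_nz[OF that] T(2)[of n j] by (auto simp: Z_def)
  have W_0: "W 0 j = {}" for j using W_nz[of _ 0 j] app_X0 by blast
  define inv where "inv n j = inv_into (W (Suc n) j) (?d (Suc n))" for n j
  have inv: "inv n j (?d (Suc n) w) = w" if "w \<in> W (Suc n) j" for n j w
  proof -
    have "inj_on (?d (Suc n)) (W (Suc n) j)"
      using d_inj inj_on_subset fs.span_superset by blast
    then show ?thesis unfolding inv_def using that by (rule inv_into_f_f)
  qed
  \<comment> \<open>In the basis \<open>Bs\<close>, the map \<open>G\<close> keeps the homology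
    representatives and kills the rest, while \<open>S\<close> sends each boundary
    \<open>d w\<close> back to \<open>w\<close> and kills the rest.\<close>
  define G :: "nat \<Rightarrow> int \<Rightarrow> ('a \<Rightarrow> 'k) \<Rightarrow> (nat \<times> int \<times> ('a \<Rightarrow> 'k)) \<Rightarrow> 'k"
    where "G n j = fsp.construct (Bs n j) (\<lambda>e. if e \<in> Hh n j then delta (n, j, e) else 0)" for n j
  define S where "S n j = fsp.construct (Bs n j) (\<lambda>e. if e \<in> dW n j then inv n j e else 0)" for n j
  have G: "Vector_Spaces.linear fscale fscale (G n j)" and S: "Vector_Spaces.linear fscale fscale (S n j)" for n j
    unfolding G_def S_def by (rule fsp.linear_construct[OF Bs_indep])+
  have Ge: "G n j e = (if e \<in> Hh n j then delta (n, j, e) else 0)"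
    and Se: "S n j e = (if e \<in> dW n j then inv n j e else 0)" if "e \<in> Bs n j" for n j e
    unfolding G_def S_def by (rule fsp.construct_basis[OF Bs_indep that])+
  \<comment> \<open>The tags keep classes of different degrees apart. Restricting to internal
    degrees that occur makes \<open>H n\<close> finite and loses nothing, by
    \<open>Hh_empty\<close>.\<close>
  define H where "H n = (\<lambda>(j, h). (n, j, h)) ` Sigma (dg ` X n) (Hh n)" for n
  have Hh_empty: "Hh n j = {}" if "j \<notin> dg ` X n" for n j
  proof -
    have "{a \<in> X n. dg a = j} = {}" using that by blast
    then have "T n j \<subseteq> {0}" using T_V[of n j] by (auto simp: V_def fsupp_def fun_eq_iff)
    moreover have "0 \<notin> T n j" using T(3) fs.dependent_zero by blast
    ultimately show ?thesis by (auto simp: Hh_def)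
  qed
  have H_iff: "(m, j, h) \<in> H n \<longleftrightarrow> m = n \<and> h \<in> Hh n j" for m n j h
  proof -
    have "h \<in> Hh n j \<Longrightarrow> j \<in> dg ` X n" using Hh_empty by blast
    then show ?thesis unfolding H_def by (auto simp: image_iff)
  qed
  have H_deg: "{h \<in> H n. fst (snd h) = j} = (\<lambda>h. (n, j, h)) ` Hh n j" for n j
    using H_iff by auto
  have finH: "finite (H n)" for n
    unfolding H_def Hh_def using fin finT by (intro finite_imageI finite_SigmaI) auto
  have G_in: "G n j v \<in> fsupp {h \<in> H n. fst (snd h) = j}" if "v \<in> V n j" for n j v
  proof -
    have "G n j ` Bs n j \<subseteq> fsupp {h \<in> H n. fst (snd h) = j}"
    proof
      fix x assume "x \<in> G n j ` Bs n j"
      then show "x \<in> fsupp {h \<in> H n. fst (snd h) = j}"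
        using Ge[of _ n j] H_iff by (auto simp: fsupp_def delta_def split: if_splits)
    qed
    then have "fs.span (G n j ` Bs n j) \<subseteq> fsupp {h \<in> H n. fst (snd h) = j}"
      by (intro fs.span_minimal fsupp_subspace)
    then show ?thesis using fsp.linear_span_image[OF G, of n j "Bs n j"] V_Bs[of n j] that by blast
  qed
  have inv_in: "inv n j e \<in> W (Suc n) j" if "e \<in> dW n j" for n j e
    using that inv by (auto simp: dW_def)
  have S_in: "S n j v \<in> V (Suc n) j" if "v \<in> V n j" for n j v
  proof -
    have "S n j ` Bs n j \<subseteq> V (Suc n) j"
      using Se[of _ n j] inv_in[of _ n j] W_V[of "Suc n" j] fs.subspace_0[OF V_subspace] by fastforce
    then have "fs.span (S n j ` Bs n j) \<subseteq> V (Suc n) j"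
      by (intro fs.span_minimal V_subspace)
    then show ?thesis using fsp.linear_span_image[OF S, of n j "Bs n j"] V_Bs[of n j] that by blast
  qed
  define f where "f h = snd (snd h)" for h :: "nat \<times> int \<times> ('a \<Rightarrow> 'k)"
  define g where "g a = G (r a) (dg a) (delta a)" for a
  define s where "s a = S (r a) (dg a) (delta a)" for a
  have delta_V: "delta a \<in> V n (dg a)" if "a \<in> X n" for a n
    unfolding V_def by (rule fsupp_delta) (use that in simp)
  have mat: "app (X n) (\<lambda>a. L (r a) (dg a) (delta a)) v = L n j v"
    if "v \<in> V n j" "\<And>n j. Vector_Spaces.linear fscale fscale (L n j)"
    for L :: "nat \<Rightarrow> int \<Rightarrow> ('a \<Rightarrow> 'k) \<Rightarrow> 'h \<Rightarrow> 'k" and n j v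
  proof -
    have "app (X n) (\<lambda>a. L (r a) (dg a) (delta a)) v = app {a \<in> X n. dg a = j} (\<lambda>a. L (r a) (dg a) (delta a)) v"
      using that(1) fin by (intro app_restrict) (auto simp: V_def)
    also have "\<dots> = app {a \<in> X n. dg a = j} (\<lambda>a. L n j (delta a)) v"
      using rank by (intro app_cong) auto
    also have "\<dots> = L n j v" by (rule app_linear_mat[OF that(2)]) (use that(1) fin in \<open>auto simp: V_def\<close>)
    finally show ?thesis .
  qed
  have g_mat: "app (X n) g v = G n j v" if "v \<in> V n j" for n j v
    unfolding g_def by (rule mat[OF that G])
  have s_mat: "app (X n) s v = S n j v" if "v \<in> V n j" for n j v
    unfolding s_def by (rule mat[OF that S])
  have dT: "?d n e = 0" if "e \<in> T n j" for n j e using T(2)[of n j] that by (auto simp: Z_def)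
  show ?thesis
  proof (rule that)
    show "finite (H n)" for n by (rule finH)
    show "fst h = n" if "h \<in> H n" for h n using that by (auto simp: H_def)
    show "card {h \<in> H n. fst (snd h) = j} = hdim X (\<lambda>_. dg) (\<lambda>_. c) n j" for n j
    proof -
      have "card {h \<in> H n. fst (snd h) = j} = card (Hh n j)"
        unfolding H_deg by (rule card_image) (auto simp: inj_on_def)
      also have "\<dots> = card (T n j) - card (dW n j)"
        unfolding Hh_def by (rule card_Diff_subset[OF finite_subset[OF T(1) finT] T(1)])
      also have "card (T n j) = fs.dim (cyc X (\<lambda>_. dg) (\<lambda>_. c) n j)"
        unfolding cyc_eq by (rule fs.basis_card_eq_dim[OF T(2) T(4) T(3)])
      also have "card (dW n j) = fs.dim (bnd X (\<lambda>_. dg) (\<lambda>_. c) n j)"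
      proof (rule fs.basis_card_eq_dim[OF _ _ dW_indep])
        show "dW n j \<subseteq> bnd X (\<lambda>_. dg) (\<lambda>_. c) n j"
          unfolding dW_def bnd_def using W_V[of "Suc n" j] by (auto simp: V_def)
        have "bnd X (\<lambda>_. dg) (\<lambda>_. c) n j \<subseteq> ?d (Suc n) ` fs.span (Bs (Suc n) j)"
          unfolding bnd_def using V_Bs[of "Suc n" j] by (auto simp: V_def)
        also have "\<dots> = fs.span (?d (Suc n) ` Bs (Suc n) j)"
          by (rule fsp.linear_span_image[OF lin, symmetric])
        also have "\<dots> \<subseteq> fs.span (insert 0 (dW n j))"
          using dT by (intro fs.span_mono) (auto simp: Bs_def dW_def)
        finally show "bnd X (\<lambda>_. dg) (\<lambda>_. c) n j \<subseteq> fs.span (dW n j)" by simp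
      qed
      finally show ?thesis by (simp add: hdim_def)
    qed
    show "f h \<in> fsupp {a \<in> X n. dg a = fst (snd h)}" if hH: "h \<in> H n" for h n
    proof -
      obtain j e where h: "h = (n, j, e)" "e \<in> Hh n j" using hH by (auto simp: H_def)
      then have "e \<in> V n j" using T_V[of n j] by (auto simp: Hh_def)
      then show ?thesis by (simp add: h f_def V_def)
    qed
    show "app (X n) c (f h) = 0" if "h \<in> H n" for h n
      using that dT unfolding H_def Hh_def f_def by auto
    show "g a \<in> fsupp {h \<in> H n. fst (snd h) = dg a}" if "a \<in> X n" for a n
      unfolding g_def rank[OF that] by (rule G_in[OF delta_V[OF that]])
    show "app (X n) g (c a) = 0" if a: "a \<in> X (Suc n)" for a n
    proof -
      have ca: "c a = ?d (Suc n) (delta a)" using a by (simp add: app_delta fin)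
      then have "c a \<in> V n (dg a)" using d_V[OF delta_V[OF a]] by (simp add: Z_def)
      then have "app (X n) g (c a) = (G n (dg a) \<circ> ?d (Suc n)) (delta a)" using ca by (simp add: g_mat)
      also have "\<dots> = (\<lambda>_. 0) (delta a)"
      proof (rule fsp.linear_eq_on[OF Vector_Spaces.linear_compose[OF lin G] fsp.linear_zero])
        show "delta a \<in> fs.span (Bs (Suc n) (dg a))" using V_Bs delta_V[OF a] by blast
        fix e assume "e \<in> Bs (Suc n) (dg a)"
        then consider "e \<in> T (Suc n) (dg a)" | "e \<in> W (Suc n) (dg a)" by (auto simp: Bs_def)
        then show "(G n (dg a) \<circ> ?d (Suc n)) e = (\<lambda>_. 0) e"
        proof cases
          case 1 then show ?thesis using dT fsp.linear_0[OF G] by simp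
        next
          case 2
          then have "?d (Suc n) e \<in> dW n (dg a)" by (simp add: dW_def)
          then show ?thesis using Ge[of "?d (Suc n) e" n "dg a"] T(1)[of n "dg a"] by (auto simp: Bs_def Hh_def)
        qed
      qed
      finally show ?thesis by simp
    qed
    show "app (X n) g (f h) = delta h" if "h \<in> H n" for h n
    proof -
      obtain j e where h: "h = (n, j, e)" "e \<in> Hh n j" using \<open>h \<in> H n\<close> by (auto simp: H_def)
      have "e \<in> V n j" "e \<in> Bs n j" using h(2) T_V[of n j] by (auto simp: Hh_def Bs_def)
      then show ?thesis using g_mat[of e n j] Ge[of e n j] h by (simp add: f_def)
    qed
    show "s a \<in> fsupp (X (Suc n))" if "a \<in> X n" for a n
      using S_in[OF delta_V[OF that]] unfolding s_def rank[OF that] by (auto simp: V_def fsupp_def)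
    show "app (H n) f (g a) + app (X (Suc n)) c (s a) + app (X (n - 1)) s (c a) = delta a" if a: "a \<in> X n" for a n
    proof -
      let ?j = "dg a"
      have ca: "c a = ?d n (delta a)" using a by (simp add: app_delta fin)
      \<comment> \<open>For \<open>n = 0\<close> the truncated index \<open>n - 1\<close> is
        harmless, since the differential vanishes on degree 0.\<close>
      have "app (X (n - 1)) s (c a) = S (n - 1) ?j (?d n (delta a))"
      proof (cases n)
        case 0 then show ?thesis using ca app_X0 fsp.linear_0[OF S] by simp
      next
        case (Suc m)
        then have "c a \<in> V m ?j" using d_V[of "delta a" m ?j] delta_V[OF a] ca by (simp add: Z_def)
        then show ?thesis using Suc ca by (simp add: s_mat)
      qed
      moreover have "g a = G n ?j (delta a)" "s a = S n ?j (delta a)"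
        by (simp_all add: g_def s_def rank[OF a])
      moreover have "app (H n) f (G n ?j v) + ?d (Suc n) (S n ?j v) + S (n - 1) ?j (?d n v) = id v"
        if "v \<in> fs.span (Bs n ?j)" for v
      proof (rule fsp.linear_eq_on[OF _ fs.linear_id that])
        show "Vector_Spaces.linear fscale fscale
            (\<lambda>v. app (H n) f (G n ?j v) + ?d (Suc n) (S n ?j v) + S (n - 1) ?j (?d n v))"
          using Vector_Spaces.linear_compose[OF G[of n ?j] app_linear[of "H n" f]] Vector_Spaces.linear_compose[OF S[of n ?j] lin[of "Suc n"]]
            Vector_Spaces.linear_compose[OF lin[of n] S[of "n - 1" ?j]]
          by (intro fsp.linear_compose_add) (simp_all add: comp_def)
        fix e assume e: "e \<in> Bs n ?j"
        \<comment> \<open>On a boundary the middle term is the identity, on a homology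
          representative the first, and on \<open>W\<close> the last; the other two terms vanish
          each time.\<close>
        then consider "e \<in> dW n ?j" | "e \<in> Hh n ?j" | "e \<in> W n ?j" by (auto simp: Bs_def Hh_def)
        then show "app (H n) f (G n ?j e) + ?d (Suc n) (S n ?j e) + S (n - 1) ?j (?d n e) = id e"
        proof cases
          case 1
          then obtain w where w: "w \<in> W (Suc n) ?j" "e = ?d (Suc n) w" by (auto simp: dW_def)
          have "?d n e = 0" using 1 T(1) dT by blast
          moreover have "S n ?j e = w" using 1 e Se inv[OF w(1)] w(2) by simp
          moreover have "G n ?j e = 0" using 1 e Ge by (simp add: Hh_def)
          ultimately show ?thesis using w fsp.linear_0[OF S] by simp
        next
          case 2
          then have "?d n e = 0" using dT by (auto simp: Hh_def)
          moreover have "S n ?j e = 0" using 2 e Se by (simp add: Hh_def)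
          moreover have "app (H n) f (G n ?j e) = e"
            using 2 e Ge[OF e] H_iff finH by (simp add: app_delta f_def)
          ultimately show ?thesis using fsp.linear_0[OF S] by simp
        next
          case 3
          then have nT: "e \<notin> T n ?j" by (rule W_T)
          then have "G n ?j e = 0" "S n ?j e = 0" using Ge[OF e] Se[OF e] T(1)[of n ?j] by (auto simp: Hh_def)
          moreover obtain m where m: "n = Suc m" using 3 W_0 by (cases n) auto
          then have "?d n e \<in> dW m ?j" using 3 by (simp add: dW_def)
          then have "S m ?j (?d n e) = e"
            using Se[of "?d n e" m ?j] T(1)[of m ?j] inv[of e m ?j] 3 m by (auto simp: Bs_def)
          ultimately show ?thesis using m by simp
        qed
      qed
      then have "app (H n) f (G n ?j (delta a)) + ?d (Suc n) (S n ?j (delta a)) + S (n - 1) ?j (?d n (delta a)) = delta a"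
        using V_Bs delta_V[OF a] by auto
      ultimately show ?thesis by simp
    qed
  qed
qed

end

lemma TX_E:
  assumes "x \<in> TX X Y n"
  obtains a b p q where "x = (a, b)" "p + q = n" "a \<in> X p" "b \<in> Y q"
  using assms by (cases x) (auto simp: TX_iff)

text \<open>
  The homology of the first factor may replace it, and then the tensor product is a direct sum of
  shifted copies of the second factor.
\<close>

theorem kuenneth:
  fixes X :: "nat \<Rightarrow> 'a set" and c :: "'a \<Rightarrow> 'a \<Rightarrow> 'k::field"
    and Y :: "nat \<Rightarrow> 'b set" and c' :: "'b \<Rightarrow> 'b \<Rightarrow> 'k"
  assumes "gcx X r c dg" "gcx Y r' c' dg'"
    and L: "finite L" "\<And>p a. p \<le> n \<Longrightarrow> a \<in> X p \<Longrightarrow> dg a \<in> L"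
  shows "hdim (TX X Y) (\<lambda>_ (a, b). dg a + dg' b) (\<lambda>_. tc r c c') n j =
    (\<Sum>p\<le>n. \<Sum>l\<in>L. hdim X (\<lambda>_. dg) (\<lambda>_. c) p l * hdim Y (\<lambda>_. dg') (\<lambda>_. c') (n - p) (j - l))"
proof -
  interpret X: gcx X r c dg by fact
  interpret Y: gcx Y r' c' dg' by fact
  obtain H :: "nat \<Rightarrow> (nat \<times> int \<times> ('a \<Rightarrow> 'k)) set" and hdeg f g s
    where finH: "\<And>n. finite (H n)" and rH: "\<And>h n. h \<in> H n \<Longrightarrow> fst h = n"
    and cardH: "\<And>n j. card {h \<in> H n. hdeg h = j} = hdim X (\<lambda>_. dg) (\<lambda>_. c) n j"
    and fH: "\<And>h n. h \<in> H n \<Longrightarrow> f h \<in> fsupp {a \<in> X n. dg a = hdeg h}"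
    and fd: "\<And>h n. h \<in> H n \<Longrightarrow> app (X n) c (f h) = 0"
    and gX: "\<And>a n. a \<in> X n \<Longrightarrow> g a \<in> fsupp {h \<in> H n. hdeg h = dg a}"
    and gd: "\<And>a n. a \<in> X (Suc n) \<Longrightarrow> app (X n) g (c a) = 0"
    and gf: "\<And>h n. h \<in> H n \<Longrightarrow> app (X n) g (f h) = delta h"
    and sX: "\<And>a n. a \<in> X n \<Longrightarrow> s a \<in> fsupp (X (Suc n))"
    and htpy: "\<And>a n. a \<in> X n \<Longrightarrow>
      app (H n) f (g a) + app (X (Suc n)) c (s a) + app (X (n - 1)) s (c a) = delta a"
    by (rule X.ex_retract) (rule that; assumption)
  have HX: "f h \<in> fsupp (X n)" if "h \<in> H n" for h n using fH[OF that] by (auto simp: fsupp_def)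
  have gH: "g a \<in> fsupp (H n)" if "a \<in> X n" for a n using gX[OF that] by (auto simp: fsupp_def)
  \<comment> \<open>The homology \<open>H\<close> becomes a complex with zero differential, homotopy
    equivalent to \<open>X\<close> through \<open>f\<close>, \<open>g\<close> and
    \<open>s\<close>.\<close>
  let ?z = "\<lambda>_. 0 :: nat \<times> int \<times> ('a \<Rightarrow> 'k) \<Rightarrow> 'k"
  have H0: "app Z ?z u = 0" for Z u by (rule app_mat_zero) simp
  interpret H: gcx H fst ?z hdeg
    by unfold_locales (auto simp: finH rH H0 fsupp_def)
  define P where "P = TX X Y"
  define Q where "Q = TX H Y"
  define cP where "cP = tc r c c'"
  define cQ where "cQ = tc fst ?z c'"
  interpret P: ucx P "\<lambda>(a, b). r a + r' b" cP
    unfolding P_def cP_def by (intro tensor_ucx X.ucx_axioms Y.ucx_axioms)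
  interpret Q: ucx Q "\<lambda>(a, b). fst a + r' b" cQ
    unfolding Q_def cQ_def by (intro tensor_ucx H.ucx_axioms Y.ucx_axioms)
  have dP: "app (P m) cP (tp u v) = tp (app (X p) c u) v + sgn_pow p (tp u (app (Y q) c' v))"
    if "u \<in> fsupp (X p)" "v \<in> fsupp (Y q)" "p + q = m" for u v p q m
    unfolding P_def cP_def by (rule app_tc[where X = X and Y = Y, OF X.fin Y.fin X.rank that])
  have dQ: "app (Q m) cQ (tp u v) = sgn_pow p (tp u (app (Y q) c' v))"
    if "u \<in> fsupp (H p)" "v \<in> fsupp (Y q)" "p + q = m" for u v p q m
    using app_tc[where X = H and Y = Y and r = fst and c = ?z and c' = c', OF H.fin Y.fin H.rank that]
    by (simp add: Q_def cQ_def H0)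
  define F where "F = (\<lambda>(h, b :: 'b). tp (f h) (delta b))"
  define G where "G = (\<lambda>(a, b :: 'b). tp (g a) (delta b))"
  define S where "S = (\<lambda>(a, b :: 'b). tp (s a) (delta b))"
  have F_tp: "app (Q m) F (tp u v) = tp (app (H p) f u) v"
    if "u \<in> fsupp (H p)" "v \<in> fsupp (Y q)" "p + q = m" for u v p q m
    unfolding Q_def F_def app_tp[where X = H and Y = Y, OF H.fin Y.fin that] prod.case
    by (rule app_tp_left) (use that H.fin Y.fin in auto)
  have G_tp: "app (P m) G (tp u v) = tp (app (X p) g u) v"
    if "u \<in> fsupp (X p)" "v \<in> fsupp (Y q)" "p + q = m" for u v p q m
    unfolding P_def G_def app_tp[where X = X and Y = Y, OF X.fin Y.fin that] prod.case
    by (rule app_tp_left) (use that X.fin Y.fin in auto)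
  have S_tp: "app (P m) S (tp u v) = tp (app (X p) s u) v"
    if "u \<in> fsupp (X p)" "v \<in> fsupp (Y q)" "p + q = m" for u v p q m
    unfolding P_def S_def app_tp[where X = X and Y = Y, OF X.fin Y.fin that] prod.case
    by (rule app_tp_left) (use that X.fin Y.fin in auto)
  have dY: "c' b \<in> fsupp (Y (q - 1)) \<and> (q = 0 \<longrightarrow> c' b = 0)" if "b \<in> Y q" for b q
    using that Y.supp Y.supp0 by (cases q) (auto simp: fsupp_def)
  have dX: "c a \<in> fsupp (X (p - 1)) \<and> (p = 0 \<longrightarrow> c a = 0)" if "a \<in> X p" for a p
    using that X.supp X.supp0 by (cases p) (auto simp: fsupp_def)
  have row_P: "cP (a, b) = tp (c a) (delta b) + sgn_pow p (tp (delta a) (c' b))" if "a \<in> X p" for a b p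
    using X.rank[OF that] by (simp add: cP_def tc_def)
  have row_Q: "cQ (h, b) = sgn_pow p (tp (delta h) (c' b))" if "h \<in> H p" for h b p
    using rH[OF that] by (simp add: cQ_def tc_def)
  have chG: "app (Q (Suc m)) cQ (G x) = app (P m) G (cP x)" if x: "x \<in> P (Suc m)" for x m
  proof -
    obtain a b p q where ab: "x = (a, b)" "p + q = Suc m" "a \<in> X p" "b \<in> Y q"
      using x unfolding P_def by (rule TX_E)
    have "app (Q (Suc m)) cQ (G x) = sgn_pow p (tp (g a) (c' b))"
      using dQ[OF gH[OF ab(3)] fsupp_delta[OF ab(4)] ab(2)] ab by (simp add: G_def app_delta Y.fin)
    moreover have "app (P m) G (tp (c a) (delta b)) = 0"
    proof (cases p)
      case (Suc p')
      then show ?thesis using G_tp[of "c a" p' "delta b" q m] X.supp[of a p'] fsupp_delta[OF ab(4)] gd[of a p'] ab by simp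
    qed (use dX[OF ab(3)] in simp)
    moreover have "app (P m) G (tp (delta a) (c' b)) = tp (g a) (c' b)"
    proof (cases q)
      case (Suc q')
      then show ?thesis using G_tp[of "delta a" p "c' b" q' m] Y.supp[of b q'] fsupp_delta[OF ab(3)] ab
        by (simp add: app_delta X.fin)
    qed (use dY[OF ab(4)] in simp)
    ultimately show ?thesis by (simp add: ab(1) row_P[OF ab(3)] app_add app_sgn_pow)
  qed
  have chF: "app (P (Suc m)) cP (F x) = app (Q m) F (cQ x)" if x: "x \<in> Q (Suc m)" for x m
  proof -
    obtain h b p q where hb: "x = (h, b)" "p + q = Suc m" "h \<in> H p" "b \<in> Y q"
      using x unfolding Q_def by (rule TX_E)
    have "app (P (Suc m)) cP (F x) = sgn_pow p (tp (f h) (c' b))"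
      using dP[OF HX[OF hb(3)] fsupp_delta[OF hb(4)] hb(2)] hb fd[OF hb(3)] by (simp add: F_def app_delta Y.fin)
    moreover have "app (Q m) F (tp (delta h) (c' b)) = tp (f h) (c' b)"
    proof (cases q)
      case (Suc q')
      then show ?thesis using F_tp[of "delta h" p "c' b" q' m] Y.supp[of b q'] fsupp_delta[OF hb(3)] hb
        by (simp add: app_delta finH)
    qed (use dY[OF hb(4)] in simp)
    ultimately show ?thesis by (simp add: hb(1) row_Q[OF hb(3)] app_sgn_pow)
  qed
  have GF: "app (P m) G (F x) = delta x" if x: "x \<in> Q m" for x m
  proof -
    obtain h b p q where hb: "x = (h, b)" "p + q = m" "h \<in> H p" "b \<in> Y q"
      using x unfolding Q_def by (rule TX_E)
    then show ?thesis using G_tp[OF HX[OF hb(3)] fsupp_delta[OF hb(4)] hb(2)] gf[OF hb(3)]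
      by (simp add: F_def delta_pair)
  qed
  \<comment> \<open>The homotopy is \<open>s\<close> on the first component. It raises the rank by
    one, so the two terms \<open>tp (s a) (c' b)\<close> come with opposite signs and
    cancel.\<close>
  have FG: "app (Q m) F (G x) + app (P (Suc m)) cP (S x) + app (P (m - 1)) S (cP x) = delta x"
    if x: "x \<in> P m" for x m
  proof -
    obtain a b p q where ab: "x = (a, b)" "p + q = m" "a \<in> X p" "b \<in> Y q"
      using x unfolding P_def by (rule TX_E)
    have 1: "app (Q m) F (G x) = tp (app (H p) f (g a)) (delta b)"
      using F_tp[OF gH[OF ab(3)] fsupp_delta[OF ab(4)] ab(2)] by (simp add: G_def ab(1))
    have 2: "app (P (Suc m)) cP (S x) = tp (app (X (Suc p)) c (s a)) (delta b) - sgn_pow p (tp (s a) (c' b))"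
      using dP[OF sX[OF ab(3)] fsupp_delta[OF ab(4)], of "Suc m"] ab
      by (simp add: S_def app_delta Y.fin sgn_pow_Suc)
    have "app (P (m - 1)) S (tp (c a) (delta b)) = tp (app (X (p - 1)) s (c a)) (delta b)"
    proof (cases p)
      case (Suc p')
      then show ?thesis using S_tp[of "c a" p' "delta b" q "m - 1"] X.supp[of a p'] fsupp_delta[OF ab(4)] ab by auto
    qed (use dX[OF ab(3)] in simp)
    moreover have "app (P (m - 1)) S (tp (delta a) (c' b)) = tp (s a) (c' b)"
    proof (cases q)
      case (Suc q')
      then show ?thesis using S_tp[of "delta a" p "c' b" q' "m - 1"] Y.supp[of b q'] fsupp_delta[OF ab(3)] ab
        by (auto simp: app_delta X.fin)
    qed (use dY[OF ab(4)] in simp)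
    ultimately have 3: "app (P (m - 1)) S (cP x) =
        tp (app (X (p - 1)) s (c a)) (delta b) + sgn_pow p (tp (s a) (c' b))"
      by (simp add: ab(1) row_P[OF ab(3)] app_add app_sgn_pow)
    have tp_add: "tp u v + tp u' v = tp (u + u') v" for u u' :: "'a \<Rightarrow> 'k" and v :: "'b \<Rightarrow> 'k"
      by (auto simp: tp_def algebra_simps)
    have "tp (app (H p) f (g a)) (delta b) + tp (app (X (Suc p)) c (s a)) (delta b) +
        tp (app (X (p - 1)) s (c a)) (delta b) = delta x"
      unfolding tp_add htpy[OF ab(3)] ab(1) delta_pair ..
    then show ?thesis unfolding 1 2 3 by (simp add: algebra_simps)
  qed
  let ?dP = "\<lambda>(_ :: nat) (a, b). dg a + dg' b" and ?dQ = "\<lambda>(_ :: nat) (h, b). hdeg h + dg' b"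
  have c_deg: "dg b = dg a" if "a \<in> X p" "c a b \<noteq> 0" for a b p
    using X.graded[of a "p - 1" b] X.supp0[of a] that by (cases p) auto
  have c'_deg: "dg' b = dg' a" if "a \<in> Y p" "c' a b \<noteq> 0" for a b p
    using Y.graded[of a "p - 1" b] Y.supp0[of a] that by (cases p) auto
  have kP: "kcx P ?dP (\<lambda>_. cP)"
  proof
    fix x m y assume x: "x \<in> P (Suc m)" "cP x y \<noteq> 0"
    obtain a b p q where ab: "x = (a, b)" "p + q = Suc m" "a \<in> X p" "b \<in> Y q"
      using x(1) unfolding P_def by (rule TX_E)
    obtain a' b' where y: "y = (a', b')" by fastforce
    have "(c a a' \<noteq> 0 \<and> b' = b) \<or> (a' = a \<and> c' b b' \<noteq> 0)"
      using x(2) by (auto simp: ab(1) y row_P[OF ab(3)] tp_def delta_def sgn_pow_def split: if_splits)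
    then have "?dP m y = ?dP (Suc m) x" using c_deg[OF ab(3)] c'_deg[OF ab(4)] by (auto simp: ab(1) y)
    moreover have "y \<in> P m" using P.supp[OF x(1)] x(2) unfolding fsupp_def by blast
    ultimately show "y \<in> P m \<and> ?dP m y = ?dP (Suc m) x" by blast
  qed (use P.fin P.dd in auto)
  have kQ: "kcx Q ?dQ (\<lambda>_. cQ)"
  proof
    fix x m y assume x: "x \<in> Q (Suc m)" "cQ x y \<noteq> 0"
    obtain a b p q where ab: "x = (a, b)" "p + q = Suc m" "a \<in> H p" "b \<in> Y q"
      using x(1) unfolding Q_def by (rule TX_E)
    obtain a' b' where y: "y = (a', b')" by fastforce
    have "a' = a \<and> c' b b' \<noteq> 0"
      using x(2) by (auto simp: ab(1) y row_Q[OF ab(3)] tp_def delta_def sgn_pow_def split: if_splits)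
    then have "?dQ m y = ?dQ (Suc m) x" using c'_deg[OF ab(4)] by (auto simp: ab(1) y)
    moreover have "y \<in> Q m" using Q.supp[OF x(1)] x(2) unfolding fsupp_def by blast
    ultimately show "y \<in> Q m \<and> ?dQ m y = ?dQ (Suc m) x" by blast
  qed (use Q.fin Q.dd in auto)
  have chG': "app (Q (Suc m)) cQ (app (P (Suc m)) G z) = app (P m) G (app (P (Suc m)) cP z)" for m z
    unfolding app_app by (rule app_cong[OF refl refl]) (rule chG)
  have chF': "app (P (Suc m)) cP (app (Q (Suc m)) F z) = app (Q m) F (app (Q (Suc m)) cQ z)" for m z
    unfolding app_app by (rule app_cong[OF refl refl]) (rule chF)
  have P0: "app (P 0) cP z = 0" for z by (rule app_mat_zero) (rule P.supp0)
  have Q0: "app (Q 0) cQ z = 0" for z by (rule app_mat_zero) (rule Q.supp0)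
  have cycP: "app (P m) cP z = 0" if "z \<in> cyc P ?dP (\<lambda>_. cP) m j" for z m
    using that P0 by (cases m) (auto simp: cyc_def)
  have degF: "app (Q m) F z \<in> fsupp {x \<in> P m. ?dP m x = j}" if z: "z \<in> fsupp {x \<in> Q m. ?dQ m x = j}" for z m
  proof -
    have "app (Q m) F z = app {x \<in> Q m. ?dQ m x = j} F z" by (rule app_restrict) (use z Q.fin in auto)
    also have "\<dots> \<in> fsupp {x \<in> P m. ?dP m x = j}"
    proof (rule app_fsupp)
      fix x assume x: "x \<in> {x \<in> Q m. ?dQ m x = j}"
      then obtain h b p q where hb: "x = (h, b)" "p + q = m" "h \<in> H p" "b \<in> Y q"
        unfolding Q_def by (auto elim: TX_E)
      have "(a, b') \<in> P m \<and> dg a + dg' b' = j" if "F x (a, b') \<noteq> 0" for a b'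
      proof -
        have a: "f h a \<noteq> 0" "b' = b"
          using that by (auto simp: hb(1) F_def tp_def delta_def split: if_splits)
        then have "a \<in> X p \<and> dg a = hdeg h" using fH[OF hb(3)] unfolding fsupp_def by blast
        then show ?thesis using a hb(2,4) x by (auto simp: hb(1) P_def TX_iff)
      qed
      then show "F x \<in> fsupp {x \<in> P m. ?dP m x = j}" unfolding fsupp_def by auto
    qed
    finally show ?thesis .
  qed
  have degG: "app (P m) G z \<in> fsupp {x \<in> Q m. ?dQ m x = j}" if z: "z \<in> fsupp {x \<in> P m. ?dP m x = j}" for z m
  proof -
    have "app (P m) G z = app {x \<in> P m. ?dP m x = j} G z" by (rule app_restrict) (use z P.fin in auto)
    also have "\<dots> \<in> fsupp {x \<in> Q m. ?dQ m x = j}"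
    proof (rule app_fsupp)
      fix x assume x: "x \<in> {x \<in> P m. ?dP m x = j}"
      then obtain a b p q where ab: "x = (a, b)" "p + q = m" "a \<in> X p" "b \<in> Y q"
        unfolding P_def by (auto elim: TX_E)
      have "(h, b') \<in> Q m \<and> hdeg h + dg' b' = j" if "G x (h, b') \<noteq> 0" for h b'
      proof -
        have h: "g a h \<noteq> 0" "b' = b"
          using that by (auto simp: ab(1) G_def tp_def delta_def split: if_splits)
        then have "h \<in> H p \<and> hdeg h = dg a" using gX[OF ab(3)] unfolding fsupp_def by blast
        then show ?thesis using h ab(2,4) x by (auto simp: ab(1) Q_def TX_iff)
      qed
      then show "G x \<in> fsupp {x \<in> Q m. ?dQ m x = j}" unfolding fsupp_def by auto
    qed
    finally show ?thesis .
  qed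
  have "hdim P ?dP (\<lambda>_. cP) n j \<le> hdim Q ?dQ (\<lambda>_. cQ) n j"
  proof (rule hdim_le[OF kP kQ app_linear[of "P n" G]])
    fix z assume z: "z \<in> cyc P ?dP (\<lambda>_. cP) n j"
    have zs: "z \<in> fsupp {x \<in> P n. ?dP n x = j}" and zP: "z \<in> fsupp (P n)"
      using z by (auto simp: cyc_def fsupp_def)
    show "app (P n) G z \<in> cyc Q ?dQ (\<lambda>_. cQ) n j"
      unfolding cyc_def
    proof (intro CollectI conjI allI impI degG[OF zs])
      fix m assume m: "n = Suc m"
      show "app (Q n) cQ (app (P n) G z) = 0" using cycP[OF z] unfolding m chG' by simp
    qed
    assume "app (P n) G z \<in> bnd Q ?dQ (\<lambda>_. cQ) n j"
    then obtain y where y: "app (P n) G z = app (Q (Suc n)) cQ y" by (auto simp: bnd_def)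
    have "z = app (P n) delta z" by (simp add: app_mat_delta P.fin zP)
    also have "\<dots> = app (P n) (\<lambda>x. app (Q n) F (G x) + app (P (Suc n)) cP (S x) + app (P (n - 1)) S (cP x)) z"
      by (rule app_cong[OF refl refl]) (rule FG[symmetric])
    also have "\<dots> = app (Q n) F (app (P n) G z) + app (P (Suc n)) cP (app (P n) S z) +
        app (P (n - 1)) S (app (P n) cP z)"
      by (simp add: app_mat_add app_app)
    also have "\<dots> = app (P (Suc n)) cP (app (Q (Suc n)) F y + app (P n) S z)"
      using cycP[OF z] by (simp add: y chF' app_add)
    finally show "z \<in> bnd P ?dP (\<lambda>_. cP) n j" by (rule kcx.bndI[OF kP zs])
  qed
  moreover have "hdim Q ?dQ (\<lambda>_. cQ) n j \<le> hdim P ?dP (\<lambda>_. cP) n j"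
  proof (rule hdim_le[OF kQ kP app_linear[of "Q n" F]])
    fix y assume y: "y \<in> cyc Q ?dQ (\<lambda>_. cQ) n j"
    have ys: "y \<in> fsupp {x \<in> Q n. ?dQ n x = j}" and yQ: "y \<in> fsupp (Q n)"
      using y by (auto simp: cyc_def fsupp_def)
    show "app (Q n) F y \<in> cyc P ?dP (\<lambda>_. cP) n j"
      unfolding cyc_def
    proof (intro CollectI conjI allI impI degF[OF ys])
      fix m assume m: "n = Suc m"
      have "app (Q (Suc m)) cQ y = 0" using y m by (auto simp: cyc_def)
      then show "app (P n) cP (app (Q n) F y) = 0" unfolding m chF' by simp
    qed
    assume "app (Q n) F y \<in> bnd P ?dP (\<lambda>_. cP) n j"
    then obtain z where z: "app (Q n) F y = app (P (Suc n)) cP z" by (auto simp: bnd_def)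
    have "y = app (Q n) delta y" by (simp add: app_mat_delta Q.fin yQ)
    also have "\<dots> = app (Q n) (\<lambda>x. app (P n) G (F x)) y"
      by (rule app_cong[OF refl refl]) (rule GF[symmetric])
    also have "\<dots> = app (Q (Suc n)) cQ (app (P (Suc n)) G z)"
      by (simp add: z chG' flip: app_app)
    finally show "y \<in> bnd Q ?dQ (\<lambda>_. cQ) n j" by (rule kcx.bndI[OF kQ ys])
  qed
  moreover have "hdim Q ?dQ (\<lambda>_. cQ) n j =
      (\<Sum>p\<le>n. \<Sum>l\<in>L. hdim X (\<lambda>_. dg) (\<lambda>_. c) p l * hdim Y (\<lambda>_. dg') (\<lambda>_. c') (n - p) (j - l))"
  proof -
    \<comment> \<open>Degrees up to \<open>Suc n\<close> are enough for homology in degree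
      \<open>n\<close> and keep the index set finite. Each class \<open>h\<close> carries a copy of
      \<open>Y\<close>, shifted by its rank and its degree, with the differential signed by its
      rank.\<close>
    let ?HH = "\<Union>p\<le>Suc n. H p"
    let ?hY = "\<lambda>p l. hdim Y (\<lambda>_. dg') (\<lambda>_. c') (n - p) (j - l)"
    let ?sh = "\<lambda>h. shift (fst h) Y" and ?sd = "\<lambda>h (_ :: nat) b. dg' b + hdeg h"
      and ?sc = "\<lambda>h (_ :: nat) b b'. (-1) ^ fst h * c' b b'"
    have sgn: "(-1 :: 'k) ^ p \<noteq> 0" for p by simp
    have "hdim Q ?dQ (\<lambda>_. cQ) n j = (\<Sum>h\<in>?HH. hdim (?sh h) (?sd h) (?sc h) n j)"
    proof (rule hdim_direct_sum)
      show "finite ?HH" using finH by simp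
      show "kcx (?sh h) (?sd h) (?sc h)" for h
        by (rule hdim_shift(1)[OF Y.kcx_axioms Y.supp0 sgn])
      show "Q m = Sigma ?HH (\<lambda>h. ?sh h m)" if "m \<le> Suc n" for m
      proof (intro set_eqI iffI)
        fix x assume "x \<in> Q m"
        then obtain h b p q where hb: "x = (h, b)" "p + q = m" "h \<in> H p" "b \<in> Y q"
          unfolding Q_def by (rule TX_E)
        then show "x \<in> Sigma ?HH (\<lambda>h. ?sh h m)" using rH[OF hb(3)] that by (auto simp: shift_def)
      next
        fix x assume "x \<in> Sigma ?HH (\<lambda>h. ?sh h m)"
        then obtain h b p where hb: "x = (h, b)" "h \<in> H p" "b \<in> ?sh h m" by auto
        then have "p \<le> m" "b \<in> Y (m - p)" using rH[OF hb(2)] by (auto simp: shift_def split: if_splits)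
        then show "x \<in> Q m" using hb by (auto simp: Q_def TX_def)
      qed
      show "?dQ m (h, b) = ?sd h m b" for m h b by simp
      show "cQ (h, b) = (\<lambda>(h', b'). if h' = h then ?sc h m b b' else 0)" for m h b
        by (auto simp: cQ_def tc_def tp_def delta_def sgn_pow_def fun_eq_iff)
    qed
    also have "\<dots> = (\<Sum>h\<in>?HH. if fst h \<le> n then ?hY (fst h) (hdeg h) else 0)"
      by (intro sum.cong refl hdim_shift(2)[OF Y.kcx_axioms Y.supp0 sgn])
    also have "\<dots> = (\<Sum>p\<le>Suc n. \<Sum>h\<in>H p. if fst h \<le> n then ?hY (fst h) (hdeg h) else 0)"
    proof (rule sum.UNION_disjoint)
      show "\<forall>p\<in>{..Suc n}. \<forall>q\<in>{..Suc n}. p \<noteq> q \<longrightarrow> H p \<inter> H q = {}" using rH by blast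
    qed (use finH in auto)
    also have "\<dots> = (\<Sum>p\<le>Suc n. \<Sum>h\<in>H p. if p \<le> n then ?hY p (hdeg h) else 0)"
      using rH by (intro sum.cong refl) auto
    also have "\<dots> = (\<Sum>p\<le>n. \<Sum>h\<in>H p. ?hY p (hdeg h))" by simp
    also have "\<dots> = (\<Sum>p\<le>n. \<Sum>l\<in>L. hdim X (\<lambda>_. dg) (\<lambda>_. c) p l * ?hY p l)"
    proof (intro sum.cong refl)
      fix p assume p: "p \<in> {..n}"
      \<comment> \<open>The representative \<open>f h\<close> is nonzero, so its degree is the
        degree of a basis element of \<open>X p\<close>.\<close>
      have "hdeg ` H p \<subseteq> L"
      proof
        fix l assume "l \<in> hdeg ` H p"
        then obtain h where h: "h \<in> H p" "l = hdeg h" by blast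
        have "f h \<noteq> 0"
        proof
          assume "f h = 0"
          then have "(delta h :: _ \<Rightarrow> 'k) = 0" using gf[OF h(1)] by (simp only: app_zero)
          from fun_cong[OF this, of h] show False by (simp add: delta_def)
        qed
        then obtain a where "f h a \<noteq> 0" by (auto simp: fun_eq_iff)
        then have "a \<in> X p \<and> dg a = hdeg h" using fH[OF h(1)] unfolding fsupp_def by blast
        then show "l \<in> L" using L(2)[of p a] p h by auto
      qed
      then have "(\<Sum>h\<in>H p. ?hY p (hdeg h)) = (\<Sum>l\<in>L. \<Sum>h\<in>{h \<in> H p. hdeg h = l}. ?hY p (hdeg h))"
        by (rule sum.group[OF finH L(1), symmetric])
      also have "\<dots> = (\<Sum>l\<in>L. card {h \<in> H p. hdeg h = l} * ?hY p l)" by (intro sum.cong refl) simp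
      finally show "(\<Sum>h\<in>H p. ?hY p (hdeg h)) = (\<Sum>l\<in>L. hdim X (\<lambda>_. dg) (\<lambda>_. c) p l * ?hY p l)"
        by (simp only: cardH)
    qed
    finally show ?thesis .
  qed
  ultimately show ?thesis by (simp add: P_def cP_def)
qed

section \<open>Betti numbers of splittings and of sums in disjoint variables\<close>

lemma hdim_cong_deg:
  assumes "\<And>n a. a \<in> X n \<Longrightarrow> deg n a = deg' n a" "\<And>n a. a \<in> X (Suc n) \<Longrightarrow> c n a = c' n a"
  shows "hdim X deg c n j = hdim X deg' c' n j"
proof -
  have "{a \<in> X n. deg n a = j} = {a \<in> X n. deg' n a = j}" for n using assms(1) by auto
  then have "hdim X deg c n j = hdim X deg' c n j" by (simp add: hdim_def cyc_def bnd_def)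
  also have "\<dots> = hdim X deg' c' n j" by (rule hdim_cong) (rule assms(2))
  finally show ?thesis .
qed

definition lcm_deg :: "('g \<Rightarrow> 'x::finite monomial) \<Rightarrow> 'g list \<Rightarrow> int" where
  "lcm_deg e s = int (mdeg (lcm_seq e s))"

text \<open>The matrix \<open>red\<close> of a Taylor complex as a free-standing function, so that
  it can be compared with matrices of the cone and of the product.\<close>

definition red_del :: "('g \<Rightarrow> 'x monomial) \<Rightarrow> 'g list \<Rightarrow> 'g list \<Rightarrow> 'k::field" where
  "red_del e s t = (if lcm_seq e s = lcm_seq e t then del_coeff s t else 0)"

lemma taylor_gcx:
  assumes "finite A"
  shows "gcx (seqs A) length (red_del e :: _ \<Rightarrow> _ \<Rightarrow> 'k::field) (lcm_deg e)"
proof -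
  interpret L: lcx "seqs A" "[]" "lcm_seq e" "\<lambda>_. del_coeff :: _ \<Rightarrow> _ \<Rightarrow> 'k" by (rule taylor_lcx[OF assms])
  have red: "L.red n = red_del e" for n by (auto simp: fun_eq_iff L.red_def red_del_def)
  interpret K: kcx "seqs A" L.ldeg L.red by (rule L.kcx_red)
  have z: "red_del e a = (0 :: _ \<Rightarrow> 'k)" if "a \<in> seqs A 0" for a
    using that by (auto simp: red_del_def del_coeff.simps)
  show ?thesis
  proof
    show "finite (seqs A n)" for n by (rule finite_seqs[OF assms])
    show "length a = n" if "a \<in> seqs A n" for a n using that by (simp add: seqs_def)
    show "red_del e a = (0 :: _ \<Rightarrow> 'k)" if "a \<in> seqs A 0" for a by (rule z[OF that])
    show "red_del e a \<in> (fsupp (seqs A n) :: (_ \<Rightarrow> 'k) set)" if "a \<in> seqs A (Suc n)" for a n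
      using K.graded[OF that] unfolding red fsupp_def by blast
    show "app (seqs A n) (red_del e) (red_del e a) = (0 :: _ \<Rightarrow> 'k)" if "a \<in> seqs A (Suc n)" for a n
    proof (cases n)
      case 0 then show ?thesis by (intro app_mat_zero z) simp
    next
      case (Suc m) then show ?thesis using K.dd[of a m] that by (simp add: red)
    qed
    show "lcm_deg e b = lcm_deg e a" if "red_del e a b \<noteq> (0 :: 'k)" for a b
      using that by (auto simp: red_del_def lcm_deg_def split: if_splits)
  qed
qed

lemma seqs_1_labels: "lcm_seq e ` seqs A (Suc 0) = e ` A"
proof -
  have "sup m 0 = m" for m :: "'a monomial" by (simp add: sup.absorb1)
  then show ?thesis by (auto simp: seqs_Suc image_iff)
qed

lemma betti_taylor:
  assumes "finite A" "\<And>a. a \<in> A \<Longrightarrow> e a \<noteq> 0" "i \<ge> -1"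
  shows "betti (ideal_gen (monom ` e ` A) :: ('x::finite, 'k::field) mpoly set) i j =
    hdim (seqs A) (\<lambda>_. lcm_deg e) (\<lambda>_. red_del e :: _ \<Rightarrow> _ \<Rightarrow> 'k) (nat (i + 1)) j"
proof -
  interpret L: lcx "seqs A" "[]" "lcm_seq e" "\<lambda>_. del_coeff :: _ \<Rightarrow> _ \<Rightarrow> 'k" by (rule taylor_lcx[OF assms(1)])
  have "lcm_seq e a \<noteq> 0" if "a \<in> seqs A (Suc 0)" for a
    using imageI[OF that, of "lcm_seq e"] assms(2) unfolding seqs_1_labels by auto
  then have "betti (ideal_gen (monom ` lcm_seq e ` seqs A (Suc 0)) :: ('x, 'k) mpoly set) i j =
      hdim (seqs A) L.ldeg L.red (nat (i + 1)) j"
    using assms(3) by (rule L.betti_labelled)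
  also have "\<dots> = hdim (seqs A) (\<lambda>_. lcm_deg e) (\<lambda>_. red_del e :: _ \<Rightarrow> _ \<Rightarrow> 'k) (nat (i + 1)) j"
    by (rule hdim_cong_deg) (auto simp: L.ldeg_def lcm_deg_def L.red_def red_del_def fun_eq_iff)
  finally show ?thesis by (simp only: seqs_1_labels)
qed

text \<open>A common factor \<open>F\<close> can be taken out of an lcm. The outer
  \<open>sup F\<close> extends this to the empty sequence, where both sides are
  \<open>F\<close>.\<close>

lemma lcm_seq_plus:
  assumes "\<And>w. w \<in> set t \<Longrightarrow> w = F + e w"
  shows "sup F (lcm_seq (\<lambda>w. w) t) = F + lcm_seq e t"
  using assms
proof (induction t)
  case Nil
  show ?case by (auto simp: fun_eq_iff sup_nat_def)
next
  case (Cons w t)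
  have IH: "sup F (lcm_seq (\<lambda>w. w) t) = F + lcm_seq e t"
    by (rule Cons.IH) (rule Cons.prems, simp)
  have "sup (F x) (sup (w x) (lcm_seq (\<lambda>w. w) t x)) = F x + sup (e w x) (lcm_seq e t x)" for x
  proof -
    have "w x = F x + e w x" using Cons.prems[of w] by (metis list.set_intros(1) plus_fun_apply)
    then show ?thesis using fun_cong[OF IH, of x] by (auto simp: sup_nat_def max_def split: if_splits)
  qed
  then show ?case by (simp add: fun_eq_iff)
qed

lemma lcm_seq_diff:
  assumes "\<And>w. w \<in> set t \<Longrightarrow> F \<le> w"
  shows "sup F (lcm_seq (\<lambda>w. w) t) = F + lcm_seq (\<lambda>w. w - F) t"
proof (rule lcm_seq_plus)
  fix w assume "w \<in> set t"
  then show "w = F + (w - F)" using assms[of w] by (auto simp: le_fun_def fun_eq_iff)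
qed

text \<open>After tensoring with \<open>k\<close> the connecting map of the cone is zero, so the
  cone falls apart into the complex for \<open>K\<close> and a copy of the one for the quotients
  \<open>w - F\<close>, moved up by one step and by the degree of \<open>F\<close>.\<close>

theorem betti_splitting:
  fixes F :: "'x::finite monomial"
  assumes fin: "finite K" "finite M"
    and \<psi>: "\<And>w. w \<in> M \<Longrightarrow> \<psi> w \<in> K" "\<And>w. w \<in> M \<Longrightarrow> \<psi> w \<le> w"
    and F: "\<And>w. w \<in> M \<Longrightarrow> F \<le> w"
    and cov: "\<And>g m. g \<in> K \<Longrightarrow> g \<le> m \<Longrightarrow> F \<le> m \<Longrightarrow> \<exists>w\<in>M. w \<le> m"
    and strict: "\<And>t. t \<noteq> [] \<Longrightarrow> set t \<subseteq> M \<Longrightarrow> lcm_seq (\<lambda>w. w) (map \<psi> t) \<noteq> lcm_seq (\<lambda>w. w) t"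
    and nz: "F \<noteq> 0" "0 \<notin> K" "F \<notin> M" and i: "i \<ge> 0"
  shows "betti (ideal_gen (monom ` insert F K) :: ('x, 'k::field) mpoly set) i j =
    betti (ideal_gen (monom ` K) :: ('x, 'k) mpoly set) i j +
    betti (ideal_gen (monom ` (\<lambda>w. w - F) ` M) :: ('x, 'k) mpoly set) (i - 1) (j - int (mdeg F))"
proof -
  let ?id = "\<lambda>w :: 'x monomial. w" and ?e = "\<lambda>w. w - F"
  interpret C: lcx "cone_X K M" "(False, [])" "cone_l ?id F" "\<lambda>_. cone_c \<psi> :: _ \<Rightarrow> _ \<Rightarrow> 'k"
    by (rule cone_lcx) (use assms in auto)
  have sup0: "sup m 0 = m" for m :: "'x monomial" by (simp add: sup.absorb1)
  have labels: "cone_l ?id F ` cone_X K M (Suc 0) = insert F K"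
    using seqs_1_labels[of ?id K] by (simp add: cone_X_def image_Un image_image cone_l_def sup0)
  have "cone_l ?id F a \<noteq> 0" if "a \<in> cone_X K M (Suc 0)" for a
    using imageI[OF that, of "cone_l ?id F"] nz unfolding labels by auto
  then have "betti (ideal_gen (monom ` cone_l ?id F ` cone_X K M (Suc 0)) :: ('x, 'k) mpoly set) i j =
      hdim (cone_X K M) C.ldeg C.red (nat (i + 1)) j"
    using i by (intro C.betti_labelled) auto
  then have "betti (ideal_gen (monom ` insert F K) :: ('x, 'k) mpoly set) i j =
      hdim (cone_X K M) C.ldeg C.red (nat (i + 1)) j"
    by (simp only: labels)
  also have "\<dots> = (\<Sum>b\<in>UNIV. hdim (if b then shift 1 (seqs M) else seqs K)
     (if b then \<lambda>_ s. lcm_deg ?e s + int (mdeg F) else (\<lambda>_. lcm_deg ?id))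
     (if b then \<lambda>_ s t. (-1) * red_del ?e s t else (\<lambda>_. red_del ?id :: _ \<Rightarrow> _ \<Rightarrow> 'k)) (nat (i + 1)) j)"
  proof (rule hdim_direct_sum)
    interpret T: gcx "seqs K" length "red_del ?id :: _ \<Rightarrow> _ \<Rightarrow> 'k" "lcm_deg ?id" by (rule taylor_gcx[OF fin(1)])
    interpret U: gcx "seqs M" length "red_del ?e :: _ \<Rightarrow> _ \<Rightarrow> 'k" "lcm_deg ?e" by (rule taylor_gcx[OF fin(2)])
    show "kcx (if b then shift 1 (seqs M) else seqs K)
     (if b then \<lambda>_ s. lcm_deg ?e s + int (mdeg F) else (\<lambda>_. lcm_deg ?id))
     (if b then \<lambda>_ s t. (-1) * red_del ?e s t else (\<lambda>_. red_del ?id :: _ \<Rightarrow> _ \<Rightarrow> 'k))" for b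
    proof (cases b)
      case True
      have "kcx (shift 1 (seqs M)) (\<lambda>_ s. lcm_deg ?e s + int (mdeg F)) (\<lambda>_ s t. (-1) * red_del ?e s t :: 'k)"
        by (rule hdim_shift(1)[OF U.kcx_axioms U.supp0]) simp_all
      then show ?thesis using True by simp
    qed (simp add: T.kcx_axioms)
    show "cone_X K M p = Sigma UNIV (\<lambda>b. (if b then shift 1 (seqs M) else seqs K) p)" for p
      by (cases p) (auto simp: cone_X_def shift_def split: if_splits)
    show "C.ldeg p (b, s) = (if b then \<lambda>_ s. lcm_deg ?e s + int (mdeg F) else (\<lambda>_. lcm_deg ?id)) p s"
      if "s \<in> (if b then shift 1 (seqs M) else seqs K) p" for p b s
    proof (cases b)
      case True
      then have "set s \<subseteq> M" using that by (auto simp: shift_def seqs_def split: if_splits)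
      then have "sup F (lcm_seq ?id s) = F + lcm_seq ?e s" using F by (intro lcm_seq_diff) auto
      then show ?thesis using True unfolding C.ldeg_def by (simp add: cone_l_def lcm_deg_def mdeg_add)
    qed (unfold C.ldeg_def, simp add: cone_l_def lcm_deg_def)
    show "C.red p (b, s) = (\<lambda>(b', t). if b' = b then
        (if b then \<lambda>_ s t. (-1) * red_del ?e s t else (\<lambda>_. red_del ?id)) p s t else 0)"
      if s: "s \<in> (if b then shift 1 (seqs M) else seqs K) (Suc p)" for p b s
    proof (rule ext, clarify)
      fix b' t
      show "C.red p (b, s) (b', t) = (if b' = b then
        (if b then \<lambda>_ s t. (-1) * red_del ?e s t else (\<lambda>_. red_del ?id)) p s t else 0)"
      proof (cases b)
        case False
        then show ?thesis unfolding C.red_def by (auto simp: cone_l_def cone_c_def join_def red_del_def)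
      next
        case True
        then have sM: "set s \<subseteq> M" using s by (auto simp: shift_def seqs_def split: if_splits)
        show ?thesis
        proof (cases b')
          case False
          \<comment> \<open>The connecting map has no unit entry: on the empty sequence because
            \<open>F\<close> is not the monomial 1, elsewhere by strict divisibility.\<close>
          have "lcm_seq ?id (map \<psi> s) \<noteq> sup F (lcm_seq ?id s)"
          proof (cases s)
            case Nil
            then show ?thesis using nz by (simp add: sup0 eq_commute)
          next
            case (Cons w s')
            then have "F \<le> lcm_seq ?id s" using F[of w] sM by (simp add: le_supI1)
            then show ?thesis using strict[of s] Cons sM by (simp add: sup.absorb2)
          qed
          then show ?thesis using True False
            unfolding C.red_def by (auto simp: cone_l_def cone_c_def join_def delta_def)
        next
          case b': True
          show ?thesis
          proof (cases "del_coeff s t = (0 :: 'k)")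
            case True
            then show ?thesis using \<open>b\<close> b' unfolding C.red_def by (simp add: cone_c_def join_def red_del_def)
          next
            case False
            then have "set t \<subseteq> M" using del_coeff_nonzero[of s t] sM by blast
            then have "sup F (lcm_seq ?id t) = F + lcm_seq ?e t" "sup F (lcm_seq ?id s) = F + lcm_seq ?e s"
              using F sM by (auto intro!: lcm_seq_diff)
            then show ?thesis using \<open>b\<close> b' unfolding C.red_def by (simp add: cone_l_def cone_c_def join_def red_del_def)
          qed
        qed
      qed
    qed
  qed simp
  also have "\<dots> = hdim (seqs K) (\<lambda>_. lcm_deg ?id) (\<lambda>_. red_del ?id :: _ \<Rightarrow> _ \<Rightarrow> 'k) (nat (i + 1)) j +
      hdim (shift 1 (seqs M)) (\<lambda>_ s. lcm_deg ?e s + int (mdeg F)) (\<lambda>_ s t. (-1) * red_del ?e s t :: 'k) (nat (i + 1)) j"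
    by (simp add: UNIV_bool)
  also have "hdim (seqs K) (\<lambda>_. lcm_deg ?id) (\<lambda>_. red_del ?id :: _ \<Rightarrow> _ \<Rightarrow> 'k) (nat (i + 1)) j =
      betti (ideal_gen (monom ` K) :: ('x, 'k) mpoly set) i j"
  proof -
    have "a \<noteq> 0" if "a \<in> K" for a using nz that by blast
    then show ?thesis using betti_taylor[OF fin(1), of ?id i j, where 'k = 'k] i by simp
  qed
  also have "hdim (shift 1 (seqs M)) (\<lambda>_ s. lcm_deg ?e s + int (mdeg F)) (\<lambda>_ s t. (-1) * red_del ?e s t :: 'k) (nat (i + 1)) j =
      betti (ideal_gen (monom ` ?e ` M) :: ('x, 'k) mpoly set) (i - 1) (j - int (mdeg F))"
  proof -
    interpret U: gcx "seqs M" length "red_del ?e :: _ \<Rightarrow> _ \<Rightarrow> 'k" "lcm_deg ?e" by (rule taylor_gcx[OF fin(2)])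
    have "hdim (shift 1 (seqs M)) (\<lambda>_ s. lcm_deg ?e s + int (mdeg F)) (\<lambda>_ s t. (-1) * red_del ?e s t :: 'k) (nat (i + 1)) j =
      (if 1 \<le> nat (i + 1) then hdim (seqs M) (\<lambda>_. lcm_deg ?e) (\<lambda>_. red_del ?e :: _ \<Rightarrow> _ \<Rightarrow> 'k) (nat (i + 1) - 1) (j - int (mdeg F)) else 0)"
      by (rule hdim_shift(2)[OF U.kcx_axioms U.supp0]) simp_all
    \<comment> \<open>Since \<open>F\<close> is not in \<open>M\<close>, the quotient ideal stays
      proper, and \<open>betti_taylor\<close> applies even for index
      \<open>i - 1 = -1\<close>.\<close>
    moreover have "?e w \<noteq> 0" if "w \<in> M" for w
    proof
      assume e: "?e w = 0"
      have "w x \<le> F x" for x using fun_cong[OF e, of x] by simp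
      then have "w \<le> F" by (simp add: le_fun_def)
      then have "w = F" using F[OF that] by (rule antisym)
      then show False using nz that by blast
    qed
    ultimately show ?thesis using i betti_taylor[OF fin(2), of ?e "i - 1" "j - int (mdeg F)", where 'k = 'k]
      by (simp add: nat_diff_distrib' nat_add_distrib)
  qed
  finally show ?thesis .
qed

lemma hdim_negative_degree:
  fixes c :: "nat \<Rightarrow> 'a \<Rightarrow> 'a \<Rightarrow> 'b::field"
  assumes "\<And>a. deg n a \<ge> 0" "j < 0"
  shows "hdim X deg c n j = 0"
proof -
  have "deg n a \<noteq> j" for a using assms(1)[of a] assms(2) by linarith
  then have e: "{a \<in> X n. deg n a = j} = {}" by blast
  have "fsupp {} = {0 :: 'a \<Rightarrow> 'b}" by (auto simp: fsupp_def fun_eq_iff)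
  then have "cyc X deg c n j = {v \<in> {0}. \<forall>m. n = Suc m \<longrightarrow> app (X n) (c m) v = 0}"
    by (simp only: cyc_def e)
  also have "\<dots> = {0}"
    by (intro set_eqI iffI) (simp_all only: mem_Collect_eq singleton_iff app_zero simp_thms)
  finally have "cyc X deg c n j = {0}" .
  then show ?thesis by (simp add: hdim_def)
qed

text \<open>In disjoint variables the lcm of two labels is their product. So degrees add up and
  tensoring the product complex with \<open>k\<close> gives the tensor product of the two reduced
  complexes. For negative \<open>j\<close> the inner sum is empty and both sides are 0.\<close>

theorem betti_sum_coprime:
  fixes A B :: "'x::finite monomial set"
  assumes fin: "finite A" "finite B" and nz: "0 \<notin> A" "0 \<notin> B" and i: "i \<ge> -1"
    and U: "\<And>a x. a \<in> A \<Longrightarrow> x \<notin> U \<Longrightarrow> a x = 0" "\<And>b x. b \<in> B \<Longrightarrow> x \<in> U \<Longrightarrow> b x = 0"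
  shows "betti (ideal_gen (monom ` (A \<union> B)) :: ('x, 'k::field) mpoly set) i j =
    (\<Sum>l1 = 0..i + 1. \<Sum>l2 = 0..j. betti (ideal_gen (monom ` A) :: ('x, 'k) mpoly set) (l1 - 1) l2 *
       betti (ideal_gen (monom ` B) :: ('x, 'k) mpoly set) (i - l1) (j - l2))"
proof -
  let ?id = "\<lambda>w :: 'x monomial. w"
  let ?l = "\<lambda>(s, t). sup (lcm_seq ?id s) (lcm_seq ?id t)"
  let ?X = "TX (seqs A) (seqs B)" and ?n = "nat (i + 1)"
  let ?red = "red_del ?id :: _ \<Rightarrow> _ \<Rightarrow> 'k"
  interpret P: lcx ?X "([], [])" ?l "\<lambda>_. tc length del_coeff del_coeff :: _ \<Rightarrow> _ \<Rightarrow> 'k"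
    by (rule pair_lcx[OF fin])
  have sup0: "sup m 0 = m" "sup 0 m = m" for m :: "'x monomial" by (simp_all add: sup.absorb1 sup.absorb2)
  have labels: "?l ` ?X (Suc 0) = A \<union> B"
  proof
    show "?l ` ?X (Suc 0) \<subseteq> A \<union> B" by (auto simp: TX_def seqs_Suc le_Suc_eq sup0)
    show "A \<union> B \<subseteq> ?l ` ?X (Suc 0)"
    proof
      fix m assume m: "m \<in> A \<union> B"
      show "m \<in> ?l ` ?X (Suc 0)"
      proof (cases "m \<in> A")
        case True
        then show ?thesis
          by (intro image_eqI[of _ _ "([m], [])"]) (simp_all add: sup0 TX_def seqs_def)
      next
        case False
        then show ?thesis using m
          by (intro image_eqI[of _ _ "([], [m])"]) (simp_all add: sup0 TX_def seqs_def)
      qed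
    qed
  qed
  have lA: "lcm_seq ?id s x = 0" if "set s \<subseteq> A" "x \<notin> U" for s x
    using that U(1) by (induction s) (auto simp: sup_nat_def)
  have lB: "lcm_seq ?id t x = 0" if "set t \<subseteq> B" "x \<in> U" for t x
    using that U(2) by (induction t) (auto simp: sup_nat_def)
  have sum: "?l (s, t) = lcm_seq ?id s + lcm_seq ?id t" if "set s \<subseteq> A" "set t \<subseteq> B" for s t
  proof
    fix x show "?l (s, t) x = (lcm_seq ?id s + lcm_seq ?id t) x"
      using lA[OF that(1), of x] lB[OF that(2), of x] by (cases "x \<in> U") (auto simp: sup_nat_def)
  qed
  have "?l a \<noteq> 0" if "a \<in> ?X (Suc 0)" for a
    using imageI[OF that, of ?l] nz unfolding labels by auto
  then have "betti (ideal_gen (monom ` ?l ` ?X (Suc 0)) :: ('x, 'k) mpoly set) i j = hdim ?X P.ldeg P.red ?n j"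
    using i by (rule P.betti_labelled)
  also have "\<dots> = hdim ?X (\<lambda>_ (s, t). lcm_deg ?id s + lcm_deg ?id t) (\<lambda>_. tc length ?red ?red) ?n j"
  proof (rule hdim_cong_deg)
    fix n x assume "x \<in> ?X n"
    then obtain s t p q where x: "x = (s, t)" "s \<in> seqs A p" "t \<in> seqs B q" by (rule TX_E)
    then show "P.ldeg n x = (case x of (s, t) \<Rightarrow> lcm_deg ?id s + lcm_deg ?id t)"
      using sum[of s t] by (simp add: P.ldeg_def lcm_deg_def seqs_def mdeg_add)
  next
    fix n x assume "x \<in> ?X (Suc n)"
    then obtain s t p q where x: "x = (s, t)" "s \<in> seqs A p" "t \<in> seqs B q" by (rule TX_E)
    then have st: "set s \<subseteq> A" "set t \<subseteq> B" by (auto simp: seqs_def)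
    show "P.red n x = tc length ?red ?red x"
    proof (rule ext, unfold x(1), clarify)
      fix s' t'
      \<comment> \<open>A nonzero entry of the differential changes one component only. By
        \<open>sum\<close> the joint label then stays the same exactly when the label of the changed
        component does.\<close>
      consider "t' = t" "s' \<noteq> s" "del_coeff s s' \<noteq> (0 :: 'k)" | "s' = s" "t' \<noteq> t" "del_coeff t t' \<noteq> (0 :: 'k)"
        | "s' = s" "t' = t" | "t' \<noteq> t" "s' \<noteq> s" | "t' = t" "s' \<noteq> s" "del_coeff s s' = (0 :: 'k)"
        | "s' = s" "t' \<noteq> t" "del_coeff t t' = (0 :: 'k)" by blast
      then show "P.red n (s, t) (s', t') = tc length ?red ?red (s, t) (s', t')"
      proof cases
        case 1
        then have "set s' \<subseteq> A" using del_coeff_nonzero[of s s'] st by blast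
        then have "?l (s, t) = ?l (s', t') \<longleftrightarrow> lcm_seq ?id s = lcm_seq ?id s'"
          using sum[OF st] sum[of s' t] st 1 by (simp del: prod.case)
        then show ?thesis using 1 unfolding P.red_def by (auto simp: tc_def tp_def delta_def sgn_pow_def red_del_def)
      next
        case 2
        then have "set t' \<subseteq> B" using del_coeff_nonzero[of t t'] st by blast
        then have "?l (s, t) = ?l (s', t') \<longleftrightarrow> lcm_seq ?id t = lcm_seq ?id t'"
          using sum[OF st] sum[of s t'] st 2 by (simp del: prod.case)
        then show ?thesis using 2 unfolding P.red_def by (auto simp: tc_def tp_def delta_def sgn_pow_def red_del_def)
      qed (unfold P.red_def, auto simp: tc_def tp_def delta_def sgn_pow_def red_del_def)
    qed
  qed
  also have "\<dots> = (\<Sum>p\<le>?n. \<Sum>l\<in>L. hdim (seqs A) (\<lambda>_. lcm_deg ?id) (\<lambda>_. ?red) p l *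
      hdim (seqs B) (\<lambda>_. lcm_deg ?id) (\<lambda>_. ?red) (?n - p) (j - l))"
    if "finite L" "\<And>p a. p \<le> ?n \<Longrightarrow> a \<in> seqs A p \<Longrightarrow> lcm_deg ?id a \<in> L" for L
    by (rule kuenneth[OF taylor_gcx[OF fin(1)] taylor_gcx[OF fin(2)] that])
  finally have ku: "betti (ideal_gen (monom ` ?l ` ?X (Suc 0)) :: ('x, 'k) mpoly set) i j =
      (\<Sum>p\<le>?n. \<Sum>l\<in>L. hdim (seqs A) (\<lambda>_. lcm_deg ?id) (\<lambda>_. ?red) p l *
      hdim (seqs B) (\<lambda>_. lcm_deg ?id) (\<lambda>_. ?red) (?n - p) (j - l))"
    if "finite L" "\<And>p a. p \<le> ?n \<Longrightarrow> a \<in> seqs A p \<Longrightarrow> lcm_deg ?id a \<in> L" for L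
    using that by blast
  let ?h = "\<lambda>(p :: nat) l. hdim (seqs A) (\<lambda>_. lcm_deg ?id) (\<lambda>_. ?red) p l *
      hdim (seqs B) (\<lambda>_. lcm_deg ?id) (\<lambda>_. ?red) (?n - p) (j - l)"
  \<comment> \<open>Large enough for \<open>kuenneth\<close>, and containing the range of the final
    sum. Degrees of lcms are nonnegative, so terms outside \<open>{0..j}\<close> vanish.\<close>
  define L where "L = {0..j} \<union> (\<Union>p\<le>?n. lcm_deg ?id ` seqs A p)"
  have finL: "finite L" using fin by (simp add: L_def finite_seqs)
  have "betti (ideal_gen (monom ` (A \<union> B)) :: ('x, 'k) mpoly set) i j = (\<Sum>p\<le>?n. \<Sum>l\<in>L. ?h p l)"
    using ku[OF finL] unfolding labels by (auto simp: L_def)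
  also have "\<dots> = (\<Sum>p\<le>?n. \<Sum>l = 0..j. ?h p l)"
  proof (rule sum.cong[OF refl], rule sum.mono_neutral_right[OF finL])
    show "{0..j} \<subseteq> L" by (simp add: L_def)
    fix p
    show "\<forall>l\<in>L - {0..j}. ?h p l = 0"
    proof
      fix l assume "l \<in> L - {0..j}"
      then have "l < 0 \<or> j - l < 0" by auto
      then show "?h p l = 0" using hdim_negative_degree[of "\<lambda>_. lcm_deg ?id"] by (auto simp: lcm_deg_def)
    qed
  qed
  also have "\<dots> = (\<Sum>l1 = 0..i + 1. \<Sum>l2 = 0..j. ?h (nat l1) l2)"
  proof (rule sum.reindex_bij_witness[of _ nat int])
    show "nat l1 \<in> {..?n}" if "l1 \<in> {0..i + 1}" for l1 using that i by auto
    show "int p \<in> {0..i + 1}" if "p \<in> {..?n}" for p using that i by auto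
  qed (use i in auto)
  also have "\<dots> = (\<Sum>l1 = 0..i + 1. \<Sum>l2 = 0..j. betti (ideal_gen (monom ` A) :: ('x, 'k) mpoly set) (l1 - 1) l2 *
       betti (ideal_gen (monom ` B) :: ('x, 'k) mpoly set) (i - l1) (j - l2))"
  proof (rule sum.cong[OF refl], rule sum.cong[OF refl])
    fix l1 l2 assume l1: "l1 \<in> {0..i + 1}"
    have AB: "a \<in> A \<Longrightarrow> a \<noteq> 0" "a \<in> B \<Longrightarrow> a \<noteq> 0" for a using nz by blast+
    have "betti (ideal_gen (monom ` A) :: ('x, 'k) mpoly set) (l1 - 1) l2 =
        hdim (seqs A) (\<lambda>_. lcm_deg ?id) (\<lambda>_. ?red) (nat l1) l2"
      using betti_taylor[OF fin(1), of ?id "l1 - 1" l2, where 'k = 'k] AB l1 by simp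
    moreover have "betti (ideal_gen (monom ` B) :: ('x, 'k) mpoly set) (i - l1) (j - l2) =
        hdim (seqs B) (\<lambda>_. lcm_deg ?id) (\<lambda>_. ?red) (?n - nat l1) (j - l2)"
    proof -
      have "nat (i - l1 + 1) = ?n - nat l1" using l1 by auto
      then show ?thesis using betti_taylor[OF fin(2), of ?id "i - l1" "j - l2", where 'k = 'k] AB l1 by simp
    qed
    ultimately show "?h (nat l1) l2 = betti (ideal_gen (monom ` A) :: ('x, 'k) mpoly set) (l1 - 1) l2 *
       betti (ideal_gen (monom ` B) :: ('x, 'k) mpoly set) (i - l1) (j - l2)" by simp
  qed
  finally show ?thesis .
qed

section \<open>Facet ideals\<close>

lemma ideal_gen_monom_eqI:
  assumes "\<And>m. (\<exists>a\<in>A. a \<le> m) \<longleftrightarrow> (\<exists>b\<in>B. b \<le> m)"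
  shows "ideal_gen (monom ` A) = (ideal_gen (monom ` B) :: ('x, 'k::field) mpoly set)"
  unfolding set_eq_iff mem_ideal_gen_monom using assms by simp

lemma ideal_gen_monom_eqD:
  assumes "ideal_gen (monom ` A) = (ideal_gen (monom ` B) :: ('x, 'k::field) mpoly set)" "a \<in> A" "a \<le> m"
  shows "\<exists>b\<in>B. b \<le> m"
proof -
  have k: "Poly_Mapping.keys (monom m :: ('x, 'k) mpoly) = {m}" by (simp add: monom_def)
  then have "(monom m :: ('x, 'k) mpoly) \<in> ideal_gen (monom ` A)"
    using assms(2,3) unfolding mem_ideal_gen_monom by auto
  then show ?thesis unfolding assms(1) mem_ideal_gen_monom k by simp
qed

text \<open>Justifies the \<open>THE\<close> in the definition: every set of monomials generating
  the ideal contains the divisibility-minimal members of \<open>A\<close>, and these already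
  generate it.\<close>

lemma min_mon_gens_monom:
  fixes A :: "'x monomial set"
  assumes "finite A"
  shows "min_mon_gens (ideal_gen (monom ` A) :: ('x, 'k::field) mpoly set) = {a \<in> A. \<forall>b\<in>A. b \<le> a \<longrightarrow> b = a}"
    (is "_ = ?M")
proof -
  have min: "\<exists>b\<in>?M. b \<le> a" if "a \<in> A" for a
    using finite_has_minimal2[OF assms that] by (auto intro: order_antisym)
  have M: "ideal_gen (monom ` ?M) = (ideal_gen (monom ` A) :: ('x, 'k) mpoly set)"
  proof (rule ideal_gen_monom_eqI)
    fix m
    show "(\<exists>a\<in>?M. a \<le> m) \<longleftrightarrow> (\<exists>a\<in>A. a \<le> m)"
    proof
      assume "\<exists>a\<in>A. a \<le> m"
      then obtain a where a: "a \<in> A" "a \<le> m" by blast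
      obtain b where "b \<in> ?M" "b \<le> a" using min[OF a(1)] by blast
      then show "\<exists>a\<in>?M. a \<le> m" using order_trans[OF _ a(2)] by blast
    qed blast
  qed
  have irr: "ideal_gen (monom ` B) \<noteq> (ideal_gen (monom ` A) :: ('x, 'k) mpoly set)" if B: "B \<subset> ?M" for B
  proof
    assume e: "ideal_gen (monom ` B) = (ideal_gen (monom ` A) :: ('x, 'k) mpoly set)"
    obtain a where a: "a \<in> ?M" "a \<notin> B" using B by blast
    then obtain b where "b \<in> B" "b \<le> a" using ideal_gen_monom_eqD[OF e[symmetric], of a a] by auto
    then show False using a B by blast
  qed
  have uniq: "B = ?M" if B: "ideal_gen (monom ` B) = (ideal_gen (monom ` A) :: ('x, 'k) mpoly set)"
    "\<forall>B'. B' \<subset> B \<longrightarrow> ideal_gen (monom ` B') \<noteq> (ideal_gen (monom ` A) :: ('x, 'k) mpoly set)" for B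
  proof -
    have "a \<in> B" if a: "a \<in> ?M" for a
    proof -
      \<comment> \<open>Some \<open>b\<close> in \<open>B\<close> divides \<open>a\<close>, and some
        member of \<open>A\<close> divides \<open>b\<close>; minimality of \<open>a\<close> squeezes
        all three together.\<close>
      obtain b where b: "b \<in> B" "b \<le> a" using ideal_gen_monom_eqD[OF B(1)[symmetric], of a a] a by auto
      obtain a' where a': "a' \<in> A" "a' \<le> b" using ideal_gen_monom_eqD[OF B(1) b(1), of b] by auto
      then have "a' \<le> a" using b(2) by simp
      then have "a' = a" using a a'(1) by blast
      then have "b = a" using a'(2) b(2) by simp
      then show ?thesis using b(1) by simp
    qed
    then have "?M \<subseteq> B" by blast
    then show ?thesis using B(2) M by blast
  qed
  show ?thesis unfolding min_mon_gens_def
    by (rule the_equality) (use M irr uniq in blast)+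
qed

text \<open>Carries the strictness condition of a splitting from sets of generators to sequences,
  where repetitions do not affect the lcm.\<close>

lemma Sup_eq_lcm_seq: "t \<noteq> [] \<Longrightarrow> Sup (set t) = lcm_seq (\<lambda>w. w) (t :: 'x monomial list)"
proof (induction t rule: list_nonempty_induct)
  case (single w)
  show ?case by (auto simp: fun_eq_iff sup_nat_def)
next
  case (cons w t)
  have "Sup (set (w # t)) x = sup w (Sup (set t)) x" for x
    using cons.hyps by (simp add: cSup_insert bdd_above_finite)
  then show ?case using cons.IH by (simp add: fun_eq_iff)
qed

section \<open>Facets of the complexes in the statement\<close>

lemma facets_antichain: "G \<in> facets \<Delta> \<Longrightarrow> H \<in> facets \<Delta> \<Longrightarrow> G \<subseteq> H \<Longrightarrow> G = H"
  by (auto simp: facets_def)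

lemma facets_complex_of_facets:
  assumes "\<And>G H. G \<in> A \<Longrightarrow> H \<in> A \<Longrightarrow> G \<subseteq> H \<Longrightarrow> G = H"
  shows "facets (complex_of_facets A) = A"
proof
  show "facets (complex_of_facets A) \<subseteq> A" by (auto simp: facets_def complex_of_facets_def)
  show "A \<subseteq> facets (complex_of_facets A)"
  proof
    fix G assume G: "G \<in> A"
    moreover have "\<not> G \<subset> H" if "H \<in> complex_of_facets A" for H
      using assms[OF G] that by (auto simp: complex_of_facets_def)
    ultimately show "G \<in> facets (complex_of_facets A)" by (auto simp: facets_def complex_of_facets_def)
  qed
qed

lemma facets_delete_facet: "facets (delete_facet \<Delta> F) = facets \<Delta> - {F}"
  unfolding delete_facet_def by (rule facets_complex_of_facets) (use facets_antichain in blast)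

lemma facets_conn: "facets (conn \<Delta> F) = {G. facets_connected \<Delta> F G}"
  unfolding conn_def
  by (rule facets_complex_of_facets) (use facets_antichain in \<open>auto simp: facets_connected_def\<close>)

lemma facets_delete_conn:
  "facets (delete_subcomplex \<Delta> (conn \<Delta> F)) = facets \<Delta> - {G. facets_connected \<Delta> F G}"
  unfolding delete_subcomplex_def facets_conn by (rule facets_complex_of_facets) (use facets_antichain in blast)

lemma facets_conn_bar:
  "facets (conn_bar \<Delta> F) = {H \<in> (\<lambda>G. G - F) ` ({G. facets_connected \<Delta> F G} - {F}).
     \<not> (\<exists>H'\<in>(\<lambda>G. G - F) ` ({G. facets_connected \<Delta> F G} - {F}). H' \<subset> H)}"
  unfolding conn_bar_def Let_def facets_delete_facet facets_conn
  by (rule facets_complex_of_facets) blast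

text \<open>A facet meeting a facet of the component prolongs a chain and so belongs to the
  component. This is what separates the variables of the two factors.\<close>

lemma facets_connected_disjoint:
  assumes "facets_connected \<Delta> F G" "H \<in> facets \<Delta>" "\<not> facets_connected \<Delta> F H"
  shows "G \<inter> H = {}"
proof (rule ccontr)
  assume "G \<inter> H \<noteq> {}"
  then have "facets_connected \<Delta> F H"
    using assms(1,2) unfolding facets_connected_def by (auto intro: rtranclp.rtrancl_into_rtrancl)
  then show False using assms(3) by blast
qed

lemma indicator_le_iff: "indicator G \<le> (m :: 'x monomial) \<longleftrightarrow> (\<forall>x\<in>G. m x \<noteq> 0)"
  by (auto simp: le_fun_def indicator_def Suc_le_eq)

lemma mdeg_indicator: "mdeg (indicator F :: 'x::finite monomial) = card F"
  by (simp add: mdeg_def indicator_def sum.If_cases)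

theorem theorem1p2:
  fixes k :: "'k::field itself"
    and \<Delta> :: "'x::finite set set"
    and F :: "'x set"
    and i j :: int
  assumes "simplicial_complex UNIV \<Delta>"
    and "splitting_facet k \<Delta> F"
    and "i \<ge> 1" and "j \<ge> 0"
  shows "betti (facet_ideal k \<Delta>) i j =
           betti (facet_ideal k (delete_facet \<Delta> F)) i j +
           (\<Sum>l1 = 0..i. \<Sum>l2 = 0..j - int (card F).
              betti (facet_ideal k (conn_bar \<Delta> F)) (l1 - 1) l2 *
              betti (facet_ideal k (delete_subcomplex \<Delta> (conn \<Delta> F)))
                (i - l1 - 1) (j - int (card F) - l2))"
proof -
  let ?F = "indicator F :: 'x monomial"
  define K :: "'x monomial set" where "K = indicator ` (facets \<Delta> - {F})"
  define C where "C = {G. facets_connected \<Delta> F G}"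
  define A :: "'x monomial set" where "A = indicator ` facets (conn_bar \<Delta> F)"
  define B :: "'x monomial set" where "B = indicator ` (facets \<Delta> - C)"
  let ?J = "ideal_gen (monom ` {?F}) :: ('x, 'k) mpoly set" and ?K = "ideal_gen (monom ` K) :: ('x, 'k) mpoly set"
  have F: "F \<in> facets \<Delta>" and sp: "is_splitting (facet_ideal k \<Delta>) ?J ?K"
    using assms(2) by (simp_all add: splitting_facet_def facet_ideal_def facets_delete_facet K_def)
  have K0: "?K \<noteq> {0}" using sp unfolding is_splitting_def by (elim conjE)
  obtain \<phi> \<psi> where
    split: "\<forall>w\<in>min_mon_gens (?J \<inter> ?K). \<phi> w \<in> min_mon_gens ?J \<and> \<psi> w \<in> min_mon_gens ?K \<and> w = sup (\<phi> w) (\<psi> w)"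
    and strict: "\<forall>S. S \<subseteq> min_mon_gens (?J \<inter> ?K) \<and> S \<noteq> {} \<longrightarrow> Sup (\<phi> ` S) < Sup S \<and> Sup (\<psi> ` S) < Sup S"
    using sp unfolding is_splitting_def by (elim conjE exE) (rule that)
  have finK: "finite K" by (simp add: K_def)
  \<comment> \<open>The minimal lcms of \<open>F\<close> with generators of \<open>K\<close>; they
    are the minimal generators of the intersection, the set on which the splitting functions are
    given.\<close>
  define M where "M = {w \<in> sup ?F ` K. \<forall>v\<in>sup ?F ` K. v \<le> w \<longrightarrow> v = w}"
  have "?J \<inter> ?K = (ideal_gen (monom ` sup ?F ` K) :: ('x, 'k) mpoly set)"
    unfolding set_eq_iff Int_iff mem_ideal_gen_monom by auto
  then have M: "min_mon_gens (?J \<inter> ?K) = M"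
    using min_mon_gens_monom[of "sup ?F ` K", where 'k = 'k] finK by (simp add: M_def)
  \<comment> \<open>The parts of a splitting are nonzero, so there is a facet besides
    \<open>F\<close>. In an antichain with two members none is empty, which excludes the generator
    1.\<close>
  have "K \<noteq> {}"
  proof
    assume "K = {}"
    then have "?K = {0}" by simp
    then show False using K0 by blast
  qed
  then have ne: "G \<noteq> {}" if "G \<in> facets \<Delta>" for G
    using facets_antichain[of G \<Delta>] F that by (auto simp: K_def)
  have ind0: "(indicator G :: 'x monomial) \<noteq> 0" if "G \<noteq> {}" for G :: "'x set"
    using that by (auto simp: fun_eq_iff indicator_def)
  have cov: "\<exists>w\<in>M. w \<le> m" if g: "g \<in> K" "g \<le> m" "?F \<le> m" for g m
  proof -
    obtain w where w: "w \<in> sup ?F ` K" "w \<le> sup ?F g" "\<forall>v\<in>sup ?F ` K. v \<le> w \<longrightarrow> w = v"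
      using finite_has_minimal2[OF finite_imageI[OF finK] imageI[OF g(1)], of "sup ?F"] by blast
    have "sup ?F g \<le> m" using g(2,3) by (rule le_supI[rotated])
    then have "w \<le> m" by (rule order_trans[OF w(2)])
    moreover have "w \<in> M" unfolding M_def
      by (intro CollectI conjI ballI impI w(1)) (rule w(3)[rule_format, symmetric])
    ultimately show ?thesis by blast
  qed
  have "betti (ideal_gen (monom ` insert ?F K) :: ('x, 'k) mpoly set) i j = betti ?K i j +
      betti (ideal_gen (monom ` (\<lambda>w. w - ?F) ` M) :: ('x, 'k) mpoly set) (i - 1) (j - int (mdeg ?F))"
  proof (rule betti_splitting)
    show "finite K" "finite M" using finK by (simp_all add: M_def)
    show "\<psi> w \<in> K" if "w \<in> M" for w
    proof -
      have "\<psi> w \<in> min_mon_gens ?K" using bspec[OF split[unfolded M] that] by (elim conjE)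
      then show ?thesis unfolding min_mon_gens_monom[OF finK, where 'k = 'k] by blast
    qed
    show "\<psi> w \<le> w" if "w \<in> M" for w
    proof -
      have e: "w = sup (\<phi> w) (\<psi> w)" using bspec[OF split[unfolded M] that] by (elim conjE)
      show ?thesis by (rule ord_le_eq_trans[OF sup_ge2 e[symmetric]])
    qed
    show "?F \<le> w" if "w \<in> M" for w using that by (auto simp: M_def)
    show "\<exists>w\<in>M. w \<le> m" if "g \<in> K" "g \<le> m" "?F \<le> m" for g m using cov that .
    show "lcm_seq (\<lambda>w. w) (map \<psi> t) \<noteq> lcm_seq (\<lambda>w. w) t" if "t \<noteq> []" "set t \<subseteq> M" for t
    proof (rule less_imp_neq)
      show "lcm_seq (\<lambda>w. w) (map \<psi> t) < lcm_seq (\<lambda>w. w) t"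
        using strict[unfolded M, rule_format, of "set t"] that by (simp add: Sup_eq_lcm_seq flip: set_map)
    qed
    show "?F \<noteq> 0" by (rule ind0[OF ne[OF F]])
    show "0 \<notin> K" using ind0 ne by (auto simp: K_def)
    show "?F \<notin> M"
    proof
      assume "?F \<in> M"
      then obtain G where G: "G \<in> facets \<Delta>" "G \<noteq> F" "?F = sup ?F (indicator G)" by (auto simp: M_def K_def)
      then have "indicator G \<le> ?F" by (metis sup_ge2)
      then have "G \<subseteq> F" by (auto simp: indicator_le_iff split: split_indicator_asm)
      then show False using facets_antichain[OF G(1) F] G(2) by blast
    qed
    show "i \<ge> 0" using assms(3) by simp
  qed
  moreover have "insert ?F K = indicator ` facets \<Delta>" using F by (auto simp: K_def)
  \<comment> \<open>Both sides are the colon ideal of \<open>K\<close> by \<open>F\<close>. The cone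
    requires the generators coming from \<open>M\<close>, the Kuenneth formula those split between
    \<open>A\<close> and \<open>B\<close>.\<close>
  moreover have "ideal_gen (monom ` (\<lambda>w. w - ?F) ` M) = (ideal_gen (monom ` (A \<union> B)) :: ('x, 'k) mpoly set)"
  proof (rule ideal_gen_monom_eqI)
    fix m :: "'x monomial"
    have "(\<exists>a\<in>(\<lambda>w. w - ?F) ` M. a \<le> m) \<longleftrightarrow> (\<exists>w\<in>M. w \<le> ?F + m)"
      by (auto simp: le_fun_def le_diff_conv add.commute)
    also have "\<dots> \<longleftrightarrow> (\<exists>g\<in>K. g \<le> ?F + m)"
    proof
      assume "\<exists>w\<in>M. w \<le> ?F + m"
      then show "\<exists>g\<in>K. g \<le> ?F + m" by (auto simp: M_def)
    next
      assume "\<exists>g\<in>K. g \<le> ?F + m"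
      moreover have "?F \<le> ?F + m" by (simp add: le_fun_def)
      ultimately show "\<exists>w\<in>M. w \<le> ?F + m" using cov by blast
    qed
    also have "\<dots> \<longleftrightarrow> (\<exists>G\<in>facets \<Delta> - {F}. indicator (G - F) \<le> m)"
    proof -
      \<comment> \<open>Divisibility by a squarefree monomial only asks for positive exponents, and
        those of \<open>?F + m\<close> are positive on all of \<open>F\<close>.\<close>
      have "indicator G \<le> ?F + m \<longleftrightarrow> indicator (G - F) \<le> m" for G :: "'x set"
        by (force simp: indicator_le_iff indicator_def)
      then show ?thesis unfolding K_def by simp
    qed
    also have "\<dots> \<longleftrightarrow> (\<exists>a\<in>A \<union> B. a \<le> m)"
    proof
      assume "\<exists>G\<in>facets \<Delta> - {F}. indicator (G - F) \<le> m"
      then obtain G where G: "G \<in> facets \<Delta>" "G \<noteq> F" "indicator (G - F) \<le> m" by blast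
      show "\<exists>a\<in>A \<union> B. a \<le> m"
      proof (cases "G \<in> C")
        case True
        let ?G = "(\<lambda>G. G - F) ` (C - {F})"
        have "finite ?G" "G - F \<in> ?G" using True G by auto
        then obtain H where H: "H \<in> ?G" "H \<subseteq> G - F" "\<forall>H'\<in>?G. H' \<subseteq> H \<longrightarrow> H = H'"
          using finite_has_minimal2[of ?G "G - F"] by auto
        then have "H \<in> facets (conn_bar \<Delta> F)" unfolding facets_conn_bar C_def[symmetric] by blast
        moreover have "indicator H \<le> m" using H(2) G(3) by (auto simp: indicator_le_iff)
        ultimately show ?thesis by (auto simp: A_def)
      next
        case False
        have "F \<in> C" using F by (simp add: C_def facets_connected_def)
        \<comment> \<open>A facet outside the component of \<open>F\<close> is disjoint from
          \<open>F\<close>, so it enters the colon ideal unchanged.\<close>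
        then have "G - F = G" using facets_connected_disjoint[of \<Delta> F F G] G(1) False by (auto simp: C_def)
        then show ?thesis using G False by (auto simp: B_def)
      qed
    next
      assume "\<exists>a\<in>A \<union> B. a \<le> m"
      then consider H where "H \<in> facets (conn_bar \<Delta> F)" "indicator H \<le> m"
        | G where "G \<in> facets \<Delta> - C" "indicator G \<le> m" by (auto simp: A_def B_def)
      then show "\<exists>G\<in>facets \<Delta> - {F}. indicator (G - F) \<le> m"
      proof cases
        case (1 H)
        then obtain G where "facets_connected \<Delta> F G" "G \<noteq> F" "H = G - F" unfolding facets_conn_bar by blast
        then show ?thesis using 1(2) by (auto simp: facets_connected_def)
      next
        case (2 G)
        have "F \<in> C" using F by (simp add: C_def facets_connected_def)
        then show ?thesis using 2 by (intro bexI[of _ G]) (auto simp: indicator_le_iff)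
      qed
    qed
    finally show "(\<exists>a\<in>(\<lambda>w. w - ?F) ` M. a \<le> m) \<longleftrightarrow> (\<exists>a\<in>A \<union> B. a \<le> m)" .
  qed
  moreover have "betti (ideal_gen (monom ` (A \<union> B)) :: ('x, 'k) mpoly set) (i - 1) (j - int (card F)) =
    (\<Sum>l1 = 0..i - 1 + 1. \<Sum>l2 = 0..j - int (card F). betti (ideal_gen (monom ` A) :: ('x, 'k) mpoly set) (l1 - 1) l2 *
       betti (ideal_gen (monom ` B) :: ('x, 'k) mpoly set) (i - 1 - l1) (j - int (card F) - l2))"
  \<comment> \<open>The vertices of the component separate the variables: \<open>conn_bar\<close>
    lives on some of them, and the facets outside the component contain none.\<close>
  proof (rule betti_sum_coprime[where U = "\<Union>C"])
    show "finite A" "finite B" by (simp_all add: A_def B_def)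
    show "0 \<notin> B" using ind0 ne by (auto simp: B_def)
    \<comment> \<open>An empty set \<open>G - F\<close> would put the facet \<open>G\<close> inside
      \<open>F\<close>, against the maximality of facets.\<close>
    show "0 \<notin> A"
    proof
      assume "0 \<in> A"
      then obtain H where H: "H \<in> facets (conn_bar \<Delta> F)" "0 = (indicator H :: 'x monomial)"
        unfolding A_def by (rule imageE)
      then have "H = {}" using ind0[of H] by metis
      then have "{} \<in> (\<lambda>G. G - F) ` ({G. facets_connected \<Delta> F G} - {F})"
        using H(1) unfolding facets_conn_bar by simp
      then obtain G where "facets_connected \<Delta> F G" "G \<noteq> F" "G \<subseteq> F" by auto
      then show False using facets_antichain[of G \<Delta> F] F by (auto simp: facets_connected_def)
    qed
    show "i - 1 \<ge> -1" using assms(3) by simp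
    show "a x = 0" if a: "a \<in> A" and x: "x \<notin> \<Union>C" for a x
    proof -
      obtain H where H: "H \<in> facets (conn_bar \<Delta> F)" "a = indicator H" using a unfolding A_def by blast
      then obtain G where "G \<in> C" "H = G - F" unfolding facets_conn_bar C_def by blast
      then show ?thesis using x H by auto
    qed
    show "b x = 0" if b: "b \<in> B" and x: "x \<in> \<Union>C" for b x
    proof -
      obtain H where H: "H \<in> facets \<Delta>" "H \<notin> C" "b = indicator H" using b unfolding B_def by blast
      obtain G where "G \<in> C" "x \<in> G" using x by blast
      then have "x \<notin> H" using facets_connected_disjoint[of \<Delta> F G H] H by (auto simp: C_def)
      then show ?thesis using H by simp
    qed
  qed
  moreover have "facet_ideal k \<Delta> = ideal_gen (monom ` indicator ` facets \<Delta>)"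
    "facet_ideal k (delete_facet \<Delta> F) = ?K"
    "facet_ideal k (conn_bar \<Delta> F) = ideal_gen (monom ` A)"
    "facet_ideal k (delete_subcomplex \<Delta> (conn \<Delta> F)) = ideal_gen (monom ` B)"
    by (simp_all only: facet_ideal_def facets_delete_facet facets_delete_conn K_def A_def B_def C_def)
  moreover have "i - 1 + 1 = i" "i - 1 - l = i - l - 1" for l by simp_all
  ultimately show ?thesis by (simp only: mdeg_indicator)
qed

end
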